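(* Let $A$ be a von Neumann algebra. Then $K_0(A)$ is a subgroup of the group $N_0(A)$; that is, the map $K_0(A)\to N_0(A)$ sending $[p]-[q]$ (with $p,q\in M_\infty(A)$ projections) to $[p]-[q]$ is a well-defined injective group homomorphism.
   Context: $M_r(A)$ is the algebra of $r\times r$ matrices over the von Neumann algebra $A$, and $M_\infty(A)=\varinjlim M_r(A)$ is the inductive limit under $a\mapsto a\oplus 0$. $M_\infty(A)_\nu$ is the set of normal elements of $M_\infty(A)$. For projections $p,q\in M_\infty(A)$, $p\simeq q$ denotes stable equivalence: $1_n\oplus p$ and $1_n\oplus q$ are Murray–von Neumann equivalent for some $n$. $K_0(A)$ is the symmetrization (Grothendieck group) of the semigroup (under $\oplus$) of stable equivalence classes of projections in $M_\infty(A)$. For $a\in M_\infty(A)_\nu$ and a Borel set $E\subset\mathbf{C}$, $P_a(E)$ is the spectral projection of $a$ corresponding to $E$. A Borel set $E\subset\mathbf{C}$ is admissible if $0$ is not in the closure of $E$. Elements $a,b\in M_\infty(A)_\nu$ are called equivalent, $a\simeq b$, if $P_a(E)\simeq P_b(E)$ for all admissible Borel sets $E$ (for projections this coincides with stable equivalence). $\mathcal{N}(A)=M_\infty(A)_\nu/{\simeq}$, an abelian semigroup under direct sum, with $[a]$ the class of $a$; $N_0(A)$ is the symmetrization of $\mathcal{N}(A)$. *)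

theory Defs
  imports
    "HOL-Analysis.Analysis"
    "HOL-Algebra.Group"
    "HOL-Library.Groups_Big_Fun"
begin

text \<open>Complex Hilbert spaces. The complex inner product is linear in the first argument; its real
  part is the real inner product of the underlying real Hilbert space, which supplies positivity
  and the complete norm.\<close>

class complex_hilbert_space = real_inner + complete_space +
  fixes scaleC :: "complex \<Rightarrow> 'a \<Rightarrow> 'a"
    and cinner :: "'a \<Rightarrow> 'a \<Rightarrow> complex"
  assumes scaleC_add_right: "scaleC c (x + y) = scaleC c x + scaleC c y"
    and scaleC_add_left: "scaleC (c + d) x = scaleC c x + scaleC d x"
    and scaleC_scaleC: "scaleC c (scaleC d x) = scaleC (c * d) x"
    and scaleC_of_real: "scaleC (complex_of_real t) x = t *\<^sub>R x"
    and cinner_commute: "cinner x y = cnj (cinner y x)"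
    and cinner_add_left: "cinner (x + y) z = cinner x z + cinner y z"
    and cinner_scaleC_left: "cinner (scaleC c x) y = c * cinner x y"
    and inner_eq_Re_cinner: "inner x y = Re (cinner x y)"

text \<open>The type \<open>'h \<Rightarrow>\<^sub>L 'h\<close> contains all real-linear bounded operators; \<open>bounded_ops\<close> is the
  algebra $B(H)$ of complex-linear ones.\<close>

definition bounded_ops :: "('h::complex_hilbert_space \<Rightarrow>\<^sub>L 'h) set" where
  "bounded_ops = {T. \<forall>c x. blinfun_apply T (scaleC c x) = scaleC c (blinfun_apply T x)}"

definition op_adj :: "('h::complex_hilbert_space \<Rightarrow>\<^sub>L 'h) \<Rightarrow> ('h \<Rightarrow>\<^sub>L 'h)" where
  "op_adj T = (THE S. \<forall>x y. cinner (blinfun_apply T x) y = cinner x (blinfun_apply S y))"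

definition commutant :: "('h::complex_hilbert_space \<Rightarrow>\<^sub>L 'h) set \<Rightarrow> ('h \<Rightarrow>\<^sub>L 'h) set" where
  "commutant X = {T \<in> bounded_ops. \<forall>S\<in>X. T o\<^sub>L S = S o\<^sub>L T}"

text \<open>A von Neumann algebra is a self-adjoint set of operators equal to its bicommutant; being a
  commutant, it is then automatically a unital subalgebra of $B(H)$.\<close>

definition von_neumann_algebra :: "('h::complex_hilbert_space \<Rightarrow>\<^sub>L 'h) set \<Rightarrow> bool" where
  "von_neumann_algebra A \<longleftrightarrow>
     A \<subseteq> bounded_ops \<and> (\<forall>T\<in>A. op_adj T \<in> A) \<and> commutant (commutant A) = A"

text \<open>An \<open>r \<times> r\<close> matrix is stored as an infinite matrix vanishing outside the upper left
  \<open>r \<times> r\<close> corner. The embedding \<open>a \<mapsto> a \<oplus> 0\<close> of $M_r(A)$ into $M_{r+1}(A)$ is then an inclusion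
  and the inductive limit $M_\infty(A)$ is a union.\<close>

type_synonym 'h opmat = "nat \<Rightarrow> nat \<Rightarrow> ('h \<Rightarrow>\<^sub>L 'h)"

definition mats :: "nat \<Rightarrow> ('h::complex_hilbert_space \<Rightarrow>\<^sub>L 'h) set \<Rightarrow> 'h opmat set" where
  "mats r A = {a. (\<forall>i<r. \<forall>j<r. a i j \<in> A) \<and> (\<forall>i j. r \<le> i \<or> r \<le> j \<longrightarrow> a i j = 0)}"

definition mats_inf :: "('h::complex_hilbert_space \<Rightarrow>\<^sub>L 'h) set \<Rightarrow> 'h opmat set" where
  "mats_inf A = (\<Union>r. mats r A)"

definition mat_times :: "'h::complex_hilbert_space opmat \<Rightarrow> 'h opmat \<Rightarrow> 'h opmat" where
  "mat_times a b = (\<lambda>i j. Sum_any (\<lambda>k. a i k o\<^sub>L b k j))"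

definition mat_adj :: "'h::complex_hilbert_space opmat \<Rightarrow> 'h opmat" where
  "mat_adj a = (\<lambda>i j. op_adj (a j i))"

definition mat_zero :: "'h::complex_hilbert_space opmat" where
  "mat_zero = (\<lambda>i j. 0)"

definition mat_one :: "nat \<Rightarrow> 'h::complex_hilbert_space opmat" where
  "mat_one n = (\<lambda>i j. if i = j \<and> i < n then id_blinfun else 0)"

text \<open>\<open>dsum r a b\<close> is \<open>a \<oplus> b\<close> for \<open>a\<close> regarded as an \<open>r \<times> r\<close> matrix.\<close>

definition dsum :: "nat \<Rightarrow> 'h::complex_hilbert_space opmat \<Rightarrow> 'h opmat \<Rightarrow> 'h opmat" where
  "dsum r a b = (\<lambda>i j. if i < r \<and> j < r then a i j
                       else if r \<le> i \<and> r \<le> j then b (i - r) (j - r) else 0)"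

definition normals :: "('h::complex_hilbert_space \<Rightarrow>\<^sub>L 'h) set \<Rightarrow> 'h opmat set" where
  "normals A = {a \<in> mats_inf A. mat_times (mat_adj a) a = mat_times a (mat_adj a)}"

definition projs :: "('h::complex_hilbert_space \<Rightarrow>\<^sub>L 'h) set \<Rightarrow> 'h opmat set" where
  "projs A = {p \<in> mats_inf A. mat_times p p = p \<and> mat_adj p = p}"

definition mvn_equiv ::
    "('h::complex_hilbert_space \<Rightarrow>\<^sub>L 'h) set \<Rightarrow> 'h opmat \<Rightarrow> 'h opmat \<Rightarrow> bool" where
  "mvn_equiv A p q \<longleftrightarrow>
     (\<exists>v\<in>mats_inf A. mat_times (mat_adj v) v = p \<and> mat_times v (mat_adj v) = q)"

definition stable_equiv ::
    "('h::complex_hilbert_space \<Rightarrow>\<^sub>L 'h) set \<Rightarrow> 'h opmat \<Rightarrow> 'h opmat \<Rightarrow> bool" where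
  "stable_equiv A p q \<longleftrightarrow> (\<exists>n. mvn_equiv A (dsum n (mat_one n) p) (dsum n (mat_one n) q))"

text \<open>\<open>mat_form r a x y\<close> is $\langle ax, y\rangle$ in $H^r$. A vector of $H^r$ is given by any sequence,
  of which only the first \<open>r\<close> entries are used.\<close>

definition mat_form ::
    "nat \<Rightarrow> 'h::complex_hilbert_space opmat \<Rightarrow> (nat \<Rightarrow> 'h) \<Rightarrow> (nat \<Rightarrow> 'h) \<Rightarrow> complex" where
  "mat_form r a x y = (\<Sum>i<r. cinner (\<Sum>j<r. blinfun_apply (a i j) (x j)) (y i))"

text \<open>\<open>P\<close> is the spectral measure of \<open>a\<close> as an operator on $H^r$: a compactly supported
  projection-valued Borel measure with $a = \int z\,dP(z)$. The integral is understood weakly; by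
  polarization it suffices to use the finite positive measures $E \mapsto \langle P(E)x,x\rangle$.
  Compact support makes $z$ integrable for each of them.\<close>

definition spectral_measure ::
    "nat \<Rightarrow> 'h::complex_hilbert_space opmat \<Rightarrow> (complex set \<Rightarrow> 'h opmat) \<Rightarrow> bool" where
  "spectral_measure r a P \<longleftrightarrow>
     (\<forall>E\<in>sets borel. P E \<in> mats r bounded_ops \<and> P E \<in> projs bounded_ops) \<and>
     P {} = mat_zero \<and> P UNIV = mat_one r \<and>
     (\<forall>E\<in>sets borel. \<forall>F\<in>sets borel. P (E \<inter> F) = mat_times (P E) (P F)) \<and>
     (\<forall>F :: nat \<Rightarrow> complex set. range F \<subseteq> sets borel \<and> disjoint_family F \<longrightarrow>
        (\<forall>x y. (\<lambda>n. mat_form r (P (F n)) x y) sums mat_form r (P (\<Union>n. F n)) x y)) \<and>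
     (\<exists>R. P (cball 0 R) = mat_one r) \<and>
     (\<forall>x. mat_form r a x x =
        integral\<^sup>L (measure_of UNIV (sets borel) (\<lambda>E. ennreal (Re (mat_form r (P E) x x)))) (\<lambda>z. z))"

text \<open>The spectral measures of \<open>a\<close> on $H^r$ and on $H^s$ differ only by the contribution of the
  point \<open>0\<close>. Hence for Borel sets \<open>E\<close> not containing \<open>0\<close> the spectral projection does not depend on
  the size \<open>r\<close> chosen for \<open>a\<close>. For \<open>E\<close> containing \<open>0\<close> the value below is not meaningful.\<close>

definition spec_proj :: "'h::complex_hilbert_space opmat \<Rightarrow> complex set \<Rightarrow> 'h opmat" where
  "spec_proj a E = (THE p. \<exists>r P. a \<in> mats r bounded_ops \<and> spectral_measure r a P \<and> p = P E)"

definition admissible :: "complex set \<Rightarrow> bool" where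
  "admissible E \<longleftrightarrow> E \<in> sets borel \<and> 0 \<notin> closure E"

definition normal_equiv ::
    "('h::complex_hilbert_space \<Rightarrow>\<^sub>L 'h) set \<Rightarrow> 'h opmat \<Rightarrow> 'h opmat \<Rightarrow> bool" where
  "normal_equiv A a b \<longleftrightarrow>
     (\<forall>E. admissible E \<longrightarrow> stable_equiv A (spec_proj a E) (spec_proj b E))"

definition stable_rel :: "('h::complex_hilbert_space \<Rightarrow>\<^sub>L 'h) set \<Rightarrow> ('h opmat \<times> 'h opmat) set" where
  "stable_rel A = {(p, q). p \<in> projs A \<and> q \<in> projs A \<and> stable_equiv A p q}"

definition normal_rel :: "('h::complex_hilbert_space \<Rightarrow>\<^sub>L 'h) set \<Rightarrow> ('h opmat \<times> 'h opmat) set" where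
  "normal_rel A = {(a, b). a \<in> normals A \<and> b \<in> normals A \<and> normal_equiv A a b}"

text \<open>The quotient of \<open>X\<close> by \<open>R\<close> with the addition (written multiplicatively in the record)
  $[a] + [b] = [a \oplus b]$. The product is the union of the classes of \<open>a \<oplus> b\<close> over all
  representatives and all sizes \<open>r\<close> of \<open>a\<close>, so that it is a single class only if the addition is
  well defined.\<close>

definition dsum_monoid ::
    "('h::complex_hilbert_space \<Rightarrow>\<^sub>L 'h) set \<Rightarrow> 'h opmat set \<Rightarrow> ('h opmat \<times> 'h opmat) set \<Rightarrow>
     'h opmat set monoid" where
  "dsum_monoid A X R =
     \<lparr>carrier = X // R,
      mult = (\<lambda>C D. \<Union>a\<in>C. \<Union>b\<in>D. \<Union>r\<in>{r. a \<in> mats r A}. R `` {dsum r a b}),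
      one = R `` {mat_zero}\<rparr>"

definition proj_monoid :: "('h::complex_hilbert_space \<Rightarrow>\<^sub>L 'h) set \<Rightarrow> 'h opmat set monoid" where
  "proj_monoid A = dsum_monoid A (projs A) (stable_rel A)"

definition normal_monoid :: "('h::complex_hilbert_space \<Rightarrow>\<^sub>L 'h) set \<Rightarrow> 'h opmat set monoid" where
  "normal_monoid A = dsum_monoid A (normals A) (normal_rel A)"

text \<open>The symmetrization (Grothendieck group) of a commutative monoid; \<open>formal_diff M x y\<close> is its
  element $x - y$.\<close>

definition symm_rel :: "('a, 'm) monoid_scheme \<Rightarrow> (('a \<times> 'a) \<times> ('a \<times> 'a)) set" where
  "symm_rel M = {((x, y), (x', y')).
     x \<in> carrier M \<and> y \<in> carrier M \<and> x' \<in> carrier M \<and> y' \<in> carrier M \<and>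
     (\<exists>k\<in>carrier M. x \<otimes>\<^bsub>M\<^esub> y' \<otimes>\<^bsub>M\<^esub> k = x' \<otimes>\<^bsub>M\<^esub> y \<otimes>\<^bsub>M\<^esub> k)}"

definition formal_diff :: "('a, 'm) monoid_scheme \<Rightarrow> 'a \<Rightarrow> 'a \<Rightarrow> ('a \<times> 'a) set" where
  "formal_diff M x y = symm_rel M `` {(x, y)}"

definition symmetrization :: "('a, 'm) monoid_scheme \<Rightarrow> ('a \<times> 'a) set monoid" where
  "symmetrization M =
     \<lparr>carrier = (carrier M \<times> carrier M) // symm_rel M,
      mult = (\<lambda>C D. \<Union>(x, y)\<in>C. \<Union>(x', y')\<in>D. formal_diff M (x \<otimes>\<^bsub>M\<^esub> x') (y \<otimes>\<^bsub>M\<^esub> y')),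
      one = formal_diff M \<one>\<^bsub>M\<^esub> \<one>\<^bsub>M\<^esub>\<rparr>"

definition K0 ::
    "('h::complex_hilbert_space \<Rightarrow>\<^sub>L 'h) set \<Rightarrow> ('h opmat set \<times> 'h opmat set) set monoid" where
  "K0 A = symmetrization (proj_monoid A)"

definition N0 ::
    "('h::complex_hilbert_space \<Rightarrow>\<^sub>L 'h) set \<Rightarrow> ('h opmat set \<times> 'h opmat set) set monoid" where
  "N0 A = symmetrization (normal_monoid A)"

definition K0_diff ::
    "('h::complex_hilbert_space \<Rightarrow>\<^sub>L 'h) set \<Rightarrow> 'h opmat \<Rightarrow> 'h opmat \<Rightarrow>
     ('h opmat set \<times> 'h opmat set) set" where
  "K0_diff A p q = formal_diff (proj_monoid A) (stable_rel A `` {p}) (stable_rel A `` {q})"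

definition N0_diff ::
    "('h::complex_hilbert_space \<Rightarrow>\<^sub>L 'h) set \<Rightarrow> 'h opmat \<Rightarrow> 'h opmat \<Rightarrow>
     ('h opmat set \<times> 'h opmat set) set" where
  "N0_diff A a b = formal_diff (normal_monoid A) (normal_rel A `` {a}) (normal_rel A `` {b})"

end

theory Submission
  imports Defs
begin

text \<open>
  For a projection \<open>p\<close> and an admissible \<open>E\<close> the spectral projection $P_p(E)$ is \<open>p\<close> if \<open>1 \<in> E\<close> and \<open>0\<close>
  otherwise, so stably equivalent projections are equivalent as normal elements and the map is well
  defined. If \<open>p \<oplus> q' \<oplus> c\<close> and \<open>p' \<oplus> q \<oplus> c\<close> are equivalent for some normal \<open>c\<close>, then
  taking spectral projections for \<open>E = {1}\<close> gives the same relation with \<open>c\<close> replaced by the projection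
  $P_c(\{1\})$; this is injectivity.

  That direct sum is well defined on classes of normal elements rests on the spectral theorem for bounded
  normal operators. A self-adjoint contraction has a binary expansion whose digits are projections in its
  bicommutant, each split off by the sign of the operator. The digits of the real and
  imaginary parts of a normal operator commute, hence define a projection-valued measure on Cantor space, and
  the spectral measure is its image under the map that evaluates binary expansions.
  If \<open>S a = b S\<close>, then \<open>S\<close> intertwines the spectral measures of \<open>a\<close> and \<open>b\<close>: the operator
  $P_b(F) S P_a(E)$ vanishes when \<open>E\<close> and \<open>F\<close> are small compared with their distance. Applied to the
  identity this gives uniqueness of spectral measures; applied to the embeddings of the summands it gives
  $P_{a \oplus b}(E) = P_a(E) \oplus P_b(E)$. Spectral projections lie in the matrix algebra because they commute
  with everything that commutes with the operator and its adjoint.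
\<close>

subsection \<open>Operators on real Hilbert spaces\<close>

text \<open>The operator type consists of real-linear maps, so projections are constructed over a
  real Hilbert space and complex linearity is recovered as commutation with the scalars. For that
  reason the constructions carry the clause that whatever commutes with the input commutes with the
  output; this one clause serves for the mutual commutation of the digits, for complex linearity and
  for the return to matrices of finite size.

  \<open>spec_proj\<close> is a definite description that ranges over all sizes of a matrix. It has
  a value only once uniqueness is known across different sizes, which is why all matrices are made
  to act on one space. Admissible sets avoid the point 0, at which the spectral projection does
  change with the size.\<close>

abbreviation sym_op :: "('a::real_inner \<Rightarrow>\<^sub>L 'a) \<Rightarrow> bool" where
  "sym_op T \<equiv> \<forall>x y. inner (T x) y = inner x (T y)"

abbreviation commutes :: "('a::real_normed_vector \<Rightarrow>\<^sub>L 'a) \<Rightarrow> ('a \<Rightarrow>\<^sub>L 'a) \<Rightarrow> bool" where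
  "commutes S T \<equiv> S o\<^sub>L T = T o\<^sub>L S"

lemma commutesD: "commutes S T \<Longrightarrow> S (T x) = T (S x)"
  by (metis blinfun_apply_blinfun_compose)

lemma commutesI: "(\<And>x. blinfun_apply S (blinfun_apply T x) = T (S x)) \<Longrightarrow> commutes S T"
  by (simp add: blinfun_eqI)

lemma sym_opD: "sym_op T \<Longrightarrow> inner (T x) y = inner x (T y)"
  by blast

lemma commutes_comp: "commutes S T \<Longrightarrow> commutes S U \<Longrightarrow> commutes S (T o\<^sub>L U)"
  by (rule commutesI) (simp add: commutesD[of S T] commutesD[of S U])

lemma blinfun_compose_assoc: "(R o\<^sub>L S) o\<^sub>L T = R o\<^sub>L (S o\<^sub>L T)"
  by (simp add: blinfun_eqI)

interpretation blinfun_compose: bounded_bilinear blinfun_compose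
  by (rule bounded_bilinear_blinfun_compose)

lemmas comp_simps = blinfun_compose.add_left blinfun_compose.add_right
  blinfun_compose.diff_left blinfun_compose.diff_right
  blinfun_compose.minus_left blinfun_compose.minus_right
  blinfun_compose.scaleR_left blinfun_compose.scaleR_right
  blinfun_compose.zero_left blinfun_compose.zero_right

lemma blinfun_compose_id [simp]: "T o\<^sub>L id_blinfun = T" "id_blinfun o\<^sub>L T = T"
  by (simp_all add: blinfun_eqI)

lemmas blin_simps = blinfun.add_left blinfun.add_right blinfun.diff_left blinfun.diff_right
  blinfun.minus_left blinfun.minus_right blinfun.scaleR_left blinfun.scaleR_right
  blinfun.zero_left blinfun.zero_right

text \<open>Minimising \<open>\<parallel>m\<parallel>\<^sup>2 - 2 f m\<close> over \<open>M\<close>: a minimising sequence is Cauchy by the parallelogram law.\<close>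

lemma riesz_on_subspace:
  fixes M :: "'a::{real_inner,banach} set"
  assumes f: "bounded_linear f" and M: "closed M" "subspace M"
  obtains m where "m \<in> M" "\<And>y. y \<in> M \<Longrightarrow> f y = inner m y"
proof -
  interpret f: bounded_linear f by fact
  \<comment> \<open>Up to a constant, \<open>g m\<close> is the squared distance from
    \<open>m\<close> to the representing vector of \<open>f\<close>.\<close>
  define g where "g m = inner m m - 2 * f m" for m
  obtain K where K: "\<And>x. norm (f x) \<le> norm x * K"
    using f.bounded by blast
  have lower: "- K\<^sup>2 \<le> g m" for m
  proof -
    have "f m \<le> norm m * K" using K[of m] by simp
    moreover have "0 \<le> (norm m - K)\<^sup>2" by simp
    ultimately show ?thesis
      unfolding g_def by (simp add: power2_diff power2_norm_eq_inner)
  qed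
  have M0: "0 \<in> M" using M(2) by (rule subspace_0)
  define d where "d = Inf (g ` M)"
  have bdd: "bdd_below (g ` M)" using lower by (intro bdd_belowI2)
  have d_le: "d \<le> g m" if "m \<in> M" for m
    unfolding d_def using that bdd by (intro cInf_lower) auto
  have "\<exists>m\<in>M. g m < d + 1 / real (Suc n)" for n
    using cInf_lessD[of "g ` M" "d + 1 / real (Suc n)"] M0 unfolding d_def by auto
  then obtain s where s: "\<And>n. s n \<in> M" "\<And>n. g (s n) < d + 1 / real (Suc n)"
    by metis
  have para: "(norm (x - y))\<^sup>2 = 2 * g x + 2 * g y - 4 * g ((1/2) *\<^sub>R (x + y))" for x y
    unfolding g_def
    by (simp add: power2_norm_eq_inner f.add f.scaleR inner_add_left inner_add_right
        inner_diff_left inner_diff_right inner_commute algebra_simps)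
  have close: "(norm (s m - s n))\<^sup>2 \<le> 2 / real (Suc m) + 2 / real (Suc n)" for m n
  proof -
    have "(1/2) *\<^sub>R (s m + s n) \<in> M"
      using s(1) M(2) by (intro subspace_scale subspace_add) auto
    from d_le[OF this] show ?thesis
      unfolding para using s(2)[of m] s(2)[of n] by simp
  qed
  have "Cauchy s"
  proof (rule metric_CauchyI)
    fix e :: real assume e: "e > 0"
    obtain N :: nat where N: "N > 0" "1 / real N < e\<^sup>2 / 4"
      using real_arch_inverse[of "e\<^sup>2 / 4"] e by (auto simp: inverse_eq_divide)
    have "dist (s m) (s n) < e" if "m \<ge> N" "n \<ge> N" for m n
    proof -
      have "1 / real (Suc m) \<le> 1 / real N" "1 / real (Suc n) \<le> 1 / real N"
        using that N(1) by (auto intro!: divide_left_mono)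
      then have "(norm (s m - s n))\<^sup>2 < e\<^sup>2"
        using close[of m n] N(2) by simp
      then show ?thesis
        using e by (simp add: dist_norm power_less_imp_less_base)
    qed
    then show "\<exists>N. \<forall>m\<ge>N. \<forall>n\<ge>N. dist (s m) (s n) < e" by blast
  qed
  then obtain m where lim: "s \<longlonglongrightarrow> m"
    using Cauchy_convergent convergent_def by blast
  have mM: "m \<in> M" using M(1) s(1) lim closed_sequentially by blast
  have "(\<lambda>n. g (s n)) \<longlonglongrightarrow> g m"
    unfolding g_def by (intro tendsto_intros lim f.tendsto)
  moreover have "(\<lambda>n. d + 1 / real (Suc n)) \<longlonglongrightarrow> d + 0"
    by (intro tendsto_intros LIMSEQ_Suc lim_1_over_n)
  ultimately have "g m \<le> d + 0"
    by (rule LIMSEQ_le) (use s(2) less_imp_le in blast)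
  then have gm: "g m = d" using d_le[OF mM] by simp
  have "f y = inner m y" if y: "y \<in> M" for y
  proof -
    define b where "b = inner m y - f y"
    have quad: "0 \<le> t\<^sup>2 * inner y y + 2 * t * b" for t
    proof -
      have "m + t *\<^sub>R y \<in> M" using mM y M(2) by (intro subspace_add subspace_scale)
      from d_le[OF this] show ?thesis
        unfolding gm[symmetric] g_def b_def
        by (simp add: f.add f.scaleR inner_add_left inner_add_right inner_commute
            algebra_simps power2_eq_square)
    qed
    have "b = 0"
    proof (cases "inner y y = 0")
      case True
      then show ?thesis using quad[of "- b"] by (auto simp: mult_le_0_iff)
    next
      case False
      then have p: "inner y y > 0" using inner_ge_zero[of y] by linarith
      \<comment> \<open>The vertex of the quadratic in \<open>t\<close>, where its value is negative
        unless \<open>b = 0\<close>.\<close>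
      have "(- b / inner y y)\<^sup>2 * inner y y + 2 * (- b / inner y y) * b = - (b\<^sup>2 / inner y y)"
        using False by (simp add: power2_eq_square field_simps)
      with quad[of "- b / inner y y"] have "b\<^sup>2 / inner y y \<le> 0" by simp
      then show ?thesis using p by (simp add: divide_le_0_iff)
    qed
    then show ?thesis by (simp add: b_def)
  qed
  with mM that show ?thesis by blast
qed

text \<open>The functional \<open>inner x\<close> restricted to \<open>M\<close> has a unique
  representing vector in \<open>M\<close>, the image of \<open>x\<close>. Uniqueness makes the
  assignment linear, and pairing with the image itself bounds its norm.\<close>

lemma orthogonal_projection_exists:
  fixes M :: "'a::{real_inner,banach} set"
  assumes M: "closed M" "subspace M"
  obtains e :: "'a \<Rightarrow>\<^sub>L 'a" where "sym_op e" "\<And>x. e x \<in> M" "\<And>x. x \<in> M \<Longrightarrow> e x = x"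
proof -
  have "\<exists>m\<in>M. \<forall>y\<in>M. inner x y = inner m y" for x
    using riesz_on_subspace[OF bounded_linear_inner_right M, of x] by metis
  then obtain p where p: "\<And>x. p x \<in> M" "\<And>x y. y \<in> M \<Longrightarrow> inner x y = inner (p x) y"
    by metis
  have uniq: "p x = m" if "m \<in> M" "\<And>y. y \<in> M \<Longrightarrow> inner x y = inner m y" for x m
  proof -
    have "p x - m \<in> M" using p(1) that(1) M(2) by (rule subspace_diff[rotated 1])
    then have "inner (p x - m) (p x - m) = 0"
      using p(2)[of "p x - m" x] that(2)[of "p x - m"] by (simp add: inner_diff_left)
    then show ?thesis by simp
  qed
  have nrm: "norm (p x) \<le> norm x" for x
  proof -
    have "norm (p x) * norm (p x) = inner x (p x)"
      using p(2)[OF p(1), of x x] by (simp flip: power2_norm_eq_inner add: power2_eq_square)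
    also have "\<dots> \<le> norm x * norm (p x)" by (rule norm_cauchy_schwarz)
    finally show ?thesis by (cases "norm (p x) = 0") auto
  qed
  have bl: "bounded_linear p"
  proof (rule bounded_linear_intro[where K = 1])
    show "p (x + y) = p x + p y" for x y
      by (rule uniq) (use p(1) M(2) in \<open>simp_all add: subspace_add inner_add_left p(2)[symmetric]\<close>)
    show "p (r *\<^sub>R x) = r *\<^sub>R p x" for r x
      by (rule uniq) (use p(1) M(2) in \<open>simp_all add: subspace_scale p(2)[symmetric]\<close>)
  qed (use nrm in simp)
  show ?thesis
  proof (rule that[of "Blinfun p"])
    have "inner (p x) y = inner x (p y)" for x y
      using p(2)[OF p(1), of y x] p(2)[OF p(1), of x y] by (simp add: inner_commute)
    then show "sym_op (Blinfun p)" using bl by (simp add: bounded_linear_Blinfun_apply)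
    show "Blinfun p x \<in> M" for x using bl p(1) by (simp add: bounded_linear_Blinfun_apply)
    show "Blinfun p x = x" if "x \<in> M" for x
      using uniq[OF that] bl by (simp add: bounded_linear_Blinfun_apply)
  qed
qed

text \<open>Riesz representation of \<open>inner (T x) y\<close> as a functional of \<open>x\<close>
  on the whole space. The adjoint serves to move an operator across an inner product and to turn
  invariance of a subspace into commutation.\<close>

lemma adjoint_exists:
  fixes T :: "'a::{real_inner,banach} \<Rightarrow>\<^sub>L 'a"
  obtains S :: "'a \<Rightarrow>\<^sub>L 'a" where "\<And>x y. inner (T x) y = inner x (S y)"
proof -
  have "\<exists>m. \<forall>x. inner (T x) y = inner m x" for y
  proof -
    have "bounded_linear (\<lambda>x. inner (T x) y)"
      by (intro bounded_linear_intros)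
    then show ?thesis
      by (rule riesz_on_subspace[of _ UNIV]) auto
  qed
  then obtain s where s: "\<And>x y. inner (T x) y = inner (s y) x" by metis
  have uniq: "s y = z" if "\<And>x. inner (T x) y = inner z x" for y z
    using that s by (metis inner_commute vector_eq_rdot)
  have bl: "bounded_linear s"
  proof (rule bounded_linear_intro[where K = "norm T"])
    show "s (x + y) = s x + s y" for x y
      by (rule uniq) (simp add: inner_add_right inner_add_left s)
    show "s (r *\<^sub>R x) = r *\<^sub>R s x" for r x
      by (rule uniq) (simp add: s)
    show "norm (s x) \<le> norm x * norm T" for x
    proof -
      have "norm (s x) * norm (s x) = inner (T (s x)) x"
        by (simp add: s flip: power2_norm_eq_inner power2_eq_square)
      also have "\<dots> \<le> norm (T (s x)) * norm x" by (rule norm_cauchy_schwarz)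
      also have "\<dots> \<le> (norm T * norm (s x)) * norm x"
        by (intro mult_right_mono norm_blinfun) simp
      finally have "norm (s x) * norm (s x) \<le> (norm x * norm T) * norm (s x)"
        by (simp add: ac_simps)
      then show ?thesis by (cases "norm (s x) = 0") auto
    qed
  qed
  have "inner (T x) y = inner x (Blinfun s y)" for x y
    using s[of x y] bl by (simp add: bounded_linear_Blinfun_apply inner_commute)
  then show ?thesis by (rule that)
qed

section \<open>Quadratic forms, square roots and signs of symmetric operators\<close>

text \<open>Polarisation: for a symmetric difference the two cross terms of the form at
  \<open>x + y\<close> coincide, so they vanish with the form. Operators obtained from measures are
  identified in this way by their diagonal values.\<close>

lemma sym_op_form_eqI:
  assumes "sym_op S" "sym_op T" "\<And>x. inner (S x) x = inner (T x) x"
  shows "S = T"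
proof -
  define D where "D = S - T"
  have D: "sym_op D" "\<And>x. inner (D x) x = 0"
    using assms by (auto simp: D_def blin_simps inner_diff_left inner_diff_right)
  have "inner (D x) y = 0" for x y
  proof -
    have "inner (D (x + y)) (x + y) = inner (D x) y + inner (D y) x"
      using D(2)[of x] D(2)[of y] by (simp add: blin_simps inner_add_left inner_add_right)
    also have "inner (D y) x = inner (D x) y" using D(1) by (simp add: inner_commute)
    finally show ?thesis using D(2)[of "x + y"] by simp
  qed
  then have "D x = 0" for x by (metis inner_eq_zero_iff)
  then show ?thesis by (intro blinfun_eqI) (simp add: D_def blin_simps)
qed

text \<open>The Cauchy-Schwarz inequality of the semidefinite form \<open>inner (T x) y\<close>,
  taken at \<open>y = T x\<close>; as an operator inequality it says that the square of
  \<open>T\<close> is at most \<open>T\<close>.\<close>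

lemma positive_contraction_norm_le:
  assumes T: "sym_op T" "\<And>x. 0 \<le> inner (T x) x" "\<And>x. inner (T x) x \<le> inner x x"
  shows "(norm (T x))\<^sup>2 \<le> inner (T x) x"
proof -
  have CS: "(inner (T x) y)\<^sup>2 \<le> inner (T x) x * inner (T y) y" for x y
  proof -
    have quad: "0 \<le> t\<^sup>2 * inner (T x) x + 2 * t * inner (T x) y + inner (T y) y" for t
      using T(2)[of "t *\<^sub>R x + y"] T(1)
      by (simp add: blin_simps inner_add_left inner_add_right inner_commute power2_eq_square algebra_simps)
    show ?thesis
    proof (cases "inner (T x) x = 0")
      case True
      have "inner (T x) y = 0"
      proof (rule ccontr)
        assume n: "inner (T x) y \<noteq> 0"
        \<comment> \<open>This \<open>t\<close> gives the expression, which is affine in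
          \<open>t\<close> here, the value -1.\<close>
        show False
          using quad[of "- (inner (T y) y + 1) / (2 * inner (T x) y)"] True n
          by (simp add: field_simps)
      qed
      then show ?thesis using True by simp
    next
      case False
      then have p: "inner (T x) x > 0" using T(2)[of x] by simp
      let ?t = "- inner (T x) y / inner (T x) x"
      have "?t\<^sup>2 * inner (T x) x + 2 * ?t * inner (T x) y + inner (T y) y
          = inner (T y) y - (inner (T x) y)\<^sup>2 / inner (T x) x"
        using p by (simp add: field_simps power2_eq_square)
      with quad[of ?t] have "(inner (T x) y)\<^sup>2 / inner (T x) x \<le> inner (T y) y" by simp
      then show ?thesis using p by (simp add: pos_divide_le_eq mult.commute)
    qed
  qed
  have "(inner (T x) (T x))\<^sup>2 \<le> inner (T x) x * inner (T x) (T x)"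
    using CS[of x "T x"] T(3)[of "T x"] T(2)[of x] by (meson mult_left_mono order_trans)
  then show ?thesis
    unfolding power2_norm_eq_inner
    by (cases "inner (T x) (T x) = 0") (use T(2)[of x] in \<open>auto simp: power2_eq_square mult_le_cancel_right\<close>)
qed

text \<open>For \<open>X = 1 - b\<^sup>2\<close> the operator \<open>1 - Y\<close> is a square root of \<open>b\<^sup>2\<close>. The increments of the iteration
  \<open>y \<mapsto> (X + y\<^sup>2)/2\<close> are bounded in norm by those of \<open>t \<mapsto> (1 + t\<^sup>2)/2\<close>.\<close>

lemma blinfun_square_root:
  fixes X :: "'a::{real_inner,banach} \<Rightarrow>\<^sub>L 'a"
  assumes X: "norm X \<le> 1" "sym_op X"
  obtains Y where "norm Y \<le> 1" "sym_op Y" "2 *\<^sub>R Y = X + (Y o\<^sub>L Y)"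
    "\<And>S. commutes S X \<Longrightarrow> commutes S Y"
proof -
  define y where "y = rec_nat 0 (\<lambda>_ Y. (1/2) *\<^sub>R (X + (Y o\<^sub>L Y)))"
  define t where "t = rec_nat 0 (\<lambda>_ s :: real. (1 + s\<^sup>2) / 2)"
  have y0: "y 0 = 0" and yS: "y (Suc n) = (1/2) *\<^sub>R (X + (y n o\<^sub>L y n))" for n
    by (simp_all add: y_def)
  have t0: "t 0 = 0" and tS: "t (Suc n) = (1 + (t n)\<^sup>2) / 2" for n
    by (simp_all add: t_def)
  have t01: "0 \<le> t n \<and> t n \<le> 1" for n
    by (induction n) (auto simp: t0 tS power_le_one)
  have com: "commutes S (y n)" if "commutes S X" for S n
  proof (induction n)
    case 0
    then show ?case by (simp add: y0)
  next
    case (Suc n)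
    have "S o\<^sub>L (y n o\<^sub>L y n) = (y n o\<^sub>L y n) o\<^sub>L S"
      using Suc by (metis blinfun_compose_assoc)
    then show ?case using that by (simp add: yS comp_simps)
  qed
  have sym: "sym_op (y n)" for n
    by (induction n) (auto simp: y0 yS blin_simps inner_add_left inner_add_right X(2))
  \<comment> \<open>\<open>X\<close> commutes with itself, so every iterate commutes with
    \<open>X\<close> and hence with every other iterate. This permits factoring the difference of
    squares in the increments.\<close>
  have comy: "commutes (y m) (y n)" for m n
    by (rule com) (rule com[symmetric], simp)
  have ny: "norm (y n) \<le> t n" for n
  proof (induction n)
    case 0
    then show ?case by (simp add: y0 t0)
  next
    case (Suc n)
    have "norm (y n o\<^sub>L y n) \<le> norm (y n) * norm (y n)" by (rule norm_blinfun_compose)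
    also have "\<dots> \<le> t n * t n" using Suc t01[of n] by (intro mult_mono) auto
    finally have "norm (X + (y n o\<^sub>L y n)) \<le> 1 + (t n)\<^sup>2"
      using X(1) by (intro order.trans[OF norm_triangle_ineq] add_mono) (auto simp: power2_eq_square)
    then show ?case by (simp add: yS tS)
  qed
  have step: "norm (y (Suc n) - y n) \<le> t (Suc n) - t n" for n
  proof (induction n)
    case 0
    then show ?case using X(1) by (simp add: y0 yS t0 tS)
  next
    case (Suc n)
    have "y (Suc (Suc n)) - y (Suc n) = (1/2) *\<^sub>R ((y (Suc n) + y n) o\<^sub>L (y (Suc n) - y n))"
      unfolding yS[of "Suc n"] by (subst (3) yS) (simp add: comp_simps comy[of n "Suc n"] algebra_simps)
    also have "norm \<dots> \<le> (1/2) * (norm (y (Suc n) + y n) * norm (y (Suc n) - y n))"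
      using norm_blinfun_compose[of "y (Suc n) + y n" "y (Suc n) - y n"] by simp
    also have "\<dots> \<le> (1/2) * ((t (Suc n) + t n) * (t (Suc n) - t n))"
      using Suc ny[of n] ny[of "Suc n"] t01[of n] t01[of "Suc n"] norm_triangle_ineq[of "y (Suc n)" "y n"]
      by (intro mult_left_mono mult_mono) auto
    also have "\<dots> = t (Suc (Suc n)) - t (Suc n)"
      by (simp add: tS field_simps power2_eq_square)
    finally show ?case .
  qed
  have diff: "norm (y (m + k) - y m) \<le> t (m + k) - t m" for m k
  proof (induction k)
    case (Suc k)
    have "norm (y (m + Suc k) - y m) \<le> norm (y (Suc (m + k)) - y (m + k)) + norm (y (m + k) - y m)"
      using norm_triangle_ineq[of "y (Suc (m + k)) - y (m + k)" "y (m + k) - y m"] by simp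
    then show ?case using step[of "m + k"] Suc by simp
  qed simp
  have tinc: "t n \<le> t (Suc n)" for n
    using step[of n] norm_ge_zero order_trans by (metis diff_ge_0_iff_ge)
  have "convergent t"
    using t01 tinc by (intro Bseq_monoseq_convergent BseqI'[where K = 1] incseq_imp_monoseq incseq_SucI)
      auto
  then have tC: "Cauchy t" by (simp add: Cauchy_convergent_iff)
  have "Cauchy y"
  proof (rule metric_CauchyI)
    fix e :: real assume "e > 0"
    then obtain N where N: "\<And>m n. m \<ge> N \<Longrightarrow> n \<ge> N \<Longrightarrow> dist (t m) (t n) < e"
      using tC by (meson metric_CauchyD)
    have main: "dist (y m) (y n) < e" if "m \<ge> n" "n \<ge> N" for m n
      using diff[of n "m - n"] N[of m n] that by (simp add: dist_norm dist_real_def abs_less_iff)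
    have "dist (y m) (y n) < e" if "m \<ge> N" "n \<ge> N" for m n
      using main[of m n] main[of n m] that by (cases "m \<ge> n") (auto simp: dist_commute)
    then show "\<exists>N. \<forall>m\<ge>N. \<forall>n\<ge>N. dist (y m) (y n) < e" by blast
  qed
  then obtain Y where Y: "y \<longlonglongrightarrow> Y"
    using Cauchy_convergent convergent_def by blast
  have Yx: "(\<lambda>n. y n x) \<longlonglongrightarrow> Y x" for x
    using Y by (intro tendsto_intros)
  have lim: "(\<lambda>n. (1/2) *\<^sub>R (X + (y n o\<^sub>L y n))) \<longlonglongrightarrow> (1/2) *\<^sub>R (X + (Y o\<^sub>L Y))"
    by (intro tendsto_intros blinfun_compose.tendsto Y)
  have "(\<lambda>n. y (Suc n)) \<longlonglongrightarrow> Y" using Y by (rule LIMSEQ_Suc)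
  then have "Y = (1/2) *\<^sub>R (X + (Y o\<^sub>L Y))"
    using lim unfolding yS by (rule LIMSEQ_unique)
  then have "2 *\<^sub>R Y = 2 *\<^sub>R ((1/2) *\<^sub>R (X + (Y o\<^sub>L Y)))" by (rule arg_cong)
  then have eq: "2 *\<^sub>R Y = X + (Y o\<^sub>L Y)" by simp
  show ?thesis
  proof (rule that[OF _ _ eq])
    show "norm Y \<le> 1"
    proof (rule LIMSEQ_le_const2[OF tendsto_norm[OF Y]])
      show "\<exists>N. \<forall>n\<ge>N. norm (y n) \<le> 1" using order_trans[OF ny] t01 by auto
    qed
    show "sym_op Y"
    proof (intro allI)
      fix u v
      have "(\<lambda>n. inner (y n u) v) \<longlonglongrightarrow> inner (Y u) v" by (intro tendsto_intros Yx)
      moreover have "(\<lambda>n. inner (y n u) v) \<longlonglongrightarrow> inner u (Y v)"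
        using sym by (simp add: tendsto_inner Yx)
      ultimately show "inner (Y u) v = inner u (Y v)" by (rule LIMSEQ_unique)
    qed
    show "commutes S Y" if "commutes S X" for S
    proof -
      have "(\<lambda>n. S o\<^sub>L y n) \<longlonglongrightarrow> (S o\<^sub>L Y)" by (intro blinfun_compose.tendsto Y tendsto_const)
      moreover have "(\<lambda>n. S o\<^sub>L y n) \<longlonglongrightarrow> (Y o\<^sub>L S)"
        unfolding com[OF that] by (intro blinfun_compose.tendsto Y tendsto_const)
      ultimately show ?thesis by (rule LIMSEQ_unique)
    qed
  qed
qed

lemma norm_le_if_square_le: "(norm x)\<^sup>2 \<le> (norm y)\<^sup>2 \<Longrightarrow> norm x \<le> norm y"
  by (rule power2_le_imp_le) simp_all

lemma sym_op_norm_square: "sym_op T \<Longrightarrow> (norm (T x))\<^sup>2 = inner (T (T x)) x"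
  by (simp add: power2_norm_eq_inner)

lemma norm_blinfun_le_1: "norm (T :: _ \<Rightarrow>\<^sub>L _) \<le> 1 \<Longrightarrow> norm (T x) \<le> norm x"
  by (metis mult_1 mult_right_mono norm_blinfun norm_ge_zero order_trans)

text \<open>With \<open>s = |b|\<close>, the projection \<open>e\<close> onto \<open>ker (s - b)\<close> splits \<open>b\<close> into its positive and negative parts.\<close>

lemma sign_operator:
  fixes b :: "'a::{real_inner,banach} \<Rightarrow>\<^sub>L 'a"
  assumes b: "norm b \<le> 1" "sym_op b"
  obtains e where "sym_op e" "e o\<^sub>L e = e" "\<And>S. commutes S b \<Longrightarrow> commutes S e"
    "norm (2 *\<^sub>R b - (2 *\<^sub>R e - id_blinfun)) \<le> 1"
proof -
  define X where "X = id_blinfun - (b o\<^sub>L b)"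
  have Xx: "X x = x - b (b x)" for x by (simp add: X_def blin_simps)
  have nb: "norm (b x) \<le> norm x" for x using b(1) by (rule norm_blinfun_le_1)
  have symX: "sym_op X" using b(2) by (simp add: Xx inner_diff_left inner_diff_right)
  have "norm X \<le> 1"
  proof (rule norm_blinfun_bound)
    fix x
    have "(norm (X x))\<^sup>2 = (norm x)\<^sup>2 - 2 * (norm (b x))\<^sup>2 + (norm (b (b x)))\<^sup>2"
      using b(2) by (simp add: Xx power2_norm_eq_inner inner_diff_left inner_diff_right inner_commute)
    moreover have "(norm (b (b x)))\<^sup>2 \<le> (norm (b x))\<^sup>2" using nb by (simp add: power_mono)
    ultimately have "(norm (X x))\<^sup>2 \<le> (norm x)\<^sup>2"
      using zero_le_power2[of "norm (b x)"] by linarith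
    then show "norm (X x) \<le> 1 * norm x" by (simp add: norm_le_if_square_le)
  qed simp
  from this symX obtain Y where Y: "norm Y \<le> 1" "sym_op Y" "2 *\<^sub>R Y = X + (Y o\<^sub>L Y)"
    and Ycom: "\<And>S. commutes S X \<Longrightarrow> commutes S Y"
    by (rule blinfun_square_root) blast
  \<comment> \<open>Completing the square in \<open>2 Y = X + Y Y\<close> gives
    \<open>(1 - Y) (1 - Y) = 1 - X = b b\<close>. Since \<open>Y\<close> is a contraction,
    \<open>1 - Y\<close> is positive, so \<open>s\<close> is the absolute value of
    \<open>b\<close>.\<close>
  define s where "s = id_blinfun - Y"
  have sx: "s x = x - Y x" for x by (simp add: s_def blin_simps)
  have syms: "sym_op s" using Y(2) by (simp add: sx inner_diff_left inner_diff_right)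
  have ss: "s (s x) = b (b x)" for x
  proof -
    have "2 *\<^sub>R Y x = x - b (b x) + Y (Y x)"
      using arg_cong[OF Y(3), of "\<lambda>T. blinfun_apply T x"] by (simp add: blin_simps Xx)
    then show ?thesis by (simp add: sx blin_simps algebra_simps scaleR_2)
  qed
  have scom: "commutes S s" if "commutes S b" for S
  proof -
    have "commutes S X"
      by (rule commutesI) (simp add: Xx blin_simps commutesD[OF that])
    then have "commutes S Y" by (rule Ycom)
    then show ?thesis by (simp add: s_def comp_simps)
  qed
  have sb: "s (b x) = b (s x)" for x using commutesD[OF scom[of b]] by simp
  have sle: "inner (s x) x \<le> inner x x" and spos: "0 \<le> inner (s x) x" for x
  proof -
    have "\<bar>inner (Y x) x\<bar> \<le> norm (Y x) * norm x" by (rule Cauchy_Schwarz_ineq2)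
    also have "\<dots> \<le> norm x * norm x" by (intro mult_right_mono norm_blinfun_le_1 Y) simp
    finally have a: "\<bar>inner (Y x) x\<bar> \<le> inner x x" by (simp flip: power2_norm_eq_inner add: power2_eq_square)
    then show "0 \<le> inner (s x) x" by (simp add: sx inner_diff_left)
    have "(norm (s x))\<^sup>2 \<le> (norm x)\<^sup>2"
      using nb[of x] b(2) ss syms by (metis norm_ge_zero power_mono sym_op_norm_square)
    then have "norm (s x) \<le> norm x" by (rule norm_le_if_square_le)
    then have "inner (s x) x \<le> norm x * norm x"
      by (meson mult_right_mono norm_cauchy_schwarz norm_ge_zero order_trans)
    then show "inner (s x) x \<le> inner x x" by (simp flip: power2_norm_eq_inner add: power2_eq_square)
  qed
  define M where "M = {x. s x = b x}"
  have "closed M" unfolding M_def by (intro closed_Collect_eq continuous_intros)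
  moreover have "subspace M" unfolding M_def by (auto simp: subspace_def blin_simps)
  ultimately obtain e where e: "sym_op e" "\<And>x. e x \<in> M" "\<And>x. x \<in> M \<Longrightarrow> e x = x"
    by (rule orthogonal_projection_exists) blast
  have ee: "e (e x) = e x" for x using e(2,3) by blast
  have eM: "s (e x) = b (e x)" for x using e(2) by (simp add: M_def)
  have ecom: "commutes S e" if S: "commutes S b" for S
  proof -
    \<comment> \<open>Both \<open>S\<close> and its adjoint commute with \<open>b\<close> and so
      leave \<open>M\<close> invariant. Invariance under the pair gives commutation with the
      projection onto \<open>M\<close>.\<close>
    obtain S' :: "'a \<Rightarrow>\<^sub>L 'a" where S': "\<And>x y. inner (S x) y = inner x (S' y)" using adjoint_exists by blast
    have S'b: "commutes S' b"
    proof (rule commutesI)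
      fix x
      have "inner y (S' (b x)) = inner y (b (S' x))" for y
      proof -
        have "inner y (S' (b x)) = inner (b (S y)) x" using b(2) S' by (simp only:)
        also have "\<dots> = inner (S (b y)) x" by (simp only: commutesD[OF S])
        also have "\<dots> = inner y (b (S' x))" using b(2) S' by (simp only:)
        finally show ?thesis .
      qed
      then show "S' (b x) = b (S' x)" using vector_eq_ldot by blast
    qed
    have inv: "e (T (e x)) = T (e x)" if "commutes T b" for T x
    proof -
      have "T (e x) \<in> M"
        unfolding M_def using commutesD[OF that, of "e x"] commutesD[OF scom[OF that], of "e x"]
        by (simp only: eM mem_Collect_eq)
      then show ?thesis by (rule e(3))
    qed
    show ?thesis
    proof (rule commutesI)
      fix x
      have "inner (e (S x)) y = inner (S (e x)) y" for y
      proof -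
        have "inner (e (S x)) y = inner x (S' (e y))" using e(1) S' by (simp only:)
        also have "\<dots> = inner x (e (S' (e y)))" using inv[OF S'b] by simp
        also have "\<dots> = inner (e (S (e x))) y" using e(1) S' by (simp only:)
        finally show ?thesis using inv[OF S] by simp
      qed
      then show "S (e x) = e (S x)" using vector_eq_rdot by metis
    qed
  qed
  have eb: "e (b x) = b (e x)" for x using commutesD[OF ecom[of b]] by simp
  have es: "e (s x) = s (e x)" for x using commutesD[OF ecom[of s]] scom[of b] by simp
  define u where "u = 2 *\<^sub>R e - id_blinfun"
  have ux: "u x = 2 *\<^sub>R e x - x" for x by (simp add: u_def blin_simps)
  have us: "b x = u (s x)" for x
  proof -
    \<comment> \<open>Since \<open>s\<close> and \<open>b\<close> commute and have the same square,
      \<open>s + b\<close> maps into the kernel of \<open>s - b\<close>. There \<open>e\<close> is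
      the identity, which yields the polar decomposition \<open>b = u s\<close> with
      \<open>u = 2 e - 1\<close>.\<close>
    have "s (b x + s x) = b (b x + s x)" by (simp add: blin_simps ss sb)
    then have "b x + s x \<in> M" by (simp add: M_def)
    then have "e (b x + s x) = b x + s x" by (rule e(3))
    then have "2 *\<^sub>R e (s x) = b x + s x" by (simp add: blin_simps es eb eM scaleR_2)
    then show ?thesis by (simp add: ux)
  qed
  have nu: "norm (u x) = norm x" for x
  proof -
    have "(norm (u x))\<^sup>2 = (norm x)\<^sup>2"
      using e(1) by (simp add: ux power2_norm_eq_inner inner_diff_left inner_diff_right inner_commute ee)
    then show ?thesis by simp
  qed
  have uu: "u (u x) = x" for x by (simp add: ux blin_simps ee scaleR_2)
  \<comment> \<open>The operator is \<open>u (2 s - 1)\<close> with \<open>u\<close> isometric, and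
    \<open>2 s - 1\<close> is a contraction because the square of \<open>s\<close> is at most
    \<open>s\<close>.\<close>
  have "norm (2 *\<^sub>R b - u) \<le> 1"
  proof (rule norm_blinfun_bound)
    fix x
    have "(2 *\<^sub>R b - u) x = u (2 *\<^sub>R s x - x)" by (simp add: blin_simps us)
    then have "(norm ((2 *\<^sub>R b - u) x))\<^sup>2 = (norm (2 *\<^sub>R s x - x))\<^sup>2" by (simp add: nu)
    also have "\<dots> = 4 * (norm (s x))\<^sup>2 - 4 * inner (s x) x + (norm x)\<^sup>2"
      by (simp add: power2_norm_eq_inner inner_diff_left inner_diff_right inner_commute)
    also have "\<dots> \<le> (norm x)\<^sup>2" using positive_contraction_norm_le[OF syms spos sle, of x] by simp
    finally have "norm ((2 *\<^sub>R b - u) x) \<le> norm x" by (rule norm_le_if_square_le)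
    then show "norm ((2 *\<^sub>R b - u) x) \<le> 1 * norm x" by simp
  qed simp
  moreover have "e o\<^sub>L e = e" by (simp add: blinfun_eqI ee)
  ultimately show ?thesis using that[of e] e(1) ecom unfolding u_def by blast
qed

text \<open>Binary digits: \<open>b = (2 e - 1)/2 + b'/2\<close> with the next contraction \<open>b' = 2 b - (2 e - 1)\<close>.\<close>

lemma digit_expansion_contraction:
  fixes b :: "'a::{real_inner,banach} \<Rightarrow>\<^sub>L 'a"
  assumes b: "norm b \<le> 1" "sym_op b"
  obtains e :: "nat \<Rightarrow> 'a \<Rightarrow>\<^sub>L 'a" where "\<And>k. sym_op (e k)" "\<And>k. e k o\<^sub>L e k = e k"
    "\<And>k S. commutes S b \<Longrightarrow> commutes S (e k)"
    "\<And>x. (\<lambda>k. (1/2)^Suc k * (2 * inner (e k x) x - inner x x)) sums inner (b x) x"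
proof -
  define good where "good d e \<longleftrightarrow> sym_op e \<and> e o\<^sub>L e = e \<and>
      (\<forall>S. commutes S d \<longrightarrow> commutes S e) \<and> norm (2 *\<^sub>R d - (2 *\<^sub>R e - id_blinfun)) \<le> 1"
    for d e :: "'a \<Rightarrow>\<^sub>L 'a"
  have "\<exists>e. norm d \<le> 1 \<and> sym_op d \<longrightarrow> good d e" for d :: "'a \<Rightarrow>\<^sub>L 'a"
    unfolding good_def by (metis sign_operator)
  then obtain sg where sg: "\<And>d :: 'a \<Rightarrow>\<^sub>L 'a. norm d \<le> 1 \<Longrightarrow> sym_op d \<Longrightarrow> good d (sg d)"
    by metis
  define D where "D = rec_nat b (\<lambda>_ d. 2 *\<^sub>R d - (2 *\<^sub>R sg d - id_blinfun))"
  have D0: "D 0 = b" and DS: "D (Suc k) = 2 *\<^sub>R D k - (2 *\<^sub>R sg (D k) - id_blinfun)" for k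
    by (simp_all add: D_def)
  have D: "norm (D k) \<le> 1 \<and> sym_op (D k) \<and> (\<forall>S. commutes S b \<longrightarrow> commutes S (D k))" for k
  proof (induction k)
    case 0
    then show ?case using b by (simp add: D0)
  next
    case (Suc k)
    then have "good (D k) (sg (D k))" by (intro sg) auto
    with Suc show ?case
      unfolding good_def DS by (auto simp: blin_simps inner_diff_left inner_diff_right comp_simps)
  qed
  have g: "good (D k) (sg (D k))" for k using D[of k] by (intro sg) auto
  show ?thesis
  proof (rule that[of "\<lambda>k. sg (D k)"])
    fix x
    let ?f = "\<lambda>k. (1/2)^Suc k * (2 * inner (sg (D k) x) x - inner x x)"
    \<comment> \<open>Unrolling the recursion leaves the remainder \<open>D n\<close> scaled by
      \<open>(1/2)^n\<close>; it tends to 0 because every \<open>D n\<close> is a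
      contraction.\<close>
    have part: "sum ?f {..<n} = inner (b x) x - (1/2)^n * inner (D n x) x" for n
    proof (induction n)
      case (Suc n)
      have "inner (D (Suc n) x) x = 2 * inner (D n x) x - (2 * inner (sg (D n) x) x - inner x x)"
        by (simp add: DS blin_simps inner_diff_left)
      then show ?case using Suc by (simp add: field_simps)
    qed (simp add: D0)
    have "(\<lambda>n. (1/2)^n * inner (D n x) x) \<longlonglongrightarrow> 0"
    proof (rule Lim_null_comparison[where g = "\<lambda>n. (1/2)^n * (norm x * norm x)"])
      have "norm (inner (D n x) x) \<le> norm x * norm x" for n
      proof -
        have "norm (inner (D n x) x) \<le> norm (D n x) * norm x"
          unfolding real_norm_def by (rule Cauchy_Schwarz_ineq2)
        also have "\<dots> \<le> norm x * norm x" using D[of n] by (intro mult_right_mono norm_blinfun_le_1) auto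
        finally show ?thesis .
      qed
      then show "\<forall>\<^sub>F n in sequentially. norm ((1/2)^n * inner (D n x) x) \<le> (1/2)^n * (norm x * norm x)"
        by (intro always_eventually allI) (simp add: abs_mult)
      show "(\<lambda>n. (1/2)^n * (norm x * norm x)) \<longlonglongrightarrow> 0"
        by (intro tendsto_mult_left_zero LIMSEQ_power_zero) simp
    qed
    then have "(\<lambda>n. inner (b x) x - (1/2)^n * inner (D n x) x) \<longlonglongrightarrow> inner (b x) x - 0"
      by (intro tendsto_intros)
    then show "?f sums inner (b x) x"
      unfolding sums_def part by simp
  qed (use g D in \<open>auto simp: good_def\<close>)
qed

text \<open>Dividing by \<open>N = norm b + 1\<close>, which is positive even for
  \<open>b = 0\<close>, gives a contraction. In the sum of the digit signs \<open>2 e k - 1\<close>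
  with weights \<open>(1/2)^Suc k\<close> the constants add up to -1, so the expansion starts with
  the identity and coefficient \<open>- N\<close> and continues with the digits and coefficients
  \<open>N * (1/2)^k\<close>.\<close>

lemma projection_expansion:
  fixes b :: "'a::{real_inner,banach} \<Rightarrow>\<^sub>L 'a"
  assumes b: "sym_op b"
  obtains Q :: "nat \<Rightarrow> 'a \<Rightarrow>\<^sub>L 'a" and c :: "nat \<Rightarrow> real"
  where "\<And>k. sym_op (Q k)" "\<And>k. Q k o\<^sub>L Q k = Q k"
    "\<And>k S. commutes S b \<Longrightarrow> commutes S (Q k)"
    "summable (\<lambda>k. \<bar>c k\<bar>)"
    "\<And>x. (\<lambda>k. c k * inner (Q k x) x) sums inner (b x) x"
proof -
  define N where "N = norm b + 1"
  have N: "N > 0" by (simp add: N_def add_nonneg_pos)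
  have "norm ((1/N) *\<^sub>R b) \<le> 1" using N by (simp add: N_def divide_le_eq)
  moreover have "sym_op ((1/N) *\<^sub>R b)" using b by (simp add: blin_simps)
  ultimately obtain e :: "nat \<Rightarrow> 'a \<Rightarrow>\<^sub>L 'a" where e: "\<And>k. sym_op (e k)" "\<And>k. e k o\<^sub>L e k = e k"
    "\<And>k S. commutes S ((1/N) *\<^sub>R b) \<Longrightarrow> commutes S (e k)"
    and sums: "\<And>x. (\<lambda>k. (1/2)^Suc k * (2 * inner (e k x) x - inner x x)) sums inner (((1/N) *\<^sub>R b) x) x"
    by (rule digit_expansion_contraction) blast
  define Q where "Q k = (case k of 0 \<Rightarrow> id_blinfun | Suc k \<Rightarrow> e k)" for k
  define c where "c k = (case k of 0 \<Rightarrow> - N | Suc k \<Rightarrow> N * (1/2)^k)" for k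
  show ?thesis
  proof (rule that[of Q c])
    show "sym_op (Q k)" for k
      using e(1)[of "k - 1"] by (cases k) (simp_all add: Q_def)
    show "Q k o\<^sub>L Q k = Q k" for k
      using e(2) by (cases k) (simp_all add: Q_def)
    show "commutes S (Q k)" if "commutes S b" for S k
      using e(3)[of S "k - 1"] that by (cases k) (simp_all add: Q_def comp_simps)
    have "summable (\<lambda>k. N * (1/2)^k)" by (intro summable_mult summable_geometric) simp
    then have "summable (\<lambda>k. \<bar>c (Suc k)\<bar>)" using N by (simp add: c_def)
    then show "summable (\<lambda>k. \<bar>c k\<bar>)" by (subst (asm) summable_Suc_iff)
    show "(\<lambda>k. c k * inner (Q k x) x) sums inner (b x) x" for x
    proof -
      have "(\<lambda>k. N * ((1/2)^Suc k * (2 * inner (e k x) x - inner x x))) sums (N * inner (((1/N) *\<^sub>R b) x) x)"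
        by (intro sums_mult sums)
      then have "(\<lambda>k. N * ((1/2)^Suc k * (2 * inner (e k x) x - inner x x))) sums inner (b x) x"
        using N by (simp add: blin_simps)
      moreover have "(\<lambda>k. N * inner x x * (1/2)^Suc k) sums (N * inner x x * 1)"
        by (intro sums_mult power_half_series)
      ultimately have "(\<lambda>k. N * ((1/2)^Suc k * (2 * inner (e k x) x - inner x x)) + N * inner x x * (1/2)^Suc k)
          sums (inner (b x) x + N * inner x x * 1)"
        by (rule sums_add)
      then have "(\<lambda>k. c (Suc k) * inner (Q (Suc k) x) x) sums (inner (b x) x + N * inner x x)"
        by (simp add: c_def Q_def algebra_simps)
      then have "(\<lambda>k. c k * inner (Q k x) x) sums (inner (b x) x + N * inner x x + c 0 * inner (Q 0 x) x)"
        by (rule sums_Suc)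
      then show ?thesis by (simp add: c_def Q_def)
    qed
  qed
qed

subsection \<open>Measures on Cantor space\<close>

text \<open>Prefixes of a bit sequence are stored with the latest bit at the head.\<close>

primrec bit_prefix :: "nat \<Rightarrow> (nat \<Rightarrow> bool) \<Rightarrow> bool list" where
  "bit_prefix 0 w = []"
| "bit_prefix (Suc n) w = w n # bit_prefix n w"

definition cylinder :: "bool list \<Rightarrow> (nat \<Rightarrow> bool) set" where
  "cylinder l = {w. bit_prefix (length l) w = l}"

text \<open>The empty set is included to make the family stable under intersection, as Dynkin
  arguments require.\<close>

definition cylinders :: "(nat \<Rightarrow> bool) set set" where
  "cylinders = insert {} (range cylinder)"

abbreviation cantor_sets :: "(nat \<Rightarrow> bool) set set" where
  "cantor_sets \<equiv> sigma_sets UNIV cylinders"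

lemma length_bit_prefix [simp]: "length (bit_prefix n w) = n"
  by (induction n) auto

lemma drop_bit_prefix: "n \<le> m \<Longrightarrow> drop (m - n) (bit_prefix m w) = bit_prefix n w"
proof (induction m)
  case (Suc m)
  then show ?case by (cases "n = Suc m") (auto simp: Suc_diff_le)
qed simp

text \<open>The latest bit stands at the head, so a prefix of \<open>w\<close> is a tail of every
  longer prefix of \<open>w\<close>. Two cylinders are therefore nested or disjoint.\<close>

lemma cylinder_Int:
  assumes "length l \<le> length m"
  shows "cylinder l \<inter> cylinder m = (if drop (length m - length l) m = l then cylinder m else {})"
proof -
  have "bit_prefix (length l) w = drop (length m - length l) m" if "bit_prefix (length m) w = m" for w
    using drop_bit_prefix[OF assms, of w] that by simp
  then show ?thesis unfolding cylinder_def by auto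
qed

lemma cylinder_Nil [simp]: "cylinder [] = UNIV"
  by (simp add: cylinder_def)

lemma cylinder_Cons: "cylinder (b # l) = {w \<in> cylinder l. w (length l) = b}"
  by (auto simp: cylinder_def)

lemma cylinder_split:
  "cylinder l = cylinder (True # l) \<union> cylinder (False # l)" "cylinder (True # l) \<inter> cylinder (False # l) = {}"
  by (auto simp: cylinder_Cons)

lemma cylinders_Pow: "cylinders \<subseteq> Pow UNIV"
  by simp

lemma Int_stable_cylinders: "Int_stable cylinders"
proof (rule Int_stableI)
  fix a b assume "a \<in> cylinders" "b \<in> cylinders"
  moreover have "cylinder l \<inter> cylinder m \<in> cylinders" for l m
  proof (cases "length l \<le> length m")
    case True
    then show ?thesis by (simp add: cylinder_Int cylinders_def)
  next
    case False
    then show ?thesis by (simp add: Int_commute[of "cylinder l"] cylinder_Int cylinders_def)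
  qed
  ultimately show "a \<inter> b \<in> cylinders" by (auto simp: cylinders_def)
qed

lemma cylinder_in_cantor_sets [simp]: "cylinder l \<in> cantor_sets"
  by (auto simp: cylinders_def)

interpretation cantor: sigma_algebra UNIV cantor_sets
  by (rule sigma_algebra_sigma_sets) simp

lemma bit_in_cantor_sets [simp]: "{w. w k} \<in> cantor_sets"
proof -
  have "{w. w k} = (\<Union>l\<in>{l. length l = k}. cylinder (True # l))"
    by (auto simp: cylinder_def)
  also have "\<dots> \<in> cantor_sets"
    by (intro cantor.countable_UN'') auto
  finally show ?thesis .
qed

text \<open>Inside the interval of \<open>l\<close> the child \<open>False\<close> lies to the left
  of the cut, so only the child \<open>True\<close> moves the left end, by the length
  \<open>m (False # l)\<close>.\<close>

primrec left_end :: "(bool list \<Rightarrow> real) \<Rightarrow> bool list \<Rightarrow> real" where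
  "left_end m [] = 0"
| "left_end m (b # l) = left_end m l + (if b then m (False # l) else 0)"

primrec split_prefix :: "(bool list \<Rightarrow> real) \<Rightarrow> nat \<Rightarrow> real \<Rightarrow> bool list" where
  "split_prefix m 0 t = []"
| "split_prefix m (Suc n) t = (let l = split_prefix m n t in (left_end m l + m (False # l) \<le> t) # l)"

text \<open>Lebesgue measure on \<open>[0, m [])\<close>, cut successively into intervals of lengths \<open>m l\<close>, is
  transported to Cantor space by recording on which side of the cuts a point lies.\<close>

lemma cantor_measure_exists:
  assumes nonneg: "\<And>l. 0 \<le> m l" and add: "\<And>l. m l = m (True # l) + m (False # l)"
  obtains M where "space M = UNIV" "sets M = cantor_sets" "\<And>l. emeasure M (cylinder l) = ennreal (m l)"
proof -
  define X where "X t n = hd (split_prefix m (Suc n) t)" for t n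
  have len: "length (split_prefix m n t) = n" for n t
    by (induction n) (auto simp: Let_def)
  have pre: "bit_prefix n (X t) = split_prefix m n t" for n t
    by (induction n) (auto simp: X_def Let_def)
  have sub: "{left_end m l..<left_end m l + m l} \<subseteq> {0..<m []}" for l
  proof (induction l)
    case (Cons b l)
    have "{left_end m (b # l)..<left_end m (b # l) + m (b # l)} \<subseteq> {left_end m l..<left_end m l + m l}"
      using nonneg[of "True # l"] nonneg[of "False # l"] add[of l] by (cases b) auto
    with Cons show ?case by blast
  qed simp
  have iff: "split_prefix m (length l) t = l \<longleftrightarrow> t \<in> {left_end m l..<left_end m l + m l}"
    if "t \<in> {0..<m []}" for l t
  proof (induction l)
    case Nil
    then show ?case using that by simp
  next
    case (Cons b l)
    have "split_prefix m (length (b # l)) t = b # l \<longleftrightarrow>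
        split_prefix m (length l) t = l \<and> (left_end m l + m (False # l) \<le> t) = b"
      by (auto simp: Let_def)
    then show ?case
      unfolding Cons.IH using nonneg[of "True # l"] nonneg[of "False # l"] add[of l] by (cases b) auto
  qed
  define N where "N = sigma UNIV cylinders"
  define L where "L = restrict_space lborel {0..<m []}"
  have pre_image: "X -` cylinder l \<inter> space L = {left_end m l..<left_end m l + m l}" for l
    using iff sub[of l] by (auto simp: L_def cylinder_def pre space_restrict_space)
  have meas: "X \<in> measurable L N"
    unfolding N_def
  proof (rule measurable_measure_of)
    fix y assume "y \<in> cylinders"
    then show "X -` y \<inter> space L \<in> sets L"
      by (auto simp: cylinders_def pre_image)
        (use sub in \<open>auto simp: L_def sets_restrict_space_iff\<close>)
  qed auto
  show ?thesis
  proof (rule that[of "distr L N X"])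
    show "emeasure (distr L N X) (cylinder l) = ennreal (m l)" for l
    proof -
      have "cylinder l \<in> sets N" by (simp add: N_def)
      then have "emeasure (distr L N X) (cylinder l) = emeasure L {left_end m l..<left_end m l + m l}"
        using meas by (simp add: emeasure_distr pre_image)
      also have "\<dots> = emeasure lborel {left_end m l..<left_end m l + m l}"
        unfolding L_def using sub[of l] by (subst emeasure_restrict_space) auto
      also have "\<dots> = ennreal (m l)" using nonneg[of l] by simp
      finally show ?thesis .
    qed
  qed (simp_all add: N_def)
qed

subsection \<open>Spectral measures from commuting projections\<close>


text \<open>Monotone convergence of positive operators: every finite block is a positive
  contraction, whose squared norm at \<open>x\<close> is at most its form at \<open>x\<close>, so
  the Cauchy property passes from the scalar series to the vectors. This produces the operators of
  countable disjoint unions.\<close>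

lemma strong_sum_exists:
  fixes T :: "nat \<Rightarrow> 'a::{real_inner,banach} \<Rightarrow>\<^sub>L 'a"
  assumes sym: "\<And>n. sym_op (T n)" and pos: "\<And>n x. 0 \<le> inner (T n x) x"
    and sums: "\<And>x. (\<lambda>n. inner (T n x) x) sums f x" and le: "\<And>x. f x \<le> inner x x"
  obtains S where "sym_op S" "\<And>x. (\<lambda>n. T n x) sums blinfun_apply S x"
proof -
  have fin: "(\<Sum>n\<in>A. inner (T n x) x) \<le> inner x x" if "finite A" for A x
    using sum_le_suminf[OF sums_summable[OF sums[of x]] that] pos sums_unique[OF sums[of x]] le[of x]
    by (metis order_trans)
  have block: "(norm (\<Sum>n\<in>A. T n x))\<^sup>2 \<le> (\<Sum>n\<in>A. inner (T n x) x)" if "finite A" for A x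
  proof -
    let ?D = "\<Sum>n\<in>A. T n"
    have D: "?D y = (\<Sum>n\<in>A. T n y)" for y
      by (simp add: blinfun.sum_left)
    have "sym_op ?D" unfolding D using sym by (simp add: inner_sum_left inner_sum_right)
    moreover have "0 \<le> inner (?D y) y" "inner (?D y) y \<le> inner y y" for y
      unfolding D inner_sum_left using pos fin[OF that] by (simp_all add: sum_nonneg)
    ultimately have "(norm (?D x))\<^sup>2 \<le> inner (?D x) x"
      by (rule positive_contraction_norm_le)
    then show ?thesis by (simp add: D inner_sum_left)
  qed
  have conv: "summable (\<lambda>n. T n x)" for x
    unfolding summable_Cauchy
  proof (intro allI impI)
    fix e :: real assume e: "e > 0"
    then have "e\<^sup>2 > 0" by simp
    then obtain N where N: "\<And>m n. m \<ge> N \<Longrightarrow> norm (\<Sum>k=m..<n. inner (T k x) x) < e\<^sup>2"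
      using sums_summable[OF sums[of x]] unfolding summable_Cauchy by blast
    have "norm (\<Sum>k=m..<n. T k x) < e" if "m \<ge> N" for m n
    proof -
      have "(norm (\<Sum>k=m..<n. T k x))\<^sup>2 < e\<^sup>2"
        using block[of "{m..<n}" x] N[OF that, of n] by simp
      then show ?thesis using e by (rule power2_less_imp_less[OF _ less_imp_le])
    qed
    then show "\<exists>N. \<forall>m\<ge>N. \<forall>n. norm (\<Sum>k=m..<n. T k x) < e" by blast
  qed
  define s where "s x = suminf (\<lambda>n. T n x)" for x
  have s: "(\<lambda>n. T n x) sums s x" for x
    unfolding s_def using conv by (rule summable_sums)
  have bl: "bounded_linear s"
  proof (rule bounded_linear_intro[where K = 1])
    show "s (x + y) = s x + s y" for x y
    proof (rule sums_unique2[OF s])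
      show "(\<lambda>n. T n (x + y)) sums (s x + s y)"
        unfolding blinfun.add_right by (intro sums_add s)
    qed
    show "s (r *\<^sub>R x) = r *\<^sub>R s x" for r x
    proof (rule sums_unique2[OF s])
      show "(\<lambda>n. T n (r *\<^sub>R x)) sums (r *\<^sub>R s x)"
        unfolding blinfun.scaleR_right by (intro sums_scaleR_right s)
    qed
    show "norm (s x) \<le> norm x * 1" for x
    proof -
      have "norm (\<Sum>n<k. T n x) \<le> norm x" for k
        using order_trans[OF block[of "{..<k}" x] fin[of "{..<k}" x]]
        by (intro norm_le_if_square_le) (simp add: power2_norm_eq_inner)
      moreover have "(\<lambda>k. norm (\<Sum>n<k. T n x)) \<longlonglongrightarrow> norm (s x)"
        using s[of x] unfolding sums_def by (rule tendsto_norm)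
      ultimately have "norm (s x) \<le> norm x" by (intro LIMSEQ_le_const2) auto
      then show ?thesis by simp
    qed
  qed
  show ?thesis
  proof (rule that[of "Blinfun s"])
    have "inner (s x) y = inner x (s y)" for x y
    proof (rule sums_unique2)
      show "(\<lambda>n. inner (T n x) y) sums inner (s x) y"
        using bounded_linear.sums[OF bounded_linear_inner_left s] .
      have "(\<lambda>n. inner x (T n y)) sums inner x (s y)"
        using bounded_linear.sums[OF bounded_linear_inner_right s] .
      then show "(\<lambda>n. inner (T n x) y) sums inner x (s y)" using sym by simp
    qed
    then show "sym_op (Blinfun s)" using bl by (simp add: bounded_linear_Blinfun_apply)
    show "(\<lambda>n. T n x) sums Blinfun s x" for x
      using s bl by (simp add: bounded_linear_Blinfun_apply)
  qed
qed

lemma commutes_strong_sum: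
  fixes R :: "'a::real_normed_vector \<Rightarrow>\<^sub>L 'a"
  assumes "\<And>x. (\<lambda>n. blinfun_apply (T n) x) sums blinfun_apply S x" "\<And>n. commutes R (T n)"
  shows "commutes R S"
proof (rule commutesI)
  fix x
  have "(\<lambda>n. R (T n x)) sums R (S x)"
    using bounded_linear.sums[OF blinfun.bounded_linear_right assms(1)] .
  moreover have "(\<lambda>n. R (T n x)) sums S (R x)"
    unfolding commutesD[OF assms(2)] by (rule assms(1))
  ultimately show "R (S x) = S (R x)" by (rule sums_unique2)
qed

section \<open>The operator-valued measure on Cantor space\<close>

locale commuting_projections =
  fixes Q :: "nat \<Rightarrow> 'a::{real_inner,banach} \<Rightarrow>\<^sub>L 'a"
  assumes sym_Q: "sym_op (Q k)"
    and idem_Q: "Q k o\<^sub>L Q k = Q k"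
    and comm_Q: "commutes (Q j) (Q k)"
begin

definition bit_proj :: "bool \<Rightarrow> nat \<Rightarrow> 'a \<Rightarrow>\<^sub>L 'a" where
  "bit_proj b k = (if b then Q k else id_blinfun - Q k)"

primrec prefix_proj :: "bool list \<Rightarrow> 'a \<Rightarrow>\<^sub>L 'a" where
  "prefix_proj [] = id_blinfun"
| "prefix_proj (b # l) = bit_proj b (length l) o\<^sub>L prefix_proj l"

lemma bit_proj_comp: "bit_proj b k o\<^sub>L bit_proj c k = (if b = c then bit_proj b k else 0)"
  by (auto simp: bit_proj_def comp_simps idem_Q)

lemma bit_proj_commutes: "(\<And>k. commutes S (Q k)) \<Longrightarrow> commutes S (bit_proj b k)"
  by (simp add: bit_proj_def comp_simps)

lemma sym_bit_proj: "sym_op (bit_proj b k)"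
  using sym_Q[of k] by (simp add: bit_proj_def blin_simps inner_diff_left inner_diff_right)

lemma prefix_proj_commutes: "(\<And>k. commutes S (Q k)) \<Longrightarrow> commutes S (prefix_proj l)"
proof (induction l)
  case (Cons b l)
  then show ?case by (simp only: prefix_proj.simps commutes_comp bit_proj_commutes)
qed simp

lemma bit_prefix_proj_commutes: "commutes (bit_proj b k) (prefix_proj l)"
  by (intro prefix_proj_commutes bit_proj_commutes[symmetric] comm_Q)

lemma sym_prefix_proj: "sym_op (prefix_proj l)"
proof (induction l)
  case (Cons b l)
  then show ?case
    using sym_bit_proj[of b "length l"] commutesD[OF bit_prefix_proj_commutes[of b "length l" l]] by simp
qed simp

text \<open>Operator counterpart of \<open>cylinder_Int\<close>. A longer right-hand prefix sheds
  its head, which commutes past the left factor; for equal lengths the two heads belong to the same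
  position and \<open>bit_proj_comp\<close> compares them.\<close>

lemma prefix_proj_comp:
  assumes "length l \<le> length m"
  shows "prefix_proj l o\<^sub>L prefix_proj m = (if drop (length m - length l) m = l then prefix_proj m else 0)"
  using assms
proof (induction m arbitrary: l)
  case Nil
  then show ?case by simp
next
  case (Cons b m)
  show ?case
  proof (cases "length l \<le> length m")
    case True
    have "prefix_proj l o\<^sub>L prefix_proj (b # m) = bit_proj b (length m) o\<^sub>L (prefix_proj l o\<^sub>L prefix_proj m)"
      by (rule blinfun_eqI) (simp add: commutesD[OF bit_prefix_proj_commutes[of b "length m" l]])
    then show ?thesis using True by (simp add: Cons.IH Suc_diff_le)
  next
    case False
    with Cons.prems obtain c k where l: "l = c # k" and len: "length k = length m"
      by (cases l) auto
    have "prefix_proj l o\<^sub>L prefix_proj (b # m)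
        = (bit_proj c (length m) o\<^sub>L bit_proj b (length m)) o\<^sub>L (prefix_proj k o\<^sub>L prefix_proj m)"
      unfolding l prefix_proj.simps len
      by (rule blinfun_eqI) (simp add: commutesD[OF bit_prefix_proj_commutes[of b "length m" k]])
    also have "\<dots> = (if c = b then bit_proj c (length m) else 0) o\<^sub>L (if m = k then prefix_proj m else 0)"
      using len Cons.IH[of k] by (simp only: bit_proj_comp) simp
    finally have eq: "prefix_proj l o\<^sub>L prefix_proj (b # m) = \<dots>" .
    have "drop (length (b # m) - length l) (b # m) = l \<longleftrightarrow> c = b \<and> m = k"
      using len by (auto simp: l)
    then show ?thesis unfolding eq by simp
  qed
qed

definition weight :: "'a \<Rightarrow> bool list \<Rightarrow> real" where
  "weight x l = inner (prefix_proj l x) x"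

lemma weight_nonneg: "0 \<le> weight x l"
proof -
  have "weight x l = inner (prefix_proj l (prefix_proj l x)) x"
    using arg_cong[OF prefix_proj_comp[of l l], of "\<lambda>T. blinfun_apply T x"] by (simp add: weight_def)
  also have "\<dots> = inner (prefix_proj l x) (prefix_proj l x)"
    by (rule sym_opD[OF sym_prefix_proj])
  finally show ?thesis by simp
qed

lemma weight_split: "weight x l = weight x (True # l) + weight x (False # l)"
  by (simp add: weight_def bit_proj_def blin_simps inner_diff_left)

text \<open>A measure is chosen for each vector separately. That its value at a fixed set is a
  quadratic form in the vector is the content of \<open>cantor_op_exists\<close>.\<close>

definition cantor_measure :: "'a \<Rightarrow> (nat \<Rightarrow> bool) measure" where
  "cantor_measure x = (SOME M. space M = UNIV \<and> sets M = cantor_sets \<and>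
     (\<forall>l. emeasure M (cylinder l) = ennreal (weight x l)))"

lemma cantor_measure:
  "space (cantor_measure x) = UNIV" "sets (cantor_measure x) = cantor_sets"
  "emeasure (cantor_measure x) (cylinder l) = ennreal (weight x l)"
proof -
  have "\<exists>M. space M = UNIV \<and> sets M = cantor_sets \<and> (\<forall>l. emeasure M (cylinder l) = ennreal (weight x l))"
    using cantor_measure_exists[of "weight x"] weight_nonneg weight_split by metis
  from someI_ex[OF this]
  show "space (cantor_measure x) = UNIV" "sets (cantor_measure x) = cantor_sets"
    "emeasure (cantor_measure x) (cylinder l) = ennreal (weight x l)"
    unfolding cantor_measure_def by blast+
qed

lemma measure_cylinder: "measure (cantor_measure x) (cylinder l) = weight x l"
  by (simp add: measure_def cantor_measure weight_nonneg)

lemma finite_cantor_measure: "finite_measure (cantor_measure x)"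
  using cantor_measure(3)[of x "[]"] by (intro finite_measureI) (simp add: cantor_measure)

lemma measure_UNIV: "measure (cantor_measure x) UNIV = inner x x"
  using measure_cylinder[of x "[]"] by (simp add: weight_def)

lemma measure_Compl:
  "G \<in> cantor_sets \<Longrightarrow> measure (cantor_measure x) (UNIV - G) = inner x x - measure (cantor_measure x) G"
  using finite_measure.finite_measure_compl[OF finite_cantor_measure, of G x]
  by (simp add: cantor_measure measure_UNIV)

text \<open>Dynkin induction from the cylinders: a complement is subtracted from the identity and a
  disjoint union is a strong sum. Symmetry and the commutation clause pass through both.\<close>

lemma cantor_op_exists:
  assumes "G \<in> cantor_sets"
  shows "\<exists>p. sym_op p \<and> (\<forall>S. (\<forall>k. commutes S (Q k)) \<longrightarrow> commutes S p) \<and>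
    (\<forall>x. measure (cantor_measure x) G = inner (blinfun_apply p x) x)"
  using Int_stable_cylinders cylinders_Pow assms
proof (induction rule: sigma_sets_induct_disjoint)
  case (basic A)
  then consider "A = {}" | l where "A = cylinder l" by (auto simp: cylinders_def)
  then show ?case
  proof cases
    case 1
    then show ?thesis by (intro exI[of _ 0]) simp
  next
    case (2 l)
    then show ?thesis
      by (intro exI[of _ "prefix_proj l"]) (use sym_prefix_proj prefix_proj_commutes in \<open>auto simp: measure_cylinder weight_def\<close>)
  qed
next
  case empty
  then show ?case by (intro exI[of _ 0]) simp
next
  case (compl A)
  then obtain p where "sym_op p" "\<And>S. (\<And>k. commutes S (Q k)) \<Longrightarrow> commutes S p"
    "\<And>x. measure (cantor_measure x) A = inner (blinfun_apply p x) x" by blast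
  then show ?case
    using compl(1) by (intro exI[of _ "id_blinfun - p"])
      (simp add: measure_Compl blin_simps inner_diff_left inner_diff_right comp_simps)
next
  case (union A)
  then obtain p where p: "\<And>n. sym_op (p n)" "\<And>n S. (\<And>k. commutes S (Q k)) \<Longrightarrow> commutes S (p n)"
    "\<And>n x. measure (cantor_measure x) (A n) = inner (blinfun_apply (p n) x) x" by metis
  have sums: "(\<lambda>n. inner (p n x) x) sums measure (cantor_measure x) (\<Union>i. A i)" for x
    unfolding p(3)[symmetric]
    using finite_measure.finite_measure_UNION[OF finite_cantor_measure] union(1,2) by (simp add: cantor_measure)
  have le: "measure (cantor_measure x) (\<Union>i. A i) \<le> inner x x" for x
    using finite_measure.bounded_measure[OF finite_cantor_measure, of x] by (simp add: cantor_measure measure_UNIV)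
  have pos: "0 \<le> inner (p n x) x" for n x unfolding p(3)[symmetric] by simp
  obtain S where S: "sym_op S" "\<And>x. (\<lambda>n. p n x) sums blinfun_apply S x"
    using strong_sum_exists[OF p(1) pos sums le] by blast
  have "measure (cantor_measure x) (\<Union>i. A i) = inner (S x) x" for x
    using sums_unique2[OF sums bounded_linear.sums[OF bounded_linear_inner_left S(2)]] .
  then show ?case using S commutes_strong_sum[OF S(2)] p(2) by blast
qed

definition cantor_op :: "(nat \<Rightarrow> bool) set \<Rightarrow> 'a \<Rightarrow>\<^sub>L 'a" where
  "cantor_op G = (SOME p. sym_op p \<and> (\<forall>S. (\<forall>k. commutes S (Q k)) \<longrightarrow> commutes S p) \<and>
    (\<forall>x. measure (cantor_measure x) G = inner (blinfun_apply p x) x))"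

lemma cantor_op:
  assumes "G \<in> cantor_sets"
  shows "sym_op (cantor_op G)" "\<And>S. (\<And>k. commutes S (Q k)) \<Longrightarrow> commutes S (cantor_op G)"
    "\<And>x. inner (cantor_op G x) x = measure (cantor_measure x) G"
  using someI_ex[OF cantor_op_exists[OF assms], folded cantor_op_def] by auto

lemma cantor_op_eqI:
  assumes "G \<in> cantor_sets" "sym_op p" "\<And>x. measure (cantor_measure x) G = inner (blinfun_apply p x) x"
  shows "cantor_op G = p"
  using assms cantor_op by (intro sym_op_form_eqI) auto

lemma cantor_op_cylinder: "cantor_op (cylinder l) = prefix_proj l"
  using sym_prefix_proj by (intro cantor_op_eqI) (auto simp: measure_cylinder weight_def)

lemma cantor_op_empty: "cantor_op {} = 0"
  by (intro cantor_op_eqI) (auto intro: sigma_sets.Empty)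

lemma cantor_op_UNIV: "cantor_op UNIV = id_blinfun"
  using cantor_op_cylinder[of "[]"] by simp

lemma cantor_op_Diff:
  assumes "G \<in> cantor_sets" "G' \<in> cantor_sets"
  shows "cantor_op (G - G') = cantor_op G - cantor_op (G \<inter> G')"
proof -
  have GG': "G \<inter> G' \<in> cantor_sets" using assms by blast
  show ?thesis
  proof (rule cantor_op_eqI)
    show "G - G' \<in> cantor_sets" using assms by blast
    show "sym_op (cantor_op G - cantor_op (G \<inter> G'))"
      using cantor_op(1)[OF assms(1)] cantor_op(1)[OF GG']
      by (simp add: blin_simps inner_diff_left inner_diff_right)
    show "measure (cantor_measure x) (G - G') = inner ((cantor_op G - cantor_op (G \<inter> G')) x) x" for x
      using finite_measure.finite_measure_Diff'[OF finite_cantor_measure, of G x G'] assms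
      by (simp add: cantor_measure blin_simps inner_diff_left cantor_op(3) GG')
  qed
qed

text \<open>The partial sums have some symmetric strong limit, whose form is the measure of the
  union; symmetric operators with equal forms agree.\<close>

lemma cantor_op_sums:
  assumes F: "range F \<subseteq> cantor_sets" "disjoint_family F"
  shows "(\<lambda>n. cantor_op (F n) x) sums cantor_op (\<Union>n. F n) x"
proof -
  have Fn: "F n \<in> cantor_sets" for n using F by auto
  have U: "(\<Union>n. F n) \<in> cantor_sets" using Fn by blast
  have sums: "(\<lambda>n. inner (cantor_op (F n) x) x) sums measure (cantor_measure x) (\<Union>n. F n)" for x
    unfolding cantor_op(3)[OF Fn]
    using finite_measure.finite_measure_UNION[OF finite_cantor_measure] F by (simp add: cantor_measure)
  have le: "measure (cantor_measure x) (\<Union>i. F i) \<le> inner x x" for x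
    using finite_measure.bounded_measure[OF finite_cantor_measure, of x] by (simp add: cantor_measure measure_UNIV)
  have pos: "0 \<le> inner (cantor_op (F n) x) x" for n x unfolding cantor_op(3)[OF Fn] by simp
  obtain S where S: "sym_op S" "\<And>x. (\<lambda>n. cantor_op (F n) x) sums blinfun_apply S x"
    using strong_sum_exists[OF cantor_op(1)[OF Fn] pos sums le] by blast
  have "measure (cantor_measure x) (\<Union>i. F i) = inner (S x) x" for x
    using sums_unique2[OF sums bounded_linear.sums[OF bounded_linear_inner_left S(2)]] .
  then have "cantor_op (\<Union>n. F n) = S" using U S(1) by (intro cantor_op_eqI)
  then show ?thesis using S(2) by simp
qed

lemma cantor_op_commutes:
  assumes "G \<in> cantor_sets" "G' \<in> cantor_sets"
  shows "commutes (cantor_op G) (cantor_op G')"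
  by (intro cantor_op(2)[OF assms(2)] cantor_op(2)[OF assms(1), symmetric] comm_Q)

text \<open>Multiplicativity extends from cylinders to measurable sets in one argument at a time. It
  is applied with \<open>G'\<close> a cylinder and then, after commuting the factors, with
  \<open>G'\<close> arbitrary.\<close>

lemma cantor_op_Int_induct:
  assumes G': "G' \<in> cantor_sets"
    and cyl: "\<And>l. cantor_op (cylinder l \<inter> G') = cantor_op (cylinder l) o\<^sub>L cantor_op G'"
    and G: "G \<in> cantor_sets"
  shows "cantor_op (G \<inter> G') = cantor_op G o\<^sub>L cantor_op G'"
  using Int_stable_cylinders cylinders_Pow G
proof (induction rule: sigma_sets_induct_disjoint)
  case (basic A)
  then show ?case using cyl by (auto simp: cylinders_def cantor_op_empty)
next
  case empty
  then show ?case by (simp add: cantor_op_empty)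
next
  case (compl A)
  have "(UNIV - A) \<inter> G' = G' - A" by blast
  then have "cantor_op ((UNIV - A) \<inter> G') = cantor_op G' - cantor_op (A \<inter> G')"
    using cantor_op_Diff[OF G' compl(1)] by (simp add: Int_commute)
  moreover have "cantor_op (UNIV - A) = id_blinfun - cantor_op A"
    using cantor_op_Diff[of UNIV A] compl(1) cantor.top by (simp add: cantor_op_UNIV)
  ultimately show ?case using compl(2) by (simp add: comp_simps)
next
  case (union A)
  have Un: "(\<Union>i. A i) \<inter> G' = (\<Union>i. A i \<inter> G')" by blast
  have 1: "(\<lambda>n. cantor_op (A n \<inter> G') x) sums cantor_op (\<Union>i. A i \<inter> G') x" for x
    using union(1,2) G' by (intro cantor_op_sums) (auto simp: disjoint_family_on_def)
  have 2: "(\<lambda>n. cantor_op (A n \<inter> G') x) sums cantor_op (\<Union>i. A i) (cantor_op G' x)" for x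
    using cantor_op_sums[OF union(2,1), of "cantor_op G' x"] union(3) by simp
  show ?case
    unfolding Un using sums_unique2[OF 1 2] by (intro blinfun_eqI) (simp only: blinfun_apply_blinfun_compose)
qed

lemma cantor_op_Int:
  assumes G: "G \<in> cantor_sets" and G': "G' \<in> cantor_sets"
  shows "cantor_op (G \<inter> G') = cantor_op G o\<^sub>L cantor_op G'"
proof -
  have cyl2: "cantor_op (cylinder l \<inter> cylinder m) = cantor_op (cylinder l) o\<^sub>L cantor_op (cylinder m)" for l m
  proof (cases "length l \<le> length m")
    case True
    then show ?thesis by (simp add: cylinder_Int cantor_op_cylinder prefix_proj_comp cantor_op_empty)
  next
    case False
    then have "cantor_op (cylinder m \<inter> cylinder l) = cantor_op (cylinder m) o\<^sub>L cantor_op (cylinder l)"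
      by (simp add: cylinder_Int cantor_op_cylinder prefix_proj_comp cantor_op_empty)
    then show ?thesis
      using cantor_op_commutes[of "cylinder m" "cylinder l"] by (simp only: Int_commute[of "cylinder l"] cylinder_in_cantor_sets)
  qed
  have cyl: "cantor_op (cylinder l \<inter> G') = cantor_op (cylinder l) o\<^sub>L cantor_op G'" for l
    using cantor_op_Int_induct[OF cylinder_in_cantor_sets cyl2 G', of l] cantor_op_commutes[OF G', of "cylinder l"]
    by (simp only: Int_commute[of "cylinder l"] cylinder_in_cantor_sets)
  show ?thesis by (rule cantor_op_Int_induct[OF G' cyl G])
qed

text \<open>Admitting an arbitrary prefix \<open>l\<close> lets the induction on the gap
  \<open>j\<close> proceed: passing to the two extensions of \<open>l\<close> shortens the gap, and
  their projections add up to that of \<open>l\<close>.\<close>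

lemma measure_cylinder_Int_bit:
  "measure (cantor_measure x) (cylinder l \<inter> {w. w (length l + j)}) = inner (Q (length l + j) (prefix_proj l x)) x"
proof (induction j arbitrary: l)
  case 0
  have "cylinder l \<inter> {w. w (length l + 0)} = cylinder (True # l)" by (auto simp: cylinder_Cons)
  then show ?case by (simp add: measure_cylinder weight_def bit_proj_def)
next
  case (Suc j)
  let ?B = "{w. w (length l + Suc j)}"
  have B: "cylinder m \<inter> ?B \<in> cantor_sets" for m
    by (intro cantor.Int) simp_all
  have "cylinder l \<inter> ?B = (cylinder (True # l) \<inter> ?B) \<union> (cylinder (False # l) \<inter> ?B)"
    using cylinder_split(1)[of l] by blast
  then have "measure (cantor_measure x) (cylinder l \<inter> ?B)
      = measure (cantor_measure x) (cylinder (True # l) \<inter> ?B) + measure (cantor_measure x) (cylinder (False # l) \<inter> ?B)"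
    using finite_measure.finite_measure_Union[OF finite_cantor_measure, of "cylinder (True # l) \<inter> ?B" x "cylinder (False # l) \<inter> ?B"]
      cylinder_split(2)[of l] B by (simp add: cantor_measure disjoint_iff)
  then show ?case
    using Suc.IH[of "True # l"] Suc.IH[of "False # l"]
    by (simp add: bit_proj_def blin_simps inner_diff_left)
qed

lemma measure_bit: "measure (cantor_measure x) {w. w k} = inner (Q k x) x"
  using measure_cylinder_Int_bit[of x "[]" k] by simp

end

section \<open>Projection-valued measures on the plane\<close>

text \<open>Idempotence is the case \<open>E = F\<close> of multiplicativity. Additivity is weak and
  uses the real inner product; the complex version follows in
  \<open>pvm_sums_cinner\<close>.\<close>

definition pvm :: "(complex set \<Rightarrow> 'a::real_inner \<Rightarrow>\<^sub>L 'a) \<Rightarrow> bool" where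
  "pvm P \<longleftrightarrow> (\<forall>E\<in>sets borel. sym_op (P E)) \<and> P {} = 0 \<and> P UNIV = id_blinfun \<and>
    (\<forall>E\<in>sets borel. \<forall>F\<in>sets borel. P (E \<inter> F) = P E o\<^sub>L P F) \<and>
    (\<forall>F :: nat \<Rightarrow> complex set. range F \<subseteq> sets borel \<and> disjoint_family F \<longrightarrow>
       (\<forall>x y. (\<lambda>n. inner (P (F n) x) y) sums inner (P (\<Union>n. F n) x) y)) \<and>
    (\<exists>r. P (cball 0 r) = id_blinfun)"

text \<open>It has the shape of the measure inside \<open>spectral_measure\<close>, so that the two
  can be compared set by set with \<open>measure_of_eq\<close>.\<close>

definition pvm_measure :: "(complex set \<Rightarrow> 'a::real_inner \<Rightarrow>\<^sub>L 'a) \<Rightarrow> 'a \<Rightarrow> complex measure" where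
  "pvm_measure P x = measure_of UNIV (sets borel) (\<lambda>E. ennreal (inner (P E x) x))"

context commuting_projections
begin

text \<open>The spectral measure is the image of the one on Cantor space under
  \<open>w \<mapsto> \<Sum>k. c k w (g k) + \<i> d k w (h k)\<close>.\<close>

lemma pvm_exists:
  assumes c: "summable (\<lambda>k. \<bar>c k\<bar>)" and d: "summable (\<lambda>k. \<bar>d k\<bar>)"
  obtains P where "pvm P" "\<And>S E. (\<And>k. commutes S (Q k)) \<Longrightarrow> E \<in> sets borel \<Longrightarrow> commutes S (P E)"
    "\<And>x. integral\<^sup>L (pvm_measure P x) (\<lambda>z. z) =
      suminf (\<lambda>k. complex_of_real (c k * inner (Q (g k) x) x) + \<i> * complex_of_real (d k * inner (Q (h k) x) x))"
proof -
  define u where "u k w = complex_of_real (c k * indicator {w. w (g k)} w)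
      + \<i> * complex_of_real (d k * indicator {w. w (h k)} w)" for k and w :: "nat \<Rightarrow> bool"
  define f where "f w = suminf (\<lambda>k. u k w)" for w
  define P where "P E = cantor_op (f -` E)" for E
  have norm_u: "norm (u k w) \<le> \<bar>c k\<bar> + \<bar>d k\<bar>" for k w
    unfolding u_def by (intro order.trans[OF norm_triangle_ineq] add_mono) (auto simp: norm_mult indicator_def)
  have cd: "summable (\<lambda>k. \<bar>c k\<bar> + \<bar>d k\<bar>)" using c d by (rule summable_add)
  have su: "summable (\<lambda>k. norm (u k w))" for w
    using cd norm_u by (intro summable_comparison_test'[OF cd, of 0]) auto
  have bit: "{w. w k} \<in> sets (cantor_measure x)" for k x by (simp add: cantor_measure)
  have meas_u: "u k \<in> borel_measurable (cantor_measure x)" for k x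
    unfolding u_def using bit by measurable
  have meas_f: "f \<in> borel_measurable (cantor_measure x)" for x
    unfolding f_def using meas_u by measurable
  have pre: "f -` E \<in> cantor_sets" if "E \<in> sets borel" for E
    using measurable_sets[OF meas_f[of 0] that] by (simp add: cantor_measure)
  define r where "r = suminf (\<lambda>k. \<bar>c k\<bar> + \<bar>d k\<bar>)"
  have norm_f: "norm (f w) \<le> r" for w
  proof -
    have "norm (f w) \<le> suminf (\<lambda>k. norm (u k w))" unfolding f_def by (rule summable_norm[OF su])
    also have "\<dots> \<le> r" unfolding r_def by (intro suminf_le norm_u su cd)
    finally show ?thesis .
  qed
  show ?thesis
  proof (rule that[of P])
    show "pvm P"
      unfolding pvm_def
    proof (intro conjI ballI allI impI)
      show "inner (P E x) y = inner x (P E y)" if "E \<in> sets borel" for E x y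
        unfolding P_def by (rule sym_opD[OF cantor_op(1)[OF pre[OF that]]])
      show "P {} = 0" "P UNIV = id_blinfun" by (simp_all add: P_def cantor_op_empty cantor_op_UNIV)
      show "P (E \<inter> F) = P E o\<^sub>L P F" if "E \<in> sets borel" "F \<in> sets borel" for E F
        unfolding P_def vimage_Int by (rule cantor_op_Int[OF pre pre]) (use that in auto)
      have "f -` cball 0 r = UNIV" using norm_f by auto
      then show "\<exists>r. P (cball 0 r) = id_blinfun"
        by (intro exI[of _ r]) (simp add: P_def cantor_op_UNIV)
      show "(\<lambda>n. inner (P (F n) x) y) sums inner (P (\<Union>n. F n) x) y"
        if "range F \<subseteq> sets borel \<and> disjoint_family F" for F :: "nat \<Rightarrow> complex set" and x y
      proof -
        have "(\<lambda>n. cantor_op (f -` F n) x) sums cantor_op (\<Union>n. f -` F n) x"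
          using that pre by (intro cantor_op_sums) (auto simp: disjoint_family_on_def, blast)
        from bounded_linear.sums[OF bounded_linear_inner_left this, of y] show ?thesis
          by (simp add: P_def vimage_UN)
      qed
    qed
    show "commutes S (P E)" if "\<And>k. commutes S (Q k)" "E \<in> sets borel" for S E
      unfolding P_def by (rule cantor_op(2)[OF pre[OF that(2)] that(1)])
    fix x
    interpret finite_measure "cantor_measure x" by (rule finite_cantor_measure)
    have int_u: "integrable (cantor_measure x) (u k)" for k
      using norm_u meas_u by (intro integrable_const_bound[where B = "\<bar>c k\<bar> + \<bar>d k\<bar>"]) auto
    have I_u: "integral\<^sup>L (cantor_measure x) (u k)
        = complex_of_real (c k * inner (Q (g k) x) x) + \<i> * complex_of_real (d k * inner (Q (h k) x) x)" for k
    proof -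
      have int: "integrable (cantor_measure x) (\<lambda>w. e * indicator {w. w j} w)" for e :: real and j
        using bit[of j x] by (intro integrable_mult_right integrable_real_indicator) (auto simp: emeasure_finite less_top[symmetric])
      have "integral\<^sup>L (cantor_measure x) (u k)
        = (\<integral>w. complex_of_real (c k * indicator {w. w (g k)} w) \<partial>cantor_measure x)
          + (\<integral>w. \<i> * complex_of_real (d k * indicator {w. w (h k)} w) \<partial>cantor_measure x)"
        unfolding u_def by (rule Bochner_Integration.integral_add) (intro integrable_mult_right integrable_of_real int)+
      then show ?thesis
        using bit by (simp only: integral_mult_right_zero integral_of_real) (simp add: measure_bit cantor_measure)
    qed
    \<comment> \<open>Change of variables: the measure of \<open>E\<close> is the Cantor measure of
      the preimage of \<open>E\<close> under \<open>f\<close>.\<close>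
    have pvm_eq: "pvm_measure P x = distr (cantor_measure x) borel f"
    proof -
      have "distr (cantor_measure x) borel f
          = measure_of UNIV (sets borel) (emeasure (distr (cantor_measure x) borel f))"
        using measure_of_of_measure[of "distr (cantor_measure x) borel f"] by simp
      also have "\<dots> = pvm_measure P x"
        unfolding pvm_measure_def
      proof (rule measure_of_eq)
        fix E :: "complex set" assume "E \<in> sigma_sets UNIV (sets borel)"
        then have E: "E \<in> sets borel" using sets.sigma_sets_eq[of "borel :: complex measure"] by simp
        then show "emeasure (distr (cantor_measure x) borel f) E = ennreal (inner (P E x) x)"
          by (simp add: emeasure_distr meas_f cantor_measure P_def cantor_op(3) pre emeasure_eq_measure)
      qed simp
      finally show ?thesis ..
    qed
    have "integral\<^sup>L (pvm_measure P x) (\<lambda>z. z) = integral\<^sup>L (cantor_measure x) f"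
      unfolding pvm_eq by (rule integral_distr) (use meas_f in auto)
    \<comment> \<open>Termwise integration is justified by the summable bounds
      \<open>\<bar>c k\<bar> + \<bar>d k\<bar>\<close> and the finiteness of the measure.\<close>
    also have "\<dots> = suminf (\<lambda>k. integral\<^sup>L (cantor_measure x) (u k))"
      unfolding f_def
    proof (rule integral_suminf)
      show "AE w in cantor_measure x. summable (\<lambda>k. norm (u k w))" using su by simp
      show "summable (\<lambda>k. \<integral>w. norm (u k w) \<partial>cantor_measure x)"
      proof (rule summable_comparison_test'[where N = 0])
        show "summable (\<lambda>k. (\<bar>c k\<bar> + \<bar>d k\<bar>) * measure (cantor_measure x) (space (cantor_measure x)))"
          using cd by (rule summable_mult2)
        have "(\<integral>w. norm (u k w) \<partial>cantor_measure x) \<le> (\<integral>w. \<bar>c k\<bar> + \<bar>d k\<bar> \<partial>cantor_measure x)" for k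
          using int_u norm_u by (intro integral_mono) auto
        then show "norm (\<integral>w. norm (u k w) \<partial>cantor_measure x)
            \<le> (\<bar>c k\<bar> + \<bar>d k\<bar>) * measure (cantor_measure x) (space (cantor_measure x))" for k
          by (simp add: mult.commute)
      qed
    qed (rule int_u)
    finally show "integral\<^sup>L (pvm_measure P x) (\<lambda>z. z) =
      suminf (\<lambda>k. complex_of_real (c k * inner (Q (g k) x) x) + \<i> * complex_of_real (d k * inner (Q (h k) x) x))"
      unfolding I_u .
  qed
qed

end

subsection \<open>The spectral theorem for normal operators\<close>

instance complex_hilbert_space \<subseteq> banach ..

lemma cinner_scaleC_right: "cinner x (scaleC c y) = cnj c * cinner x y"
  for x y :: "'a::complex_hilbert_space"
  by (metis cinner_commute cinner_scaleC_left complex_cnj_cnj complex_cnj_mult)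

lemma cinner_add_right: "cinner x (y + z) = cinner x y + cinner x z"
  for x y z :: "'a::complex_hilbert_space"
  by (metis cinner_add_left cinner_commute complex_cnj_add)

lemma cinner_zero_left [simp]: "cinner 0 y = 0"
  for y :: "'a::complex_hilbert_space"
  using cinner_add_left[of 0 0 y] by simp

lemma cinner_zero_right [simp]: "cinner y 0 = 0"
  for y :: "'a::complex_hilbert_space"
  using cinner_add_right[of y 0 0] by simp

lemma cinner_minus_left: "cinner (- x) y = - cinner x y"
  for x y :: "'a::complex_hilbert_space"
  using cinner_add_left[of "- x" x y] by (simp add: eq_neg_iff_add_eq_0)

lemma cinner_minus_right: "cinner x (- y) = - cinner x y"
  for x y :: "'a::complex_hilbert_space"
  using cinner_add_right[of x "- y" y] by (simp add: eq_neg_iff_add_eq_0)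

lemma cinner_diff_left: "cinner (x - z) y = cinner x y - cinner z y"
  for x y :: "'a::complex_hilbert_space"
  by (simp add: diff_conv_add_uminus cinner_add_left cinner_minus_left del: add_uminus_conv_diff)

lemma cinner_diff_right: "cinner y (x - z) = cinner y x - cinner y z"
  for x y :: "'a::complex_hilbert_space"
  by (simp add: diff_conv_add_uminus cinner_add_right cinner_minus_right del: add_uminus_conv_diff)

text \<open>By conjugate linearity, \<open>\<i>\<close> in the second argument multiplies the value
  by \<open>- \<i>\<close>, which makes the imaginary part a real part. A complex-linear operator
  that is symmetric for \<open>inner\<close> is thereby symmetric for \<open>cinner\<close>.\<close>

lemma cinner_conv_inner: "cinner x y = Complex (inner x y) (inner x (scaleC \<i> y))"
  for x y :: "'a::complex_hilbert_space"
  by (simp add: complex_eq_iff inner_eq_Re_cinner cinner_scaleC_right)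

lemma inner_scaleC: "inner (scaleC c x) y = inner x (scaleC (cnj c) y)"
  for x y :: "'a::complex_hilbert_space"
  by (simp add: inner_eq_Re_cinner cinner_scaleC_left cinner_scaleC_right)

lemma cinner_self: "cinner x x = complex_of_real ((norm x)\<^sup>2)"
  for x :: "'a::complex_hilbert_space"
proof -
  have "Im (cinner x x) = 0" using arg_cong[OF cinner_commute[of x x], of Im] by simp
  then show ?thesis by (simp add: complex_eq_iff power2_norm_eq_inner inner_eq_Re_cinner)
qed

lemma norm_scaleC: "norm (scaleC c x) = cmod c * norm x"
  for x :: "'a::complex_hilbert_space"
proof -
  have "complex_of_real ((norm (scaleC c x))\<^sup>2) = complex_of_real ((cmod c * norm x)\<^sup>2)"
  proof -
    have "complex_of_real ((norm (scaleC c x))\<^sup>2) = cinner (scaleC c x) (scaleC c x)"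
      by (simp only: cinner_self)
    also have "\<dots> = (c * cnj c) * cinner x x" by (simp add: cinner_scaleC_left cinner_scaleC_right)
    also have "\<dots> = complex_of_real ((cmod c * norm x)\<^sup>2)"
      by (simp only: cinner_self complex_norm_square[symmetric] of_real_mult[symmetric] power_mult_distrib)
    finally show ?thesis .
  qed
  then have "(norm (scaleC c x))\<^sup>2 = (cmod c * norm x)\<^sup>2" by (simp only: of_real_eq_iff)
  then show ?thesis by (simp add: power2_eq_iff_nonneg)
qed

lemma cinner_eqI: "(\<And>y. cinner x y = cinner z y) \<Longrightarrow> x = z"
  for x :: "'a::complex_hilbert_space"
  by (metis inner_eq_Re_cinner vector_eq_rdot)

lemma cinner_eqI': "(\<And>y. cinner y x = cinner y z) \<Longrightarrow> x = z"
  for x :: "'a::complex_hilbert_space"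
  by (metis inner_eq_Re_cinner vector_eq_ldot)

lift_definition scaleC_op :: "complex \<Rightarrow> 'a::complex_hilbert_space \<Rightarrow>\<^sub>L 'a" is "scaleC"
proof
  fix c and x y :: 'a and r :: real
  show "scaleC c (x + y) = scaleC c x + scaleC c y" by (rule scaleC_add_right)
  show "scaleC c (r *\<^sub>R x) = r *\<^sub>R scaleC c x"
    by (metis mult.commute scaleC_of_real scaleC_scaleC)
  show "\<exists>K. \<forall>x::'a. norm (scaleC c x) \<le> norm x * K"
    by (intro exI[of _ "cmod c"]) (simp add: norm_scaleC mult.commute)
qed

declare scaleC_op.rep_eq [simp]

lemma bounded_opsD: "T \<in> bounded_ops \<Longrightarrow> T (scaleC c x) = scaleC c (T x)"
  by (simp add: bounded_ops_def)

text \<open>Turns complex linearity into a commutation property, which the constructions on the real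
  space preserve.\<close>

lemma bounded_ops_iff: "T \<in> bounded_ops \<longleftrightarrow> (\<forall>c. commutes (scaleC_op c) T)"
proof
  show "\<forall>c. commutes (scaleC_op c) T" if "T \<in> bounded_ops"
    using that by (auto simp: bounded_ops_def intro!: commutesI)
  show "T \<in> bounded_ops" if "\<forall>c. commutes (scaleC_op c) T"
    using commutesD[OF that[rule_format]] by (simp add: bounded_ops_def)
qed

lemma bounded_ops_commutes: "T \<in> bounded_ops \<Longrightarrow> commutes (scaleC_op c) T"
  by (simp add: bounded_ops_iff)

lemma scaleC_op_bounded [simp]: "scaleC_op c \<in> bounded_ops"
  by (simp add: bounded_ops_def scaleC_scaleC mult.commute)

lemma scaleC_zero_right [simp]: "scaleC c (0::'a::complex_hilbert_space) = 0"
  using scaleC_add_right[of c 0 "0::'a"] by simp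

lemma scaleC_minus_right: "scaleC c (- x) = - scaleC c x"
  for x :: "'a::complex_hilbert_space"
  using scaleC_add_right[of c "- x" x] by (simp add: eq_neg_iff_add_eq_0)

lemma scaleC_minus_left: "scaleC (- c) x = - scaleC c x"
  for x :: "'a::complex_hilbert_space"
  using scaleC_add_left[of "- c" c x] scaleC_of_real[of 0 x] by (simp add: eq_neg_iff_add_eq_0)

lemma scaleC_diff_right: "scaleC c (x - y) = scaleC c x - scaleC c y"
  for x :: "'a::complex_hilbert_space"
  by (simp add: diff_conv_add_uminus scaleC_add_right scaleC_minus_right del: add_uminus_conv_diff)

lemma scaleC_scaleR: "scaleC c (r *\<^sub>R x) = r *\<^sub>R scaleC c x"
  for x :: "'a::complex_hilbert_space"
  by (metis mult.commute scaleC_of_real scaleC_scaleC)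

lemma scaleC_sum: "scaleC c (sum f A) = (\<Sum>i\<in>A. scaleC c (f i))"
  for f :: "_ \<Rightarrow> 'a::complex_hilbert_space"
  using blinfun.sum_right[of "scaleC_op c" f A] by simp

lemma bounded_ops_zero [simp]: "0 \<in> bounded_ops"
  and bounded_ops_id [simp]: "id_blinfun \<in> bounded_ops"
  and bounded_ops_add: "S \<in> bounded_ops \<Longrightarrow> T \<in> bounded_ops \<Longrightarrow> S + T \<in> bounded_ops"
  and bounded_ops_diff: "S \<in> bounded_ops \<Longrightarrow> T \<in> bounded_ops \<Longrightarrow> S - T \<in> bounded_ops"
  and bounded_ops_comp: "S \<in> bounded_ops \<Longrightarrow> T \<in> bounded_ops \<Longrightarrow> S o\<^sub>L T \<in> bounded_ops"
  by (simp_all add: bounded_ops_def blin_simps scaleC_add_right scaleC_diff_right)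

text \<open>The operator form of \<open>spectral_measure\<close>; as there, the integral formula is
  imposed on the diagonal only.\<close>

definition spectral_for :: "('a::complex_hilbert_space \<Rightarrow>\<^sub>L 'a) \<Rightarrow> (complex set \<Rightarrow> 'a \<Rightarrow>\<^sub>L 'a) \<Rightarrow> bool" where
  "spectral_for a P \<longleftrightarrow> pvm P \<and> (\<forall>E\<in>sets borel. P E \<in> bounded_ops) \<and>
    (\<forall>x. cinner (a x) x = integral\<^sup>L (pvm_measure P x) (\<lambda>z. z))"

text \<open>Normality makes the real part \<open>b\<close> and the imaginary part \<open>c\<close>
  commute, hence also their digits. With the digits of \<open>b\<close> at even and those of
  \<open>c\<close> at odd positions they form one commuting family, and the two expansions together
  give the integral of \<open>z\<close>.\<close>

theorem spectral_theorem_normal: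
  fixes a a' :: "'a::complex_hilbert_space \<Rightarrow>\<^sub>L 'a"
  assumes a: "a \<in> bounded_ops" "a' \<in> bounded_ops"
    and adj: "\<And>x y. cinner (a x) y = cinner x (a' y)" and normal: "commutes a a'"
  obtains P where "spectral_for a P"
    "\<And>S E. S \<in> bounded_ops \<Longrightarrow> commutes S a \<Longrightarrow> commutes S a' \<Longrightarrow> E \<in> sets borel \<Longrightarrow> commutes S (P E)"
proof -
  have adjR: "inner (a x) y = inner x (a' y)" for x y
    using adj[of x y] by (simp add: inner_eq_Re_cinner)
  have adjR': "inner (a' x) y = inner x (a y)" for x y
    using adjR[of y x] by (simp add: inner_commute)
  have sc: "inner (scaleC (- \<i>) x) y = inner x (scaleC \<i> y)" for x y :: 'a
    by (simp add: inner_eq_Re_cinner cinner_scaleC_left cinner_scaleC_right)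
  have sc': "scaleC (- \<i>) x = - scaleC \<i> x" for x :: 'a
    by (rule scaleC_minus_left)
  define b where "b = (1/2) *\<^sub>R (a + a')"
  \<comment> \<open>The imaginary part \<open>(a - a') / (2 \<i>)\<close>.\<close>
  define c where "c = (1/2) *\<^sub>R (scaleC_op (- \<i>) o\<^sub>L (a - a'))"
  have symb: "sym_op b"
    by (simp add: b_def blin_simps inner_add_left inner_add_right adjR adjR')
  have symc: "sym_op c"
  proof (intro allI)
    fix x y
    have "inner (c x) y = (1/2) * inner (a x - a' x) (scaleC \<i> y)"
      by (simp add: c_def blin_simps sc)
    also have "\<dots> = (1/2) * inner x (a' (scaleC \<i> y) - a (scaleC \<i> y))"
      by (simp add: inner_diff_left inner_diff_right adjR adjR')
    also have "\<dots> = inner x (c y)"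
      by (simp add: c_def blin_simps sc' bounded_opsD a scaleC_diff_right inner_diff_right)
    finally show "inner (c x) y = inner x (c y)" .
  qed
  have com_b: "commutes S b" if "commutes S a" "commutes S a'" for S
    using that by (simp add: b_def comp_simps)
  have com_c: "commutes S c" if "S \<in> bounded_ops" "commutes S a" "commutes S a'" for S
  proof (rule commutesI)
    show "S (c x) = c (S x)" for x
      using that(1) by (simp add: c_def blin_simps bounded_opsD commutesD[OF that(2)] commutesD[OF that(3)])
  qed
  have cbnd: "c \<in> bounded_ops" and bbnd: "b \<in> bounded_ops"
    by (simp_all add: c_def b_def bounded_ops_def blin_simps bounded_opsD[OF a(1)] bounded_opsD[OF a(2)]
        scaleC_add_right scaleC_diff_right scaleC_scaleC scaleC_scaleR mult.commute)
  have bc: "commutes b c"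
    using normal by (intro com_c bbnd com_b[symmetric]) (simp_all add: comp_simps b_def)
  obtain Q1 :: "nat \<Rightarrow> 'a \<Rightarrow>\<^sub>L 'a" and e1 where Q1: "\<And>k. sym_op (Q1 k)" "\<And>k. Q1 k o\<^sub>L Q1 k = Q1 k"
    "\<And>k S. commutes S b \<Longrightarrow> commutes S (Q1 k)" "summable (\<lambda>k. \<bar>e1 k\<bar>)"
    "\<And>x. (\<lambda>k. e1 k * inner (Q1 k x) x) sums inner (b x) x"
    using projection_expansion[OF symb] by blast
  obtain Q2 :: "nat \<Rightarrow> 'a \<Rightarrow>\<^sub>L 'a" and e2 where Q2: "\<And>k. sym_op (Q2 k)" "\<And>k. Q2 k o\<^sub>L Q2 k = Q2 k"
    "\<And>k S. commutes S c \<Longrightarrow> commutes S (Q2 k)" "summable (\<lambda>k. \<bar>e2 k\<bar>)"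
    "\<And>x. (\<lambda>k. e2 k * inner (Q2 k x) x) sums inner (c x) x"
    using projection_expansion[OF symc] by blast
  define Q where "Q k = (if even k then Q1 (k div 2) else Q2 (k div 2))" for k
  have Q_com: "commutes S (Q k)" if "commutes S b" "commutes S c" for S k
    using Q1(3)[OF that(1)] Q2(3)[OF that(2)] by (simp add: Q_def)
  have bQ: "commutes b (Q k)" and cQ: "commutes c (Q k)" for k
    using bc by (auto intro!: Q_com)
  interpret commuting_projections Q
  proof
    show "\<forall>x y. inner (Q k x) y = inner x (Q k y)" for k using Q1(1) Q2(1) by (simp add: Q_def)
    show "Q k o\<^sub>L Q k = Q k" for k using Q1(2) Q2(2) by (simp add: Q_def)
    show "commutes (Q j) (Q k)" for j k by (rule Q_com[OF bQ[symmetric] cQ[symmetric]])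
  qed
  obtain P where P: "pvm P" "\<And>S E. (\<And>k. commutes S (Q k)) \<Longrightarrow> E \<in> sets borel \<Longrightarrow> commutes S (P E)"
    and I: "\<And>x. integral\<^sup>L (pvm_measure P x) (\<lambda>z. z) =
      suminf (\<lambda>k. complex_of_real (e1 k * inner (Q (2 * k) x) x)
        + \<i> * complex_of_real (e2 k * inner (Q (2 * k + 1) x) x))"
    using pvm_exists[OF Q1(4) Q2(4), of "\<lambda>k. 2 * k" "\<lambda>k. 2 * k + 1"] by blast
  show ?thesis
  proof (rule that[of P])
    show com: "commutes S (P E)"
      if "S \<in> bounded_ops" "commutes S a" "commutes S a'" "E \<in> sets borel" for S E
      using that by (intro P(2) Q_com com_b com_c)
    show "spectral_for a P"
      unfolding spectral_for_def
    proof (intro conjI ballI allI P(1))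
      \<comment> \<open>The scalars commute with \<open>a\<close> and \<open>a'\<close>, hence with
        \<open>P E\<close>; this is complex linearity of \<open>P E\<close>.\<close>
      show "P E \<in> bounded_ops" if "E \<in> sets borel" for E
        unfolding bounded_ops_iff using that a by (intro allI com bounded_ops_commutes scaleC_op_bounded)
      fix x
      have "(\<lambda>k. complex_of_real (e1 k * inner (Q (2 * k) x) x)
          + \<i> * complex_of_real (e2 k * inner (Q (2 * k + 1) x) x))
        sums (complex_of_real (inner (b x) x) + \<i> * complex_of_real (inner (c x) x))"
        using Q1(5)[of x] Q2(5)[of x]
        by (intro sums_add sums_mult sums_of_real) (simp_all add: Q_def)
      then have "integral\<^sup>L (pvm_measure P x) (\<lambda>z. z)
          = complex_of_real (inner (b x) x) + \<i> * complex_of_real (inner (c x) x)"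
        unfolding I by (rule sums_unique[symmetric])
      moreover have "inner (b x) x = inner (a x) x"
        using adjR'[of x x] inner_commute[of x "a x"] by (simp add: b_def blin_simps inner_add_left)
      moreover have "inner (c x) x = inner (a x) (scaleC \<i> x)"
      proof -
        have "inner (a' x) (scaleC \<i> x) = inner x (scaleC \<i> (a x))"
          by (simp add: adjR' bounded_opsD a)
        also have "\<dots> = - inner (scaleC \<i> x) (a x)" using sc[of x "a x"] by (simp add: sc')
        also have "\<dots> = - inner (a x) (scaleC \<i> x)" by (simp only: inner_commute)
        finally show ?thesis by (simp add: c_def blin_simps sc inner_diff_left)
      qed
      ultimately show "cinner (a x) x = integral\<^sup>L (pvm_measure P x) (\<lambda>z. z)"
        by (simp add: cinner_conv_inner complex_eq_iff)
    qed
  qed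
qed

subsection \<open>Intertwiners and uniqueness of the spectral measure\<close>

context
  fixes P :: "complex set \<Rightarrow> 'a::complex_hilbert_space \<Rightarrow>\<^sub>L 'a"
  assumes P: "pvm P"
begin

lemma pvm_sym: "E \<in> sets borel \<Longrightarrow> inner (P E x) y = inner x (P E y)"
  and pvm_empty: "P {} = 0"
  and pvm_UNIV: "P UNIV = id_blinfun"
  and pvm_Int: "E \<in> sets borel \<Longrightarrow> F \<in> sets borel \<Longrightarrow> P (E \<inter> F) = P E o\<^sub>L P F"
  and pvm_sums: "range G \<subseteq> sets borel \<Longrightarrow> disjoint_family G \<Longrightarrow>
    (\<lambda>n. inner (P (G n) x) y) sums inner (P (\<Union>n. G n) x) y"
  and pvm_bounded: "\<exists>r. P (cball 0 r) = id_blinfun"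
  using P unfolding pvm_def by blast+

lemma pvm_Int_apply: "E \<in> sets borel \<Longrightarrow> F \<in> sets borel \<Longrightarrow> P E (P F x) = P (E \<inter> F) x"
  by (simp add: pvm_Int)

lemma pvm_form_nonneg: "E \<in> sets borel \<Longrightarrow> 0 \<le> inner (P E x) x"
  using pvm_Int_apply[of E E x] pvm_sym[of E "P E x" x] by (metis Int_absorb inner_ge_zero)

lemma pvm_Un:
  assumes "E \<in> sets borel" "F \<in> sets borel" "E \<inter> F = {}"
  shows "P (E \<union> F) x = P E x + P F x"
proof -
  let ?G = "\<lambda>n::nat. if n = 0 then E else if n = 1 then F else {}"
  have "range ?G \<subseteq> sets borel" "disjoint_family ?G"
    using assms by (auto simp: disjoint_family_on_def)
  from pvm_sums[OF this] have s: "(\<lambda>n. inner (P (?G n) x) y) sums inner (P (\<Union>n. ?G n) x) y" for y .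
  have U: "(\<Union>n. ?G n) = E \<union> F" by (auto split: if_splits)
  have "inner (P (E \<union> F) x) y = inner (P E x + P F x) y" for y
  proof (rule sums_unique2)
    show "(\<lambda>n. inner (P (?G n) x) y) sums inner (P (E \<union> F) x) y" using s[of y] unfolding U .
    have "(\<lambda>n. inner (P (?G n) x) y) sums (\<Sum>n\<in>{0,1}. inner (P (?G n) x) y)"
      by (rule sums_finite) (auto simp: pvm_empty)
    then show "(\<lambda>n. inner (P (?G n) x) y) sums inner (P E x + P F x) y"
      by (simp add: inner_add_left)
  qed
  then show ?thesis using vector_eq_rdot by blast
qed

lemma pvm_Compl:
  assumes "E \<in> sets borel"
  shows "P (- E) x = x - P E x"
proof -
  have "P (E \<union> - E) x = P E x + P (- E) x"
    using assms by (intro pvm_Un borel_comp) auto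
  then have "x = P E x + P (- E) x" by (simp add: pvm_UNIV)
  then show ?thesis by (metis add_diff_cancel_left')
qed

lemma norm_pvm_le: "E \<in> sets borel \<Longrightarrow> norm (P E x) \<le> norm x"
proof -
  assume E: "E \<in> sets borel"
  have "(norm (P E x))\<^sup>2 = inner (P E x) x"
    using pvm_Int_apply[OF E E, of x] pvm_sym[OF E, of "P E x" x] by (simp add: power2_norm_eq_inner)
  also have "\<dots> \<le> norm (P E x) * norm x" by (rule norm_cauchy_schwarz)
  finally show ?thesis by (cases "norm (P E x) = 0") (auto simp: power2_eq_square)
qed

lemma space_pvm_measure [simp]: "space (pvm_measure P x) = UNIV"
  by (simp add: pvm_measure_def)

lemma sets_pvm_measure [simp, measurable_cong]: "sets (pvm_measure P x) = sets borel"
  using sets.sigma_sets_eq[of "borel :: complex measure"] by (simp add: pvm_measure_def)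

lemma emeasure_pvm_measure:
  assumes "E \<in> sets borel"
  shows "emeasure (pvm_measure P x) E = ennreal (inner (P E x) x)"
  unfolding pvm_measure_def
proof (rule emeasure_measure_of_sigma)
  show "sigma_algebra UNIV (sets (borel :: complex measure))"
    using sets.sigma_algebra_axioms[of "borel :: complex measure"] by simp
  show "positive (sets borel) (\<lambda>E. ennreal (inner (P E x) x))"
    by (simp add: positive_def pvm_empty)
  show "countably_additive (sets borel) (\<lambda>E. ennreal (inner (P E x) x))"
  proof (rule countably_additiveI)
    fix G :: "nat \<Rightarrow> complex set"
    assume G: "range G \<subseteq> sets borel" "disjoint_family G"
    show "suminf (\<lambda>i. ennreal (inner (P (G i) x) x)) = ennreal (inner (P (\<Union>i. G i) x) x)"
      using G(1) by (intro suminf_ennreal_eq pvm_sums G pvm_form_nonneg) auto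
  qed
qed fact

lemma finite_pvm_measure: "finite_measure (pvm_measure P x)"
  by (rule finite_measureI) (simp add: emeasure_pvm_measure)

lemma measure_pvm_measure: "E \<in> sets borel \<Longrightarrow> measure (pvm_measure P x) E = inner (P E x) x"
  by (simp add: measure_def emeasure_pvm_measure pvm_form_nonneg)

lemma AE_pvm_measure:
  assumes "E \<in> sets borel" "P E x = x"
  shows "AE z in pvm_measure P x. z \<in> E"
proof (rule AE_I)
  show "emeasure (pvm_measure P x) (- E) = 0"
    using assms by (simp add: emeasure_pvm_measure borel_comp pvm_Compl)
qed (use assms in \<open>auto simp: borel_comp\<close>)

lemma integrable_pvm_measure: "integrable (pvm_measure P x) (\<lambda>z. z)"
proof -
  obtain r where r: "P (cball 0 r) = id_blinfun" using pvm_bounded by blast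
  interpret finite_measure "pvm_measure P x" by (rule finite_pvm_measure)
  have "AE z in pvm_measure P x. z \<in> cball 0 r"
    by (rule AE_pvm_measure) (auto simp: r)
  then show ?thesis
    by (intro integrable_const_bound[where B = r]) (auto simp: dist_norm)
qed

text \<open>Replacing \<open>x\<close> by \<open>P E x\<close> restricts its measure to
  \<open>E\<close>, since \<open>P E\<close>, \<open>P G\<close> and \<open>P E\<close> multiply to
  \<open>P (E \<inter> G)\<close>. An integral of \<open>z\<close> over \<open>E\<close> thus
  becomes a form of the operator on the range of \<open>P E\<close>.\<close>

lemma pvm_measure_restrict:
  assumes E: "E \<in> sets borel"
  shows "pvm_measure P (P E x) = density (pvm_measure P x) (indicator E)"
proof (rule measure_eqI)
  fix G assume "G \<in> sets (pvm_measure P (P E x))"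
  then have G: "G \<in> sets borel" by simp
  have "inner (P G (P E x)) (P E x) = inner (P E (P G (P E x))) x"
    using pvm_sym[OF E] by metis
  also have "P E (P G (P E x)) = P (E \<inter> G) x"
    using E G by (simp add: pvm_Int_apply Int_commute)
  finally have "emeasure (pvm_measure P (P E x)) G = emeasure (pvm_measure P x) (E \<inter> G)"
    using E G by (simp add: emeasure_pvm_measure)
  also have "\<dots> = \<integral>\<^sup>+ z. indicator (E \<inter> G) z \<partial>pvm_measure P x"
    using E G by simp
  also have "\<dots> = \<integral>\<^sup>+ z. indicator E z * indicator G z \<partial>pvm_measure P x"
    by (simp only: indicator_inter_arith)
  also have "\<dots> = emeasure (density (pvm_measure P x) (indicator E)) G"
    using E G by (intro emeasure_density[symmetric]) auto
  finally show "emeasure (pvm_measure P (P E x)) G = emeasure (density (pvm_measure P x) (indicator E)) G" .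
qed simp

lemma integral_pvm_measure_restrict:
  assumes E: "E \<in> sets borel"
  shows "integral\<^sup>L (pvm_measure P (P E x)) (\<lambda>z. z) = (\<integral>z. indicator E z *\<^sub>R z \<partial>pvm_measure P x)"
proof -
  have "density (pvm_measure P x) (indicator E) = density (pvm_measure P x) (\<lambda>z. ennreal (indicator E z))"
    by (simp add: ennreal_indicator)
  then show ?thesis
    unfolding pvm_measure_restrict[OF E] using E by (simp add: integral_density)
qed

end

text \<open>Testing with \<open>y\<close> and with \<open>scaleC \<i> y\<close> separates the two
  cross terms, so over the complex numbers the form alone determines the operator; in
  \<open>sym_op_form_eqI\<close> symmetry does this.\<close>

lemma complex_form_zero:
  fixes D :: "'a::complex_hilbert_space \<Rightarrow>\<^sub>L 'a"
  assumes D: "D \<in> bounded_ops" and zero: "\<And>x. cinner (D x) x = 0"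
  shows "D = 0"
proof (rule blinfun_eqI)
  fix x
  have s: "cinner (D x) y + cinner (D y) x = 0" for y
    using zero[of "x + y"] zero[of x] zero[of y]
    by (simp add: blin_simps cinner_add_left cinner_add_right add.commute)
  have "cinner (D x) y = 0" for y
  proof -
    have "\<i> * (cinner (D y) x - cinner (D x) y) = 0"
      using s[of "scaleC \<i> y"] by (simp add: bounded_opsD[OF D] cinner_scaleC_left cinner_scaleC_right algebra_simps)
    then have "cinner (D y) x = cinner (D x) y" by simp
    then show ?thesis using s[of y] by simp
  qed
  then show "D x = blinfun_apply 0 x" by (intro cinner_eqI) simp
qed

text \<open>Only diagonal values of \<open>a\<close> are known. The integral of \<open>z\<close>
  splits over \<open>E\<close> and its complement, so \<open>a\<close> and the sum of its two
  diagonal blocks relative to \<open>P E\<close> have the same form. They therefore agree, and a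
  block diagonal operator commutes with \<open>P E\<close>.\<close>

lemma spectral_for_commutes:
  assumes a: "a \<in> bounded_ops" and sf: "spectral_for a P" and E: "E \<in> sets borel"
  shows "commutes a (P E)"
proof -
  have P: "pvm P" and Pb: "\<And>E. E \<in> sets borel \<Longrightarrow> P E \<in> bounded_ops"
    and I: "\<And>x. cinner (a x) x = integral\<^sup>L (pvm_measure P x) (\<lambda>z. z)"
    using sf unfolding spectral_for_def by auto
  have E': "- E \<in> sets borel" using E by (rule borel_comp)
  define D where "D = a - (P E o\<^sub>L a o\<^sub>L P E) - (P (- E) o\<^sub>L a o\<^sub>L P (- E))"
  have cs: "cinner (P F x) y = cinner x (P F y)" if "F \<in> sets borel" for F x y
    using pvm_sym[OF P that] bounded_opsD[OF Pb[OF that]] by (simp add: cinner_conv_inner)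
  have "D = 0"
  proof (rule complex_form_zero)
    show "D \<in> bounded_ops"
      unfolding D_def using a Pb[OF E] Pb[OF E'] by (intro bounded_ops_diff bounded_ops_comp)
    fix x
    have part: "cinner (P F (a (P F x))) x = (\<integral>z. indicator F z *\<^sub>R z \<partial>pvm_measure P x)"
      if F: "F \<in> sets borel" for F
      by (simp add: cs[OF F] I integral_pvm_measure_restrict[OF P F])
    have int: "integrable (pvm_measure P x) (\<lambda>z. indicator F z *\<^sub>R z)" if "F \<in> sets borel" for F
      using that by (intro integrable_mult_indicator integrable_pvm_measure P) (simp add: sets_pvm_measure[OF P])
    have "cinner (P E (a (P E x))) x + cinner (P (- E) (a (P (- E) x))) x
        = (\<integral>z. indicator E z *\<^sub>R z + indicator (- E) z *\<^sub>R z \<partial>pvm_measure P x)"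
      unfolding part[OF E] part[OF E']
      by (rule Bochner_Integration.integral_add[symmetric]) (intro int E E')+
    also have "(\<lambda>z. indicator E z *\<^sub>R z + indicator (- E) z *\<^sub>R z) = (\<lambda>z::complex. z)"
      by (auto simp: indicator_def)
    finally show "cinner (D x) x = 0"
      by (simp add: D_def blin_simps cinner_diff_left I diff_diff_eq cinner_add_left)
  qed
  then have a_eq: "a x = P E (a (P E x)) + P (- E) (a (P (- E) x))" for x
  proof -
    have "D x = 0" by (simp add: \<open>D = 0\<close> blin_simps)
    then show ?thesis by (simp add: D_def blin_simps algebra_simps)
  qed
  have PP: "P E (P E y) = P E y" "P E (P (- E) y) = 0" "P (- E) (P E y) = 0" for y
    using E E' by (simp_all add: pvm_Int_apply[OF P] pvm_empty[OF P])
  show ?thesis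
  proof (rule commutesI)
    fix x
    have "a (P E x) = P E (a (P E x))" using a_eq[of "P E x"] by (simp add: PP blin_simps)
    moreover have "P E (a x) = P E (a (P E x))"
      using arg_cong[OF a_eq[of x], of "blinfun_apply (P E)"] by (simp add: PP blin_simps)
    ultimately show "a (P E x) = P E (a x)" by simp
  qed
qed

text \<open>On the range of \<open>P E\<close> the form of \<open>a - c\<close> is an integral of
  \<open>z - c\<close> over \<open>E\<close>, where the integrand is at most \<open>\<rho>\<close>.
  Polarisation passes from the form to the norm and costs the factor 2.\<close>

lemma spectral_for_norm_bound:
  assumes a: "a \<in> bounded_ops" and sf: "spectral_for a P" and E: "E \<in> sets borel"
    and ball: "E \<subseteq> cball c \<rho>" and w: "P E w = w"
  shows "norm (a w - scaleC c w) \<le> 2 * \<rho> * norm w"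
proof -
  have P: "pvm P" and Pb: "P E \<in> bounded_ops"
    and I: "\<And>x. cinner (a x) x = integral\<^sup>L (pvm_measure P x) (\<lambda>z. z)"
    using sf E unfolding spectral_for_def by auto
  define T where "T = a - scaleC_op c"
  have Tx: "T x = a x - scaleC c x" for x by (simp add: T_def blin_simps)
  have Tb: "T \<in> bounded_ops" unfolding T_def using a by (intro bounded_ops_diff) simp_all
  have PT: "P E (T x) = T (P E x)" for x
    using commutesD[OF spectral_for_commutes[OF a sf E]] bounded_opsD[OF Pb] by (simp add: Tx blin_simps)
  have q: "cmod (cinner (T v) v) \<le> \<rho> * (norm v)\<^sup>2" if v: "P E v = v" for v
  proof -
    interpret finite_measure "pvm_measure P v" by (rule finite_pvm_measure[OF P])
    have mU: "measure (pvm_measure P v) UNIV = (norm v)\<^sup>2"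
      by (simp add: measure_pvm_measure[OF P] pvm_UNIV[OF P] power2_norm_eq_inner)
    have int: "integrable (pvm_measure P v) (\<lambda>z. z - c)"
      by (intro Bochner_Integration.integrable_diff integrable_pvm_measure P) simp
    have "cinner (T v) v = integral\<^sup>L (pvm_measure P v) (\<lambda>z. z) - (\<integral>z. c \<partial>pvm_measure P v)"
      by (simp add: Tx cinner_diff_left I cinner_scaleC_left cinner_self mU space_pvm_measure[OF P] scaleR_conv_of_real)
    also have "\<dots> = (\<integral>z. z - c \<partial>pvm_measure P v)"
      by (rule Bochner_Integration.integral_diff[symmetric]) (simp_all add: integrable_pvm_measure[OF P])
    also have "cmod \<dots> \<le> (\<integral>z. norm (z - c) \<partial>pvm_measure P v)" by (rule integral_norm_bound)
    also have "\<dots> \<le> (\<integral>z. \<rho> \<partial>pvm_measure P v)"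
    proof (rule integral_mono_AE)
      show "AE z in pvm_measure P v. norm (z - c) \<le> \<rho>"
        by (rule eventually_mono[OF AE_pvm_measure[OF P E v]])
          (use ball in \<open>auto simp: dist_norm norm_minus_commute subset_iff\<close>)
    qed (use int in auto)
    also have "\<dots> = \<rho> * (norm v)\<^sup>2" by (simp add: mU space_pvm_measure[OF P])
    finally show ?thesis .
  qed
  have polar: "4 * inner (T w) v \<le> 4 * \<rho> * ((norm w)\<^sup>2 + (norm v)\<^sup>2)" if v: "P E v = v" for v
  proof -
    let ?q = "\<lambda>u. cinner (T u) u"
    have "4 * cinner (T w) v = ?q (w + v) - ?q (w - v) + \<i> * ?q (w + scaleC \<i> v) - \<i> * ?q (w - scaleC \<i> v)"
      by (simp add: blin_simps bounded_opsD[OF Tb] cinner_add_left cinner_add_right cinner_diff_left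
          cinner_diff_right cinner_scaleC_left cinner_scaleC_right algebra_simps)
    then have "4 * inner (T w) v = Re (?q (w + v) - ?q (w - v) + \<i> * ?q (w + scaleC \<i> v) - \<i> * ?q (w - scaleC \<i> v))"
      by (metis Re_divide_numeral inner_eq_Re_cinner nonzero_mult_div_cancel_left times_divide_eq_right zero_neq_numeral)
    also have "\<dots> \<le> cmod (?q (w + v)) + cmod (?q (w - v)) + cmod (?q (w + scaleC \<i> v)) + cmod (?q (w - scaleC \<i> v))"
      using complex_Re_le_cmod[of "?q (w + v)"] complex_Re_le_cmod[of "- ?q (w - v)"]
        complex_Re_le_cmod[of "\<i> * ?q (w + scaleC \<i> v)"] complex_Re_le_cmod[of "- \<i> * ?q (w - scaleC \<i> v)"]
      by (simp add: norm_mult)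
    also have "\<dots> \<le> \<rho> * (norm (w + v))\<^sup>2 + \<rho> * (norm (w - v))\<^sup>2
        + \<rho> * (norm (w + scaleC \<i> v))\<^sup>2 + \<rho> * (norm (w - scaleC \<i> v))\<^sup>2"
      by (intro add_mono q) (simp_all add: blin_simps w v bounded_opsD[OF Pb])
    also have "\<dots> = \<rho> * ((norm (w + v))\<^sup>2 + (norm (w - v))\<^sup>2)
        + \<rho> * ((norm (w + scaleC \<i> v))\<^sup>2 + (norm (w - scaleC \<i> v))\<^sup>2)"
      by (simp add: algebra_simps)
    also have "(norm (w + v))\<^sup>2 + (norm (w - v))\<^sup>2 = 2 * (norm w)\<^sup>2 + 2 * (norm v)\<^sup>2"
      by (simp add: power2_norm_eq_inner inner_add_left inner_add_right inner_diff_left inner_diff_right)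
    also have "(norm (w + scaleC \<i> v))\<^sup>2 + (norm (w - scaleC \<i> v))\<^sup>2 = 2 * (norm w)\<^sup>2 + 2 * (norm (scaleC \<i> v))\<^sup>2"
      by (simp add: power2_norm_eq_inner inner_add_left inner_add_right inner_diff_left inner_diff_right)
    finally show ?thesis by (simp add: norm_scaleC algebra_simps)
  qed
  show ?thesis
  proof (cases "T w = 0 \<or> w = 0")
    case True
    have "0 \<le> \<rho> * (norm w)\<^sup>2" using q[OF w] norm_ge_zero order_trans by blast
    then have "0 \<le> \<rho> * norm w" by (cases "w = 0") (auto simp: zero_le_mult_iff)
    then show ?thesis using True by (auto simp: Tx)
  next
    case False
    \<comment> \<open>The multiple of \<open>T w\<close> with the norm of \<open>w\<close>: it
      balances the two squares in \<open>polar\<close> and stays in the range of \<open>P E\<close>,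
      because \<open>T\<close> commutes with \<open>P E\<close>.\<close>
    define v where "v = (norm w / norm (T w)) *\<^sub>R T w"
    have "P E v = v" by (simp add: v_def blin_simps PT w)
    from polar[OF this] have "4 * inner (T w) v \<le> 8 * \<rho> * (norm w)\<^sup>2"
      using False by (simp add: v_def)
    moreover have "inner (T w) v = norm w * norm (T w)"
      using False by (simp add: v_def power2_norm_eq_inner[symmetric] power2_eq_square)
    ultimately have "norm w * norm (T w) \<le> norm w * (2 * \<rho> * norm w)"
      by (simp add: power2_eq_square algebra_simps)
    then show ?thesis using False by (simp add: Tx)
  qed
qed

text \<open>Balls around a countable dense set, made disjoint. Countability lets weak additivity
  reassemble the pieces.\<close>

lemma small_borel_partition:
  assumes "\<rho> > 0"
  obtains B :: "nat \<Rightarrow> complex set" and c where "\<And>n. B n \<in> sets borel" "disjoint_family B" "(\<Union>n. B n) = UNIV"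
    "\<And>n. B n \<subseteq> cball (c n) \<rho>"
proof -
  obtain D :: "complex set" where D: "countable D" "closure D = UNIV"
    using separable[of "UNIV :: complex set"] by (metis top.extremum_uniqueI)
  then have "D \<noteq> {}" by auto
  then have rng: "range (from_nat_into D) = D" using D(1) by (rule range_from_nat_into)
  define C where "C n = ball (from_nat_into D n) \<rho>" for n
  have "z \<in> (\<Union>n. C n)" for z
  proof -
    obtain y where "y \<in> D" "dist y z < \<rho>"
      using D(2) assms closure_approachable[of z D] by auto
    moreover from \<open>y \<in> D\<close> obtain n where "y = from_nat_into D n" using rng by blast
    ultimately show ?thesis by (auto simp: C_def)
  qed
  then have "(\<Union>n. C n) = UNIV" by blast
  then have U: "(\<Union>n. disjointed C n) = UNIV" using UN_disjointed_eq[of C] by simp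
  show ?thesis
  proof (rule that[of "disjointed C" "from_nat_into D"])
    show "disjointed C n \<in> sets borel" for n
    proof -
      have "range C \<subseteq> sets borel" by (auto simp: C_def)
      from sets.range_disjointed_sets[OF this] show ?thesis by blast
    qed
    show "disjointed C n \<subseteq> cball (from_nat_into D n) \<rho>" for n
      using disjointed_subset[of C n] by (auto simp: C_def)
  qed (use U disjoint_family_disjointed in auto)
qed

lemma pvm_apply_zeroI:
  fixes P :: "complex set \<Rightarrow> 'a::complex_hilbert_space \<Rightarrow>\<^sub>L 'a"
  assumes P: "pvm P" and G: "range G \<subseteq> sets borel" "disjoint_family G"
    and zero: "\<And>n::nat. inner (P (G n) x) y = 0"
  shows "inner (P (\<Union>n. G n) x) y = 0"
proof -
  have "(\<lambda>n. 0) sums inner (P (\<Union>n. G n) x) y"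
    using pvm_sums[OF P G, of x y] by (simp only: zero)
  then show ?thesis using sums_unique2 sums_zero by blast
qed

section \<open>Intertwining relations\<close>

context
  fixes a b S :: "'a::complex_hilbert_space \<Rightarrow>\<^sub>L 'a" and P P'
  assumes a: "a \<in> bounded_ops" "spectral_for a P" and b: "b \<in> bounded_ops" "spectral_for b P'"
    and S: "S \<in> bounded_ops" "S o\<^sub>L a = b o\<^sub>L S"
begin

lemma intertwined_pvm: "pvm P" "pvm P'"
  using a b by (auto simp: spectral_for_def)

text \<open>On \<open>T = P' F S P E\<close> the operator \<open>b\<close> acts both as nearly \<open>\<mu>\<close> from the left and, since
  \<open>b T = T a\<close>, as nearly \<open>\<lambda>\<close> from the right.\<close>

lemma intertwiner_small_zero:
  assumes E: "E \<in> sets borel" "E \<subseteq> cball l \<rho>" and F: "F \<in> sets borel" "F \<subseteq> cball m \<rho>"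
    and far: "4 * \<rho> < cmod (l - m)" and \<rho>: "0 \<le> \<rho>"
  shows "P' F (S (P E x)) = 0"
proof -
  note P = intertwined_pvm(1) and P' = intertwined_pvm(2)
  have Pb: "P E \<in> bounded_ops" and P'b: "P' F \<in> bounded_ops"
    using a b E F by (auto simp: spectral_for_def)
  define T where "T = P' F o\<^sub>L S o\<^sub>L P E"
  have Tx: "T x = P' F (S (P E x))" for x by (simp add: T_def)
  have Tb: "T \<in> bounded_ops" unfolding T_def by (intro bounded_ops_comp Pb P'b S)
  have Sa: "S (a x) = b (S x)" for x
    using arg_cong[OF S(2), of "\<lambda>T. blinfun_apply T x"] by simp
  have PE: "P E (P E x) = P E x" for x using E by (simp add: pvm_Int_apply[OF P])
  have PF: "P' F (P' F x) = P' F x" for x using F by (simp add: pvm_Int_apply[OF P'])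
  have bT: "b (T x) = T (a x)" for x
    using commutesD[OF spectral_for_commutes[OF a E(1)]] commutesD[OF spectral_for_commutes[OF b F(1)]]
    by (simp add: Tx flip: Sa)
  have TP: "T (P E x) = T x" for x by (simp add: Tx PE)
  have bound: "cmod (l - m) * norm (T x) \<le> 4 * \<rho> * norm T * norm x" for x
  proof -
    have "norm (b (T x) - scaleC l (T x)) = norm (T (a (P E x) - scaleC l (P E x)))"
      by (simp add: blin_simps bounded_opsD[OF Tb] TP flip: bT)
    also have "\<dots> \<le> norm T * norm (a (P E x) - scaleC l (P E x))" by (rule norm_blinfun)
    also have "\<dots> \<le> norm T * (2 * \<rho> * norm (P E x))"
      by (intro mult_left_mono spectral_for_norm_bound[OF a E] PE) simp
    also have "\<dots> \<le> norm T * (2 * \<rho> * norm x)"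
      by (intro mult_left_mono norm_pvm_le[OF P] E) (use \<rho> in auto)
    finally have 1: "norm (b (T x) - scaleC l (T x)) \<le> 2 * \<rho> * norm T * norm x" by (simp add: mult_ac)
    have "norm (b (T x) - scaleC m (T x)) \<le> 2 * \<rho> * norm (T x)"
      by (intro spectral_for_norm_bound[OF b F]) (simp add: Tx PF)
    also have "\<dots> \<le> 2 * \<rho> * (norm T * norm x)" by (intro mult_left_mono norm_blinfun) (use \<rho> in auto)
    finally have 2: "norm (b (T x) - scaleC m (T x)) \<le> 2 * \<rho> * norm T * norm x" by (simp add: mult_ac)
    have "scaleC (l - m) (T x) = (b (T x) - scaleC m (T x)) - (b (T x) - scaleC l (T x))"
      using scaleC_add_left[of "l - m" m "T x"] by (simp add: algebra_simps)
    then have "norm (scaleC (l - m) (T x)) \<le> norm (b (T x) - scaleC m (T x)) + norm (b (T x) - scaleC l (T x))"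
      by (metis norm_triangle_ineq4)
    then show ?thesis using 1 2 by (simp add: norm_scaleC)
  qed
  have pos: "cmod (l - m) > 0" using far \<rho> by linarith
  \<comment> \<open>The bound is linear in \<open>norm T\<close> with the factor
    \<open>4 * \<rho> / cmod (l - m)\<close> below 1, which forces \<open>T = 0\<close>.\<close>
  have "norm T \<le> 4 * \<rho> * norm T / cmod (l - m)"
  proof (rule norm_blinfun_bound)
    show "0 \<le> 4 * \<rho> * norm T / cmod (l - m)" using \<rho> by simp
    show "norm (T x) \<le> 4 * \<rho> * norm T / cmod (l - m) * norm x" for x
      using bound[of x] pos by (simp add: pos_le_divide_eq mult_ac)
  qed
  then have "norm T * cmod (l - m) \<le> norm T * (4 * \<rho>)"
    using pos by (simp add: pos_le_divide_eq mult_ac)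
  then have "norm T = 0"
    using far by (metis linorder_not_le mult_le_cancel_left_pos norm_ge_zero order_le_less)
  then show ?thesis using Tx[of x] by simp
qed

lemma intertwiner_separated_zero:
  assumes E: "E \<in> sets borel" and F: "F \<in> sets borel"
    and sep: "\<delta> > 0" "\<And>z w. z \<in> E \<Longrightarrow> w \<in> F \<Longrightarrow> \<delta> \<le> dist z w"
  shows "P' F (S (P E x)) = 0"
proof -
  note P = intertwined_pvm(1) and P' = intertwined_pvm(2)
  \<comment> \<open>The centres of cells that meet \<open>E\<close> and \<open>F\<close> are at
    least \<open>\<delta> - 2 * \<rho> = 6 * \<rho>\<close> apart, beyond the
    \<open>4 * \<rho>\<close> required by \<open>intertwiner_small_zero\<close>.\<close>
  define \<rho> where "\<rho> = \<delta> / 8"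
  have \<rho>: "\<rho> > 0" using sep(1) by (simp add: \<rho>_def)
  obtain B :: "nat \<Rightarrow> complex set" and c where B: "\<And>n. B n \<in> sets borel" "disjoint_family B" "(\<Union>n. B n) = UNIV" "\<And>n. B n \<subseteq> cball (c n) \<rho>"
    by (rule small_borel_partition[OF \<rho>]) blast
  have dis: "disjoint_family (\<lambda>n. G \<inter> B n)" for G :: "complex set"
    using B(2) unfolding disjoint_family_on_def by blast
  have UB: "(\<Union>n. G \<inter> B n) = G" for G using B(3) by blast
  have bor: "G \<inter> B n \<in> sets borel" if "G \<in> sets borel" for G n using that B(1) by blast
  have small: "P' (F \<inter> B k) (S (P (E \<inter> B n) x)) = 0" for k n x
  proof (cases "E \<inter> B n = {} \<or> F \<inter> B k = {}")
    case True
    then show ?thesis using pvm_empty[OF P] pvm_empty[OF P'] by (auto simp: blin_simps)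
  next
    case False
    then obtain z w where zw: "z \<in> E" "z \<in> B n" "w \<in> F" "w \<in> B k" by blast
    then have "dist (c n) z \<le> \<rho>" "dist (c k) w \<le> \<rho>" using B(4) by (meson mem_cball subsetD)+
    moreover have "dist z w \<le> dist (c n) z + dist (c n) (c k) + dist (c k) w"
      using dist_triangle[of z w "c n"] dist_triangle[of "c n" w "c k"] by (simp add: dist_commute)
    ultimately have "4 * \<rho> < dist (c n) (c k)" using sep(2)[OF zw(1,3)] \<rho> by (simp add: \<rho>_def)
    then show ?thesis
      using B(4) \<rho> by (intro intertwiner_small_zero[OF bor[OF E] _ bor[OF F], where \<rho> = \<rho>])
        (auto simp: dist_norm)
  qed
  obtain S' :: "'a \<Rightarrow>\<^sub>L 'a" where S': "\<And>x y. inner (S x) y = inner x (S' y)" using adjoint_exists by blast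
  have half: "P' (F \<inter> B k) (S (P E x)) = 0" for k x
  proof -
    have "inner (P' (F \<inter> B k) (S (P E x))) y = 0" for y
    proof -
      \<comment> \<open>Additivity of \<open>P\<close> is weak, so \<open>P G x\<close> has to stand
        alone in an inner product; the symmetry of \<open>P'\<close> and the adjoint of
        \<open>S\<close> carry the rest to the other side.\<close>
      have eq: "inner (P' (F \<inter> B k) (S (P G x))) y = inner (P G x) (S' (P' (F \<inter> B k) y))" for G
        using pvm_sym[OF P' bor[OF F]] S' by simp
      have "inner (P (\<Union>n. E \<inter> B n) x) (S' (P' (F \<inter> B k) y)) = 0"
        using bor[OF E] by (intro pvm_apply_zeroI[OF P _ dis]) (auto simp: small simp flip: eq)
      then show ?thesis unfolding eq UB .
    qed
    then show ?thesis using inner_eq_zero_iff by blast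
  qed
  have "inner (P' (\<Union>n. F \<inter> B n) (S (P E x))) y = 0" for y
    using bor[OF F] by (intro pvm_apply_zeroI[OF P' _ dis]) (auto simp: half)
  then show ?thesis unfolding UB using inner_eq_zero_iff by blast
qed

text \<open>The complement of a closed \<open>E\<close> is the union of the sets at distance at
  least \<open>1 / real (Suc n)\<close> from \<open>E\<close>; made disjoint, each is separated from
  \<open>E\<close>. Hence \<open>P' (- E) S P E\<close> and \<open>P' E S P (- E)\<close> both
  vanish, so \<open>S P E = P' E S P E = P' E S\<close>.\<close>

lemma intertwiner_closed:
  assumes E: "closed E"
  shows "S (P E x) = P' E (S x)"
proof -
  note P = intertwined_pvm(1) and P' = intertwined_pvm(2)
  have EB: "E \<in> sets borel" "- E \<in> sets borel" using E by (auto simp: borel_comp)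
  define F where "F n = {w. \<forall>z\<in>E. 1 / real (Suc n) \<le> dist z w}" for n
  have clF: "closed (F n)" for n
  proof -
    have "F n = (\<Inter>z\<in>E. {w. 1 / real (Suc n) \<le> dist z w})" by (auto simp: F_def)
    then show ?thesis by (auto intro!: closed_INT closed_Collect_le continuous_intros)
  qed
  have UF: "(\<Union>n. F n) = - E"
  proof (intro equalityI subsetI)
    fix w assume "w \<in> - E"
    moreover have "open (- E)" using E by auto
    ultimately obtain e where e: "e > 0" "ball w e \<subseteq> - E" using open_contains_ball by blast
    obtain n where "1 / real (Suc n) < e" using e(1) reals_Archimedean[of e] by (auto simp: inverse_eq_divide)
    then have "w \<in> F n" using e(2) by (force simp: F_def dist_commute subset_iff)
    then show "w \<in> (\<Union>n. F n)" by blast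
  qed (auto simp: F_def)
  define G where "G = disjointed F"
  have "range F \<subseteq> sets borel" using clF by auto
  then have G: "range G \<subseteq> sets borel" "disjoint_family G" "(\<Union>n. G n) = - E" "\<And>n. G n \<subseteq> F n"
    unfolding G_def UN_disjointed_eq
    by (simp_all only: sets.range_disjointed_sets disjoint_family_disjointed UF disjointed_subset)
  have GB: "G n \<in> sets borel" for n using G(1) by blast
  have sepG: "1 / real (Suc n) \<le> dist z w" if "z \<in> E" "w \<in> G n" for z w n
    using that G(4)[of n] by (auto simp: F_def)
  have sepG': "1 / real (Suc n) \<le> dist z w" if "z \<in> G n" "w \<in> E" for z w n
    using sepG[OF that(2,1)] by (simp only: dist_commute)
  have 1: "P' (- E) (S (P E x)) = 0" for x
  proof -
    have "P' (G n) (S (P E x)) = 0" for n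
      by (rule intertwiner_separated_zero[OF EB(1) GB, of "1 / real (Suc n)"]) (use sepG in auto)
    then have "inner (P' (\<Union>n. G n) (S (P E x))) y = 0" for y
      by (intro pvm_apply_zeroI[OF P' G(1,2)]) simp
    then show ?thesis unfolding G(3) using inner_eq_zero_iff by blast
  qed
  obtain S' :: "'a \<Rightarrow>\<^sub>L 'a" where S': "\<And>x y. inner (S x) y = inner x (S' y)" using adjoint_exists by blast
  have 2: "P' E (S (P (- E) x)) = 0" for x
  proof -
    have z: "P' E (S (P (G n) x)) = 0" for n
      by (rule intertwiner_separated_zero[OF GB EB(1), of "1 / real (Suc n)"])
        (use sepG' in auto)
    have eq: "inner (P' E (S (P H x))) y = inner (P H x) (S' (P' E y))" for H y
      using pvm_sym[OF P' EB(1)] S' by simp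
    have "inner (P (\<Union>n. G n) x) (S' (P' E y)) = 0" for y
      by (intro pvm_apply_zeroI[OF P G(1,2)]) (simp add: z flip: eq)
    then have "inner (P' E (S (P (- E) x))) y = 0" for y unfolding eq G(3) .
    then show ?thesis using inner_eq_zero_iff by blast
  qed
  show ?thesis
    using 1[of x] 2[of x] EB(1) by (simp add: pvm_Compl[OF P] pvm_Compl[OF P'] blin_simps)
qed

text \<open>The closed sets generate the Borel sets and are stable under intersection, and the
  relation passes to complements and disjoint unions. The assumption concerns \<open>a\<close> and
  \<open>b\<close> and not their adjoints, so this is a form of the Fuglede-Putnam theorem.\<close>

theorem spectral_intertwiner:
  assumes E: "E \<in> sets borel"
  shows "S o\<^sub>L P E = P' E o\<^sub>L S"
proof -
  note P = intertwined_pvm(1) and P' = intertwined_pvm(2)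
  obtain S' :: "'a \<Rightarrow>\<^sub>L 'a" where S': "\<And>x y. inner (S x) y = inner x (S' y)" using adjoint_exists by blast
  have bor: "sigma_sets UNIV (Collect closed) = sets (borel :: complex measure)"
    by (subst borel_eq_closed) simp
  have "Int_stable (Collect closed :: complex set set)" by (auto simp: Int_stable_def)
  moreover have "Collect closed \<subseteq> Pow (UNIV :: complex set)" by simp
  moreover have "E \<in> sigma_sets UNIV (Collect closed)" using E unfolding bor .
  ultimately have "\<forall>x. S (P E x) = P' E (S x)"
  proof (induction rule: sigma_sets_induct_disjoint)
    case (basic A)
    then show ?case using intertwiner_closed by simp
  next
    case empty
    then show ?case using pvm_empty[OF P] pvm_empty[OF P'] by (simp add: blin_simps)
  next
    case (compl A)
    then show ?case
      using pvm_Compl[OF P, of A] pvm_Compl[OF P', of A] unfolding bor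
      by (simp add: blin_simps flip: Compl_eq_Diff_UNIV)
  next
    case (union A)
    have A: "range A \<subseteq> sets borel" using union(2) unfolding bor .
    show ?case
    proof
      fix x
      have "inner (S (P (\<Union>i. A i) x)) y = inner (P' (\<Union>i. A i) (S x)) y" for y
      proof (rule sums_unique2)
        have "(\<lambda>n. inner (P (A n) x) (S' y)) sums inner (P (\<Union>i. A i) x) (S' y)"
          by (rule pvm_sums[OF P A union(1)])
        then show "(\<lambda>n. inner (P' (A n) (S x)) y) sums inner (S (P (\<Union>i. A i) x)) y"
          using union(3) by (simp flip: S')
        show "(\<lambda>n. inner (P' (A n) (S x)) y) sums inner (P' (\<Union>i. A i) (S x)) y"
          by (rule pvm_sums[OF P' A union(1)])
      qed
      then show "S (P (\<Union>i. A i) x) = P' (\<Union>i. A i) (S x)" using vector_eq_rdot by blast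
    qed
  qed
  then show ?thesis by (intro blinfun_eqI) simp
qed

end

corollary spectral_for_unique:
  assumes "a \<in> bounded_ops" "spectral_for a P" "spectral_for a P'" "E \<in> sets borel"
  shows "P E = P' E"
  using spectral_intertwiner[OF assms(1,2,1,3), of id_blinfun E] assms(4) by simp

text \<open>Countable additivity of a point mass \<open>t\<close> at \<open>z\<close>: disjointness
  leaves at most one nonzero term.\<close>

lemma sums_disjoint_family:
  fixes t :: real and F :: "nat \<Rightarrow> 'b set"
  assumes F: "disjoint_family F"
  shows "(\<lambda>n. if z \<in> F n then t else 0) sums (if z \<in> (\<Union>n. F n) then t else 0)"
proof (cases "z \<in> (\<Union>n. F n)")
  case True
  then obtain n where n: "z \<in> F n" by blast
  have "F k \<inter> F n = {}" if "k \<noteq> n" for k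
    using F that by (simp add: disjoint_family_on_def)
  with n have iff: "z \<in> F k \<longleftrightarrow> k = n" for k by blast
  show ?thesis using True sums_single[of n "\<lambda>_. t"] by (simp only: iff if_True)
next
  case False
  then show ?thesis by simp
qed

lemma spectral_for_projection:
  fixes p :: "'a::complex_hilbert_space \<Rightarrow>\<^sub>L 'a"
  assumes p: "p \<in> bounded_ops" "sym_op p" "p o\<^sub>L p = p"
  shows "spectral_for p (\<lambda>E. (if 1 \<in> E then p else 0) + (if 0 \<in> E then id_blinfun - p else 0))"
    (is "spectral_for p ?P")
proof -
  have P: "pvm ?P"
    unfolding pvm_def
  proof (intro conjI ballI allI impI)
    show "inner (?P E x) y = inner x (?P E y)" for E x y
      using p(2) by (simp add: blin_simps inner_add_left inner_add_right inner_diff_left inner_diff_right)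
    show "?P (E \<inter> F) = ?P E o\<^sub>L ?P F" for E F by (simp add: comp_simps p(3))
    have "?P (cball 0 1) = id_blinfun" by simp
    then show "\<exists>r. ?P (cball 0 r) = id_blinfun" by blast
    fix F :: "nat \<Rightarrow> complex set" and x y :: 'a
    assume F: "range F \<subseteq> sets borel \<and> disjoint_family F"
    note ind = sums_disjoint_family[OF conjunct2[OF F]]
    have eq: "inner (?P E x) y = (if 1 \<in> E then inner (p x) y else 0)
        + (if 0 \<in> E then inner (x - p x) y else 0)" for E
      by (simp add: blin_simps inner_add_left)
    show "(\<lambda>n. inner (?P (F n) x) y) sums inner (?P (\<Union>n. F n) x) y"
      unfolding eq by (intro sums_add ind)
  qed simp_all
  show ?thesis
    unfolding spectral_for_def
  proof (intro conjI ballI allI P)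
    show "?P E \<in> bounded_ops" for E using p(1) by (simp add: bounded_ops_add bounded_ops_diff)
    fix x
    have "AE z in pvm_measure ?P x. z \<in> {0, 1}"
      by (rule AE_pvm_measure[OF P]) simp_all
    \<comment> \<open>On {0, 1} the function \<open>z\<close> is the indicator of {1}, so its
      integral is the measure of {1}.\<close>
    then have "AE z in pvm_measure ?P x. z = complex_of_real (indicator {1} z)"
      by eventually_elim auto
    then have "integral\<^sup>L (pvm_measure ?P x) (\<lambda>z. z) = (\<integral>z. complex_of_real (indicator {1} z) \<partial>pvm_measure ?P x)"
      using sets_pvm_measure[OF P, measurable_cong] by (intro integral_cong_AE) measurable
    also have "\<dots> = complex_of_real (measure (pvm_measure ?P x) {1})"
      by (simp add: sets_pvm_measure[OF P] space_pvm_measure[OF P])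
    also have "\<dots> = complex_of_real (inner (p x) x)"
      by (simp add: measure_pvm_measure[OF P])
    also have "\<dots> = cinner (p x) x"
    proof -
      have pp: "p (p x) = p x" using arg_cong[OF p(3), of "\<lambda>T. blinfun_apply T x"] by simp
      have "cinner (p x) x = cinner (p x) (p x)"
        unfolding cinner_conv_inner
        by (simp only: bounded_opsD[OF p(1), symmetric] sym_opD[OF p(2), symmetric] pp)
      then show ?thesis by (simp add: cinner_self inner_eq_Re_cinner)
    qed
    finally show "cinner (p x) x = integral\<^sup>L (pvm_measure ?P x) (\<lambda>z. z)" ..
  qed
qed

subsection \<open>Adjoints\<close>

lemma op_adj_eqI:
  assumes "\<And>x y. cinner (blinfun_apply T x) y = cinner x (blinfun_apply S y)"
  shows "op_adj T = S"
  unfolding op_adj_def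
proof (rule the_equality)
  fix R assume "\<forall>x y. cinner (T x) y = cinner x (blinfun_apply R y)"
  then have "cinner x (R y) = cinner x (S y)" for x y using assms by simp
  then show "R = S" by (intro blinfun_eqI cinner_eqI')
qed (use assms in blast)

text \<open>Moving a scalar across the real inner product and back shows that the real adjoint is
  complex linear; it is then an adjoint for \<open>cinner\<close>, and uniqueness identifies it with
  the definite description \<open>op_adj\<close>.\<close>

lemma op_adj:
  assumes T: "T \<in> bounded_ops"
  shows "cinner (T x) y = cinner x (op_adj T y)" and op_adj_bounded: "op_adj T \<in> bounded_ops"
proof -
  obtain S :: "'a \<Rightarrow>\<^sub>L 'a" where S: "\<And>x y. inner (T x) y = inner x (S y)" using adjoint_exists by blast
  have Sb: "S \<in> bounded_ops"
    unfolding bounded_ops_def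
  proof (clarify)
    fix c y
    have "inner x (S (scaleC c y)) = inner x (scaleC c (S y))" for x
      using inner_scaleC[of "cnj c" "T x" y] inner_scaleC[of "cnj c" x "S y"] S[of x "scaleC c y"]
        S[of "scaleC (cnj c) x" y] by (simp add: bounded_opsD[OF T])
    then show "S (scaleC c y) = scaleC c (S y)" using vector_eq_ldot by blast
  qed
  have c: "cinner (T x) y = cinner x (S y)" for x y
    by (simp add: cinner_conv_inner S bounded_opsD[OF Sb])
  then have "op_adj T = S" by (rule op_adj_eqI)
  with c Sb show "cinner (T x) y = cinner x (op_adj T y)" "op_adj T \<in> bounded_ops" by simp_all
qed

lemma op_adj_right: "T \<in> bounded_ops \<Longrightarrow> cinner (op_adj T x) y = cinner x (T y)"
  using op_adj(1)[of T y x] by (metis cinner_commute)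

lemma op_adj_adj [simp]: "T \<in> bounded_ops \<Longrightarrow> op_adj (op_adj T) = T"
  by (rule op_adj_eqI) (rule op_adj_right)

lemma op_adj_zero [simp]: "op_adj (0 :: 'a::complex_hilbert_space \<Rightarrow>\<^sub>L 'a) = 0"
  by (rule op_adj_eqI) simp

lemma op_adj_id [simp]: "op_adj (id_blinfun :: 'a::complex_hilbert_space \<Rightarrow>\<^sub>L 'a) = id_blinfun"
  by (rule op_adj_eqI) simp

lemma op_adj_comp:
  assumes "S \<in> bounded_ops" "T \<in> bounded_ops"
  shows "op_adj (S o\<^sub>L T) = op_adj T o\<^sub>L op_adj S"
  by (rule op_adj_eqI) (simp add: assms op_adj(1))

lemma bounded_ops_sum: "(\<And>i. i \<in> I \<Longrightarrow> f i \<in> bounded_ops) \<Longrightarrow> sum f I \<in> bounded_ops"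
  by (induction I rule: infinite_finite_induct) (auto intro: bounded_ops_add)

lemma cinner_sum_left: "cinner (sum f I) y = (\<Sum>i\<in>I. cinner (f i) y)"
  for y :: "'a::complex_hilbert_space"
  by (induction I rule: infinite_finite_induct) (auto simp: cinner_add_left)

lemma cinner_sum_right: "cinner y (sum f I) = (\<Sum>i\<in>I. cinner y (f i))"
  for y :: "'a::complex_hilbert_space"
  by (induction I rule: infinite_finite_induct) (auto simp: cinner_add_right)

lemma op_adj_sum:
  assumes "\<And>i. i \<in> I \<Longrightarrow> f i \<in> bounded_ops"
  shows "op_adj (sum f I) = (\<Sum>i\<in>I. op_adj (f i))"
  by (rule op_adj_eqI) (simp add: blinfun.sum_left cinner_sum_left cinner_sum_right assms op_adj(1))

subsection \<open>Square-summable sequences\<close>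

text \<open>All the spaces $H^r$ embed into the single type \<open>'h l2\<close>.\<close>

typedef (overloaded) 'h l2 = "{f :: nat \<Rightarrow> 'h::complex_hilbert_space. summable (\<lambda>n. (norm (f n))\<^sup>2)}"
  morphisms l2_nth Abs_l2
  by (rule exI[of _ "\<lambda>_. 0"]) simp

setup_lifting type_definition_l2

lemma summable_l2_nth: "summable (\<lambda>n. (norm (l2_nth x n))\<^sup>2)"
  using l2_nth[of x] by simp

lemma l2_eqI: "(\<And>n. l2_nth x n = l2_nth y n) \<Longrightarrow> x = y"
  by (simp add: l2_nth_inject[symmetric] ext)

lemma norm_add_square_le: "(norm (x + y))\<^sup>2 \<le> 2 * (norm x)\<^sup>2 + 2 * (norm y)\<^sup>2"
  for x y :: "'a::real_inner"
proof -
  have "(norm (x + y))\<^sup>2 + (norm (x - y))\<^sup>2 = 2 * (norm x)\<^sup>2 + 2 * (norm y)\<^sup>2"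
    by (simp add: power2_norm_eq_inner inner_add_left inner_add_right inner_diff_left inner_diff_right)
  then show ?thesis using zero_le_power2[of "norm (x - y)"] by linarith
qed

lemma summable_norm_add_square:
  fixes f g :: "nat \<Rightarrow> 'a::real_inner"
  assumes "summable (\<lambda>n. (norm (f n))\<^sup>2)" "summable (\<lambda>n. (norm (g n))\<^sup>2)"
  shows "summable (\<lambda>n. (norm (f n + g n))\<^sup>2)"
proof (rule summable_comparison_test'[where N = 0])
  show "summable (\<lambda>n. 2 * (norm (f n))\<^sup>2 + 2 * (norm (g n))\<^sup>2)"
    by (intro summable_add summable_mult assms)
qed (use norm_add_square_le in auto)

lemma summable_inner_l2:
  fixes f g :: "nat \<Rightarrow> 'a::real_inner"
  assumes "summable (\<lambda>n. (norm (f n))\<^sup>2)" "summable (\<lambda>n. (norm (g n))\<^sup>2)"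
  shows "summable (\<lambda>n. inner (f n) (g n))"
proof (rule summable_comparison_test'[where N = 0])
  show "summable (\<lambda>n. (norm (f n))\<^sup>2 + (norm (g n))\<^sup>2)" by (intro summable_add assms)
  fix n
  have "\<bar>inner (f n) (g n)\<bar> \<le> norm (f n) * norm (g n)" by (rule Cauchy_Schwarz_ineq2)
  also have "\<dots> \<le> (norm (f n))\<^sup>2 + (norm (g n))\<^sup>2"
    using sum_squares_bound[of "norm (f n)" "norm (g n)"]
      mult_nonneg_nonneg[OF norm_ge_zero[of "f n"] norm_ge_zero[of "g n"]] by linarith
  finally show "norm (inner (f n) (g n)) \<le> (norm (f n))\<^sup>2 + (norm (g n))\<^sup>2" by simp
qed

section \<open>The Hilbert space structure\<close>

instantiation l2 :: (complex_hilbert_space) real_vector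
begin

lift_definition zero_l2 :: "'a l2" is "\<lambda>_. 0" by simp
lift_definition plus_l2 :: "'a l2 \<Rightarrow> 'a l2 \<Rightarrow> 'a l2" is "\<lambda>f g n. f n + g n"
  by (rule summable_norm_add_square)
lift_definition uminus_l2 :: "'a l2 \<Rightarrow> 'a l2" is "\<lambda>f n. - f n" by simp
lift_definition minus_l2 :: "'a l2 \<Rightarrow> 'a l2 \<Rightarrow> 'a l2" is "\<lambda>f g n. f n - g n"
proof -
  fix f g :: "nat \<Rightarrow> 'a"
  assume "summable (\<lambda>n. (norm (f n))\<^sup>2)" "summable (\<lambda>n. (norm (g n))\<^sup>2)"
  then show "summable (\<lambda>n. (norm (f n - g n))\<^sup>2)"
    using summable_norm_add_square[of f "\<lambda>n. - g n"] by simp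
qed
lift_definition scaleR_l2 :: "real \<Rightarrow> 'a l2 \<Rightarrow> 'a l2" is "\<lambda>r f n. r *\<^sub>R f n"
  by (simp add: power_mult_distrib summable_mult)

instance
  by standard (transfer; simp add: algebra_simps)+

end

instantiation l2 :: (complex_hilbert_space) real_inner
begin

definition inner_l2 :: "'a l2 \<Rightarrow> 'a l2 \<Rightarrow> real" where
  "inner_l2 x y = suminf (\<lambda>n. inner (l2_nth x n) (l2_nth y n))"
definition norm_l2 :: "'a l2 \<Rightarrow> real" where "norm_l2 x = sqrt (inner x x)"
definition dist_l2 :: "'a l2 \<Rightarrow> 'a l2 \<Rightarrow> real" where "dist_l2 x y = norm (x - y)"
definition sgn_l2 :: "'a l2 \<Rightarrow> 'a l2" where "sgn_l2 x = x /\<^sub>R norm x"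
definition uniformity_l2 :: "('a l2 \<times> 'a l2) filter" where
  "uniformity_l2 = (INF e\<in>{0 <..}. principal {(x, y). dist x y < e})"
definition open_l2 :: "'a l2 set \<Rightarrow> bool" where
  "open_l2 U \<longleftrightarrow> (\<forall>x\<in>U. eventually (\<lambda>(x', y). x' = x \<longrightarrow> y \<in> U) uniformity)"

instance
proof
  fix x y z :: "'a l2" and r :: real
  show "dist x y = norm (x - y)" "sgn x = x /\<^sub>R norm x" "norm x = sqrt (inner x x)"
    by (fact dist_l2_def sgn_l2_def norm_l2_def)+
  show "uniformity = (INF e\<in>{0 <..}. principal {(x, y). dist (x::'a l2) y < e})"
    by (fact uniformity_l2_def)
  show "open U \<longleftrightarrow> (\<forall>x\<in>U. eventually (\<lambda>(x', y). x' = x \<longrightarrow> y \<in> U) uniformity)" for U :: "'a l2 set"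
    by (fact open_l2_def)
  show "inner x y = inner y x" by (simp add: inner_l2_def inner_commute)
  have sm: "summable (\<lambda>n. inner (l2_nth x n) (l2_nth y n))" for x y :: "'a l2"
    by (intro summable_inner_l2 summable_l2_nth)
  show "inner (x + y) z = inner x z + inner y z"
    by (simp add: inner_l2_def plus_l2.rep_eq inner_add_left suminf_add sm)
  show "inner (r *\<^sub>R x) y = r * inner x y"
    by (simp add: inner_l2_def scaleR_l2.rep_eq suminf_mult sm)
  show "0 \<le> inner x x"
    unfolding inner_l2_def by (intro suminf_nonneg sm) simp
  show "inner x x = 0 \<longleftrightarrow> x = 0"
  proof
    assume "inner x x = 0"
    then have "\<forall>n. inner (l2_nth x n) (l2_nth x n) = 0"
      using suminf_eq_zero_iff[OF sm[of x x]] by (simp add: inner_l2_def)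
    then show "x = 0" by (intro l2_eqI) (simp add: zero_l2.rep_eq)
  qed (simp add: inner_l2_def zero_l2.rep_eq)
qed

end

lemma inner_l2_sums: "(\<lambda>n. inner (l2_nth x n) (l2_nth y n)) sums inner x y"
  unfolding inner_l2_def by (intro summable_sums summable_inner_l2 summable_l2_nth)

lemma sum_norm_square_le: "(\<Sum>n\<in>A. (norm (l2_nth x n))\<^sup>2) \<le> (norm x)\<^sup>2" if "finite A"
  using sum_le_suminf[OF summable_l2_nth that, of x]
  by (simp add: power2_norm_eq_inner inner_l2_def)

lemma norm_l2_nth_le: "norm (l2_nth x n) \<le> norm x"
  by (rule power2_le_imp_le[OF _ norm_ge_zero]) (use sum_norm_square_le[of "{n}" x] in simp)

text \<open>Coordinates converge because they are dominated by the norm. Bounds on finite partial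
  sums pass to the coordinatewise limit, uniformly in the finite set; this gives both square
  summability of the limit and convergence in norm.\<close>

instance l2 :: (complex_hilbert_space) complete_space
proof
  fix X :: "nat \<Rightarrow> 'a l2" assume X: "Cauchy X"
  have "Cauchy (\<lambda>k. l2_nth (X k) n)" for n
  proof (rule metric_CauchyI)
    fix e :: real assume "e > 0"
    then obtain N where N: "\<And>m k. m \<ge> N \<Longrightarrow> k \<ge> N \<Longrightarrow> dist (X m) (X k) < e"
      using X by (meson metric_CauchyD)
    have "dist (l2_nth (X m) n) (l2_nth (X k) n) \<le> dist (X m) (X k)" for m k
      using norm_l2_nth_le[of "X m - X k" n] by (simp add: dist_norm minus_l2.rep_eq)
    then show "\<exists>N. \<forall>m\<ge>N. \<forall>k\<ge>N. dist (l2_nth (X m) n) (l2_nth (X k) n) < e"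
      using N order_le_less_trans by blast
  qed
  then have "\<exists>l. (\<lambda>k. l2_nth (X k) n) \<longlonglongrightarrow> l" for n
    using Cauchy_convergent convergent_def by blast
  then obtain f where f: "\<And>n. (\<lambda>k. l2_nth (X k) n) \<longlonglongrightarrow> f n" by metis
  have tail: "\<exists>N. \<forall>m\<ge>N. \<forall>A. finite A \<longrightarrow> (\<Sum>n\<in>A. (norm (l2_nth (X m) n - f n))\<^sup>2) \<le> e\<^sup>2" if e: "e > 0" for e
  proof -
    obtain N where N: "\<And>m k. m \<ge> N \<Longrightarrow> k \<ge> N \<Longrightarrow> dist (X m) (X k) < e"
      using X e by (meson metric_CauchyD)
    have "(\<Sum>n\<in>A. (norm (l2_nth (X m) n - f n))\<^sup>2) \<le> e\<^sup>2" if "m \<ge> N" "finite A" for m A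
    proof (rule LIMSEQ_le_const2)
      show "(\<lambda>k. \<Sum>n\<in>A. (norm (l2_nth (X m) n - l2_nth (X k) n))\<^sup>2) \<longlonglongrightarrow> (\<Sum>n\<in>A. (norm (l2_nth (X m) n - f n))\<^sup>2)"
        by (intro tendsto_intros f)
      have "(\<Sum>n\<in>A. (norm (l2_nth (X m) n - l2_nth (X k) n))\<^sup>2) \<le> e\<^sup>2" if k: "k \<ge> N" for k
      proof -
        have "(\<Sum>n\<in>A. (norm (l2_nth (X m) n - l2_nth (X k) n))\<^sup>2) \<le> (norm (X m - X k))\<^sup>2"
          using sum_norm_square_le[OF \<open>finite A\<close>, of "X m - X k"] by (simp add: minus_l2.rep_eq)
        also have "\<dots> \<le> e\<^sup>2"
          using N[OF \<open>m \<ge> N\<close> k] by (intro power_mono) (simp_all add: dist_norm)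
        finally show ?thesis .
      qed
      then show "\<exists>N. \<forall>k\<ge>N. (\<Sum>n\<in>A. (norm (l2_nth (X m) n - l2_nth (X k) n))\<^sup>2) \<le> e\<^sup>2" by blast
    qed
    then show ?thesis by blast
  qed
  have sum_diff: "summable (\<lambda>n. (norm (l2_nth (X m) n - f n))\<^sup>2)"
    if "\<forall>A. finite A \<longrightarrow> (\<Sum>n\<in>A. (norm (l2_nth (X m) n - f n))\<^sup>2) \<le> e\<^sup>2" for m e
    using that by (intro summableI_nonneg_bounded[where x = "e\<^sup>2"]) auto
  obtain N where "\<forall>A. finite A \<longrightarrow> (\<Sum>n\<in>A. (norm (l2_nth (X N) n - f n))\<^sup>2) \<le> 1\<^sup>2"
    using tail[of 1] by auto
  from summable_norm_add_square[OF summable_l2_nth[of "X N"], of "\<lambda>n. f n - l2_nth (X N) n"]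
    sum_diff[OF this] have "summable (\<lambda>n. (norm (f n))\<^sup>2)"
    by (simp add: norm_minus_commute)
  then have L: "l2_nth (Abs_l2 f) = f" by (intro Abs_l2_inverse) simp
  have "X \<longlonglongrightarrow> Abs_l2 f"
  proof (rule metric_LIMSEQ_I)
    fix e :: real assume e: "e > 0"
    obtain N where N: "\<And>m A. m \<ge> N \<Longrightarrow> finite A \<Longrightarrow> (\<Sum>n\<in>A. (norm (l2_nth (X m) n - f n))\<^sup>2) \<le> (e/2)\<^sup>2"
      using tail[of "e/2"] e by auto
    have "dist (X m) (Abs_l2 f) < e" if "m \<ge> N" for m
    proof -
      have "suminf (\<lambda>n. (norm (l2_nth (X m) n - f n))\<^sup>2) \<le> (e/2)\<^sup>2"
        using N[OF that] by (intro suminf_le_const sum_diff[where e = "e/2"]) auto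
      then have "(norm (X m - Abs_l2 f))\<^sup>2 \<le> (e/2)\<^sup>2"
        by (simp add: power2_norm_eq_inner inner_l2_def minus_l2.rep_eq L)
      then have "norm (X m - Abs_l2 f) \<le> e/2" by (rule power2_le_imp_le) (use e in simp)
      then show ?thesis using e by (simp add: dist_norm)
    qed
    then show "\<exists>N. \<forall>m\<ge>N. dist (X m) (Abs_l2 f) < e" by blast
  qed
  then show "convergent X" by (rule convergentI)
qed

instantiation l2 :: (complex_hilbert_space) complex_hilbert_space
begin

lift_definition scaleC_l2 :: "complex \<Rightarrow> 'a l2 \<Rightarrow> 'a l2" is "\<lambda>c f n. scaleC c (f n)"
  by (simp add: norm_scaleC power_mult_distrib summable_mult)

text \<open>The identity \<open>cinner_conv_inner\<close> taken as definition, so that only real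
  series are summed.\<close>

definition cinner_l2 :: "'a l2 \<Rightarrow> 'a l2 \<Rightarrow> complex" where
  "cinner_l2 x y = Complex (inner x y) (inner x (scaleC \<i> y))"

instance
proof
  fix x y z :: "'a l2" and c d :: complex and t :: real
  show add: "scaleC c (x + y) = scaleC c x + scaleC c y" for c
    by transfer (simp add: scaleC_add_right)
  show addl: "scaleC (c + d) x = scaleC c x + scaleC d x" for c d
    by transfer (simp add: scaleC_add_left)
  show sc: "scaleC c (scaleC d x) = scaleC (c * d) x" for c d and x :: "'a l2"
    by transfer (simp add: scaleC_scaleC)
  show re: "scaleC (complex_of_real t) x = t *\<^sub>R x" for t and x :: "'a l2"
    by transfer (simp add: scaleC_of_real)
  have adj: "inner (scaleC c x) y = inner x (scaleC (cnj c) y)" for c and x y :: "'a l2"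
    by (simp add: inner_l2_def scaleC_l2.rep_eq inner_scaleC)
  have neg: "scaleC (- c) x = - scaleC c x" for c and x :: "'a l2"
    by (rule l2_eqI) (simp add: scaleC_l2.rep_eq uminus_l2.rep_eq scaleC_minus_left)
  show "cinner x y = cnj (cinner y x)"
    using adj[of \<i> y x] by (simp add: cinner_l2_def complex_eq_iff inner_commute neg)
  show "cinner (x + y) z = cinner x z + cinner y z"
    by (simp add: cinner_l2_def complex_eq_iff inner_add_left)
  show "cinner (scaleC c x) y = c * cinner x y"
  proof -
    have c: "scaleC c x = Re c *\<^sub>R x + Im c *\<^sub>R scaleC \<i> x"
      unfolding re[symmetric] sc addl[symmetric]
      by (subst complex_eq[of c]) (simp only: mult.commute)
    have i: "inner (scaleC \<i> x) y = - inner x (scaleC \<i> y)"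
      "inner (scaleC \<i> x) (scaleC \<i> y) = inner x y"
      by (simp_all add: adj neg sc re[of 1 y, simplified])
    show ?thesis
      unfolding c cinner_l2_def by (simp add: complex_eq_iff inner_add_left i algebra_simps)
  qed
  show "inner x y = Re (cinner x y)" by (simp add: cinner_l2_def)
qed

end

section \<open>Coordinate projections and embeddings\<close>

lift_definition l2_pr :: "nat \<Rightarrow> 'a::complex_hilbert_space l2 \<Rightarrow>\<^sub>L 'a" is "\<lambda>i x. l2_nth x i"
proof
  fix i and x y :: "'a l2" and r
  show "l2_nth (x + y) i = l2_nth x i + l2_nth y i" by (simp add: plus_l2.rep_eq)
  show "l2_nth (r *\<^sub>R x) i = r *\<^sub>R l2_nth x i" by (simp add: scaleR_l2.rep_eq)
  show "\<exists>K. \<forall>x::'a l2. norm (l2_nth x i) \<le> norm x * K"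
    by (intro exI[of _ 1]) (simp add: norm_l2_nth_le)
qed

lift_definition l2_single :: "nat \<Rightarrow> 'a::complex_hilbert_space \<Rightarrow> 'a l2" is "\<lambda>i h n. if n = i then h else 0"
proof -
  fix i :: nat and h :: 'a
  have "(\<lambda>n. (norm (if n = i then h else 0))\<^sup>2) = (\<lambda>n. if n = i then (norm h)\<^sup>2 else 0)" by auto
  then show "summable (\<lambda>n. (norm (if n = i then h else 0))\<^sup>2)" by simp
qed

lemma inner_l2_single: "inner (l2_single i h) x = inner h (l2_nth x i)"
proof -
  have "(\<lambda>n. inner (l2_nth (l2_single i h) n) (l2_nth x n)) = (\<lambda>n. if n = i then inner h (l2_nth x n) else 0)"
    by (auto simp: l2_single.rep_eq)
  then have "(\<lambda>n. inner (l2_nth (l2_single i h) n) (l2_nth x n)) sums inner h (l2_nth x i)"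
    using sums_single[of i "\<lambda>n. inner h (l2_nth x n)"] by simp
  then show ?thesis using inner_l2_sums sums_unique2 by blast
qed

lift_definition l2_inj :: "nat \<Rightarrow> 'a::complex_hilbert_space \<Rightarrow>\<^sub>L 'a l2" is l2_single
proof
  fix i and x y :: 'a and r
  show "l2_single i (x + y) = l2_single i x + l2_single i y"
    by (rule l2_eqI) (simp add: l2_single.rep_eq plus_l2.rep_eq)
  show "l2_single i (r *\<^sub>R x) = r *\<^sub>R l2_single i x"
    by (rule l2_eqI) (simp add: l2_single.rep_eq scaleR_l2.rep_eq)
  show "\<exists>K. \<forall>x::'a. norm (l2_single i x) \<le> norm x * K"
    by (intro exI[of _ 1]) (simp add: norm_eq_sqrt_inner inner_l2_single l2_single.rep_eq)
qed

lemma l2_pr_inj [simp]: "l2_pr i (l2_inj j h) = (if i = j then h else 0)"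
  by (simp add: l2_pr.rep_eq l2_inj.rep_eq l2_single.rep_eq)

lemma l2_pr_eqI: "(\<And>i. l2_pr i x = l2_pr i y) \<Longrightarrow> x = y"
  by (rule l2_eqI) (simp add: l2_pr.rep_eq)

lemma l2_pr_scaleC: "l2_pr i (scaleC c x) = scaleC c (l2_pr i x)"
  by (simp add: l2_pr.rep_eq scaleC_l2.rep_eq)

lemma l2_inj_scaleC: "l2_inj i (scaleC c h) = scaleC c (l2_inj i h)"
  by (rule l2_pr_eqI) (simp add: l2_pr_scaleC)

lemma cinner_l2_inj: "cinner (l2_inj i h) x = cinner h (l2_pr i x)"
  by (simp add: cinner_conv_inner l2_inj.rep_eq inner_l2_single l2_pr.rep_eq scaleC_l2.rep_eq)

lemma cinner_l2_inj_right: "cinner x (l2_inj i h) = cinner (l2_pr i x) h"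
  using cinner_l2_inj[of i h x] by (metis cinner_commute)

lemma l2_inj_pr_sum: "l2_pr i (\<Sum>k<r. l2_inj k (f k)) = (if i < r then f i else 0)"
proof -
  have "l2_pr i (\<Sum>k<r. l2_inj k (f k)) = (\<Sum>k<r. if i = k then f k else 0)"
    by (simp add: blinfun.sum_right)
  then show ?thesis by simp
qed

subsection \<open>Matrices as operators\<close>

lemma matsD: "a \<in> mats r A \<Longrightarrow> r \<le> i \<or> r \<le> j \<Longrightarrow> a i j = 0"
  and mats_entry: "a \<in> mats r A \<Longrightarrow> i < r \<Longrightarrow> j < r \<Longrightarrow> a i j \<in> A"
  by (auto simp: mats_def)

lemma mats_mono: "a \<in> mats r A \<Longrightarrow> r \<le> s \<Longrightarrow> 0 \<in> A \<Longrightarrow> a \<in> mats s A"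
  unfolding mats_def by (auto, metis not_less)

lemma mats_subset: "A \<subseteq> B \<Longrightarrow> a \<in> mats r A \<Longrightarrow> a \<in> mats r B"
  by (auto simp: mats_def)

lemma mats_common:
  assumes "a \<in> mats r A" "b \<in> mats s A" "0 \<in> A"
  obtains t where "a \<in> mats t A" "b \<in> mats t A" "r \<le> t" "s \<le> t"
  using assms mats_mono[of a r A "max r s"] mats_mono[of b s A "max r s"] by auto

lemma mat_times_sum:
  assumes "\<And>k. r \<le> k \<Longrightarrow> a i k = 0"
  shows "mat_times a b i j = (\<Sum>k<r. a i k o\<^sub>L b k j)"
  unfolding mat_times_def
  by (rule Sum_any.expand_superset) (use assms in \<open>auto simp: not_less[symmetric] elim: contrapos_np\<close>)

lemma mat_times_sum_left: "a \<in> mats r A \<Longrightarrow> mat_times a b i j = (\<Sum>k<r. a i k o\<^sub>L b k j)"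
  by (rule mat_times_sum) (auto dest: matsD)

lemma mat_times_sum_right: "b \<in> mats r A \<Longrightarrow> mat_times a b i j = (\<Sum>k<r. a i k o\<^sub>L b k j)"
  unfolding mat_times_def
  by (rule Sum_any.expand_superset) (auto simp: matsD[of b r A] not_less[symmetric] elim: contrapos_np)

text \<open>Coordinates from \<open>r\<close> on are ignored and not reached. The operator of an
  element of \<open>mats r A\<close> is therefore the same for all admissible sizes
  (\<open>mat_op_indep\<close>), while the unit matrix becomes the cut \<open>l2_cut r\<close> and
  not the identity.\<close>

definition mat_op :: "nat \<Rightarrow> 'h::complex_hilbert_space opmat \<Rightarrow> 'h l2 \<Rightarrow>\<^sub>L 'h l2" where
  "mat_op r a = (\<Sum>i<r. \<Sum>j<r. l2_inj i o\<^sub>L a i j o\<^sub>L l2_pr j)"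

definition op_mat :: "nat \<Rightarrow> ('h::complex_hilbert_space l2 \<Rightarrow>\<^sub>L 'h l2) \<Rightarrow> 'h opmat" where
  "op_mat r T = (\<lambda>i j. if i < r \<and> j < r then l2_pr i o\<^sub>L T o\<^sub>L l2_inj j else 0)"

definition l2_cut :: "nat \<Rightarrow> 'h::complex_hilbert_space l2 \<Rightarrow>\<^sub>L 'h l2" where
  "l2_cut r = (\<Sum>i<r. l2_inj i o\<^sub>L l2_pr i)"

text \<open>The amplification of \<open>T\<close>; commuting with it detects matrices whose entries
  commute with \<open>T\<close>.\<close>

definition l2_diag :: "nat \<Rightarrow> ('h::complex_hilbert_space \<Rightarrow>\<^sub>L 'h) \<Rightarrow> 'h l2 \<Rightarrow>\<^sub>L 'h l2" where
  "l2_diag r T = (\<Sum>i<r. l2_inj i o\<^sub>L T o\<^sub>L l2_pr i)"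

definition l2_vec :: "nat \<Rightarrow> (nat \<Rightarrow> 'h::complex_hilbert_space) \<Rightarrow> 'h l2" where
  "l2_vec r x = (\<Sum>i<r. l2_inj i (x i))"

lemma l2_pr_mat_op: "l2_pr i (mat_op r a x) = (if i < r then \<Sum>j<r. a i j (l2_pr j x) else 0)"
proof -
  have "mat_op r a x = (\<Sum>i<r. l2_inj i (\<Sum>j<r. a i j (l2_pr j x)))"
    by (simp add: mat_op_def blinfun.sum_left blinfun.sum_right)
  then show ?thesis by (simp only: l2_inj_pr_sum)
qed

lemma l2_pr_cut: "l2_pr i (l2_cut r x) = (if i < r then l2_pr i x else 0)"
proof -
  have "l2_cut r x = (\<Sum>i<r. l2_inj i (l2_pr i x))" by (simp add: l2_cut_def blinfun.sum_left)
  then show ?thesis by (simp only: l2_inj_pr_sum)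
qed

lemma l2_pr_diag: "l2_pr i (l2_diag r T x) = (if i < r then T (l2_pr i x) else 0)"
proof -
  have "l2_diag r T x = (\<Sum>i<r. l2_inj i (T (l2_pr i x)))" by (simp add: l2_diag_def blinfun.sum_left)
  then show ?thesis by (simp only: l2_inj_pr_sum)
qed

lemma l2_pr_vec: "l2_pr i (l2_vec r x) = (if i < r then x i else 0)"
  unfolding l2_vec_def by (rule l2_inj_pr_sum)

lemma l2_cut_vec [simp]: "l2_cut r (l2_vec r x) = l2_vec r x"
  by (rule l2_pr_eqI) (simp add: l2_pr_cut l2_pr_vec)

lemma l2_cut_cut [simp]: "l2_cut r (l2_cut r x) = l2_cut r x"
  by (rule l2_pr_eqI) (simp add: l2_pr_cut)

lemma l2_cut_mat_op [simp]: "l2_cut r (mat_op r a x) = mat_op r a x"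
  by (rule l2_pr_eqI) (simp add: l2_pr_cut l2_pr_mat_op)

lemma mat_op_l2_cut [simp]: "mat_op r a (l2_cut r x) = mat_op r a x"
  by (rule l2_pr_eqI) (simp add: l2_pr_cut l2_pr_mat_op)

lemma l2_cut_bounded [simp]: "l2_cut r \<in> bounded_ops"
  unfolding bounded_ops_def by (auto intro!: l2_pr_eqI simp: l2_pr_cut l2_pr_scaleC)

lemma l2_diag_bounded: "T \<in> bounded_ops \<Longrightarrow> l2_diag r T \<in> bounded_ops"
  unfolding bounded_ops_def by (auto intro!: l2_pr_eqI simp: l2_pr_diag l2_pr_scaleC)

lemma mat_op_bounded:
  assumes "a \<in> mats r bounded_ops"
  shows "mat_op r a \<in> bounded_ops"
proof -
  have "mat_op r a (scaleC c x) = scaleC c (mat_op r a x)" for c x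
  proof (rule l2_pr_eqI)
    fix i
    have "a i j (scaleC c y) = scaleC c (a i j y)" if "i < r" "j < r" for j y
      using bounded_opsD[OF mats_entry[OF assms that]] .
    then show "l2_pr i (mat_op r a (scaleC c x)) = l2_pr i (scaleC c (mat_op r a x))"
      by (simp add: l2_pr_mat_op l2_pr_scaleC scaleC_sum)
  qed
  then show ?thesis by (simp add: bounded_ops_def)
qed

lemma cinner_l2_cut: "cinner (l2_cut r x) y = cinner x (l2_cut r y)"
  by (simp add: l2_cut_def blinfun.sum_left cinner_sum_left cinner_sum_right cinner_l2_inj cinner_l2_inj_right)

lemma sym_l2_cut: "sym_op (l2_cut r)"
  by (simp add: inner_eq_Re_cinner cinner_l2_cut)

lemma mat_op_one [simp]: "mat_op r (mat_one r) = l2_cut r"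
proof (rule blinfun_eqI, rule l2_pr_eqI)
  fix x i
  have "(\<Sum>j<r. mat_one r i j (l2_pr j x)) = (\<Sum>j<r. if i = j then l2_pr j x else 0)"
    by (intro sum.cong) (auto simp: mat_one_def blin_simps)
  then show "l2_pr i (mat_op r (mat_one r) x) = l2_pr i (l2_cut r x)"
    by (simp add: l2_pr_mat_op l2_pr_cut)
qed

lemma mat_op_zero [simp]: "mat_op r mat_zero = 0"
  by (simp add: mat_op_def mat_zero_def)

lemma mat_op_times:
  assumes "a \<in> mats r A"
  shows "mat_op r (mat_times a b) = mat_op r a o\<^sub>L mat_op r b"
proof (rule blinfun_eqI, rule l2_pr_eqI)
  fix x i
  have "(\<Sum>j<r. mat_times a b i j (l2_pr j x)) = (\<Sum>j<r. \<Sum>k<r. a i k (b k j (l2_pr j x)))"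
    by (simp add: mat_times_sum_left[OF assms] blinfun.sum_left)
  also have "\<dots> = (\<Sum>k<r. \<Sum>j<r. a i k (b k j (l2_pr j x)))" by (rule sum.swap)
  finally show "l2_pr i (mat_op r (mat_times a b) x) = l2_pr i ((mat_op r a o\<^sub>L mat_op r b) x)"
    by (simp add: l2_pr_mat_op blinfun.sum_right)
qed

lemma mat_op_adj:
  assumes "a \<in> mats r bounded_ops"
  shows "cinner (mat_op r a x) y = cinner x (mat_op r (mat_adj a) y)"
proof -
  have "cinner (mat_op r a x) y = (\<Sum>i<r. \<Sum>j<r. cinner (a i j (l2_pr j x)) (l2_pr i y))"
    by (simp add: mat_op_def blinfun.sum_left cinner_sum_left cinner_l2_inj)
  also have "\<dots> = (\<Sum>i<r. \<Sum>j<r. cinner (l2_pr j x) (op_adj (a i j) (l2_pr i y)))"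
    by (intro sum.cong refl op_adj(1) mats_entry[OF assms]) auto
  also have "\<dots> = (\<Sum>j<r. \<Sum>i<r. cinner (l2_pr j x) (op_adj (a i j) (l2_pr i y)))" by (rule sum.swap)
  also have "\<dots> = cinner x (mat_op r (mat_adj a) y)"
    by (simp add: mat_op_def mat_adj_def blinfun.sum_left cinner_sum_right cinner_l2_inj_right)
  finally show ?thesis .
qed

lemma mat_op_form: "cinner (mat_op r a x) y = mat_form r a (\<lambda>i. l2_pr i x) (\<lambda>i. l2_pr i y)"
  by (simp add: mat_op_def mat_form_def blinfun.sum_left cinner_sum_left cinner_l2_inj)

lemma mat_form_eq: "mat_form r a x y = cinner (mat_op r a (l2_vec r x)) (l2_vec r y)"
  by (simp add: mat_op_form mat_form_def l2_pr_vec)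

lemma op_mat_mat_op: "a \<in> mats r A \<Longrightarrow> op_mat r (mat_op r a) = a"
proof (intro ext blinfun_eqI)
  fix i j h assume a: "a \<in> mats r A"
  have "(\<Sum>k<r. a i k (l2_pr k (l2_inj j h))) = (\<Sum>k<r. if k = j then a i k h else 0)"
    by (intro sum.cong) (auto simp: blin_simps)
  then show "op_mat r (mat_op r a) i j h = a i j h"
    using matsD[OF a, of i j] by (auto simp: op_mat_def l2_pr_mat_op blin_simps not_less)
qed

lemma mat_op_op_mat: "mat_op r (op_mat r T) x = l2_cut r (T (l2_cut r x))"
proof (rule l2_pr_eqI)
  fix i
  have "(\<Sum>j<r. l2_pr i (T (l2_inj j (l2_pr j x)))) = l2_pr i (T (l2_cut r x))"
    by (simp add: l2_cut_def blinfun.sum_left blinfun.sum_right)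
  then show "l2_pr i (mat_op r (op_mat r T) x) = l2_pr i (l2_cut r (T (l2_cut r x)))"
    by (simp add: l2_pr_mat_op l2_pr_cut op_mat_def)
qed

lemma mat_op_mono:
  assumes a: "a \<in> mats r A" and rs: "r \<le> s"
  shows "mat_op s a = mat_op r a"
proof (rule blinfun_eqI, rule l2_pr_eqI)
  fix x i
  have "(\<Sum>j<s. a i j (l2_pr j x)) = (\<Sum>j<r. a i j (l2_pr j x))"
    using rs by (intro sum.mono_neutral_right) (auto simp: matsD[OF a] blin_simps)
  moreover have "(\<Sum>j<s. a i j (l2_pr j x)) = 0" if "\<not> i < r"
    using that by (intro sum.neutral) (auto simp: matsD[OF a] blin_simps)
  ultimately show "l2_pr i (mat_op s a x) = l2_pr i (mat_op r a x)"
    using rs by (auto simp: l2_pr_mat_op)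
qed

lemma mat_op_indep:
  assumes "a \<in> mats r A" "a \<in> mats s A"
  shows "mat_op r a = mat_op s a"
  using mat_op_mono[OF assms(1), of s] mat_op_mono[OF assms(2), of r] by (metis le_cases)

lemma mat_op_inject:
  assumes a: "a \<in> mats r A" and b: "b \<in> mats s A" and A: "0 \<in> A" and eq: "mat_op r a = mat_op s b"
  shows "a = b"
proof -
  obtain t where t: "a \<in> mats t A" "b \<in> mats t A" "r \<le> t" "s \<le> t" using mats_common[OF a b A] .
  have "mat_op t a = mat_op t b"
    using eq mat_op_mono[OF a t(3)] mat_op_mono[OF b t(4)] by simp
  then show ?thesis using op_mat_mat_op[OF t(1)] op_mat_mat_op[OF t(2)] by metis
qed

lemma op_mat_in_mats: "T \<in> bounded_ops \<Longrightarrow> op_mat r T \<in> mats r bounded_ops"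
  unfolding mats_def op_mat_def bounded_ops_def by (auto simp: l2_inj_scaleC l2_pr_scaleC)

lemma mat_times_in_mats:
  assumes A: "0 \<in> A" "\<And>S T. S \<in> A \<Longrightarrow> T \<in> A \<Longrightarrow> S + T \<in> A" "\<And>S T. S \<in> A \<Longrightarrow> T \<in> A \<Longrightarrow> S o\<^sub>L T \<in> A"
    and ab: "a \<in> mats r A" "b \<in> mats r A"
  shows "mat_times a b \<in> mats r A"
  unfolding mats_def
proof (intro CollectI conjI allI impI)
  have sum: "sum f I \<in> A" if "\<And>k. k \<in> I \<Longrightarrow> f k \<in> A" for f and I :: "nat set"
    using that by (induction I rule: infinite_finite_induct) (auto intro: A)
  show "mat_times a b i j \<in> A" if "i < r" "j < r" for i j
    unfolding mat_times_sum_left[OF ab(1)]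
    using that mats_entry[OF ab(1)] mats_entry[OF ab(2)] by (intro sum A(3)) auto
  show "mat_times a b i j = 0" if "r \<le> i \<or> r \<le> j" for i j
    unfolding mat_times_sum_left[OF ab(1)]
    using that matsD[OF ab(1), of i] matsD[OF ab(2), of _ j] by (intro sum.neutral) auto
qed

lemma mat_one_in_mats: "id_blinfun \<in> A \<Longrightarrow> 0 \<in> A \<Longrightarrow> mat_one r \<in> mats r A"
  by (auto simp: mats_def mat_one_def)

lemma op_mat_id: "op_mat r id_blinfun = mat_one r"
  by (intro ext blinfun_eqI) (auto simp: op_mat_def mat_one_def blin_simps)

subsection \<open>Spectral measures of matrices\<close>

lemma pvm_sums_cinner:
  fixes P :: "complex set \<Rightarrow> 'a::complex_hilbert_space \<Rightarrow>\<^sub>L 'a"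
  assumes "pvm P" "range G \<subseteq> sets borel" "disjoint_family G"
  shows "(\<lambda>n. cinner (P (G n) x) y) sums cinner (P (\<Union>n. G n) x) y"
proof -
  have "(\<lambda>n. complex_of_real (inner (P (G n) x) y) + \<i> * complex_of_real (inner (P (G n) x) (scaleC \<i> y))) sums
     (complex_of_real (inner (P (\<Union>n. G n) x) y) + \<i> * complex_of_real (inner (P (\<Union>n. G n) x) (scaleC \<i> y)))"
    by (intro sums_add sums_mult sums_of_real pvm_sums[OF assms])
  then show ?thesis by (simp add: cinner_conv_inner Complex_eq)
qed

text \<open>The spectral measure of \<open>mat_op r a\<close> is compressed to matrices of size
  \<open>r\<close>. The cut commutes with the operators of \<open>a\<close> and its adjoint, hence
  with the spectral projections, so the compression is multiplicative; its entries are placed in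
  \<open>A\<close> by the bicommutant property.\<close>

lemma normal_spectral_measure_exists:
  assumes vn: "von_neumann_algebra A" and a: "a \<in> mats r A"
    and normal: "mat_times (mat_adj a) a = mat_times a (mat_adj a)"
  obtains P where "spectral_measure r a P" "\<And>E. E \<in> sets borel \<Longrightarrow> P E \<in> mats r A"
proof -
  have A: "A \<subseteq> bounded_ops" "\<And>T. T \<in> A \<Longrightarrow> op_adj T \<in> A" "commutant (commutant A) = A"
    using vn by (auto simp: von_neumann_algebra_def)
  have ab: "a \<in> mats r bounded_ops" using A(1) a by (rule mats_subset)
  have adjA: "mat_adj a \<in> mats r A"
    using A(2) a unfolding mats_def mat_adj_def by auto
  then have adjb: "mat_adj a \<in> mats r bounded_ops" by (rule mats_subset[OF A(1)])
  let ?a = "mat_op r a" and ?a' = "mat_op r (mat_adj a)"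
  have "commutes ?a ?a'"
    using arg_cong[OF normal, of "mat_op r"] by (simp add: mat_op_times[OF a] mat_op_times[OF adjA])
  then obtain Q where Q: "spectral_for ?a Q"
    "\<And>S E. S \<in> bounded_ops \<Longrightarrow> commutes S ?a \<Longrightarrow> commutes S ?a' \<Longrightarrow> E \<in> sets borel \<Longrightarrow> commutes S (Q E)"
    using spectral_theorem_normal[OF mat_op_bounded[OF ab] mat_op_bounded[OF adjb] mat_op_adj[OF ab]] by blast
  have pQ: "pvm Q" and Qb: "\<And>E. E \<in> sets borel \<Longrightarrow> Q E \<in> bounded_ops"
    and I: "\<And>x. cinner (?a x) x = integral\<^sup>L (pvm_measure Q x) (\<lambda>z. z)"
    using Q(1) by (auto simp: spectral_for_def)
  have cut: "Q E (l2_cut r x) = l2_cut r (Q E x)" if "E \<in> sets borel" for E x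
    by (rule commutesD[symmetric], rule Q(2)) (auto intro!: commutesI that)
  define P where "P E = op_mat r (Q E)" for E
  have PE: "mat_op r (P E) x = l2_cut r (Q E x)" if "E \<in> sets borel" for E x
    by (simp add: P_def mat_op_op_mat cut[OF that])
  have Pb: "P E \<in> mats r bounded_ops" if "E \<in> sets borel" for E
    unfolding P_def by (rule op_mat_in_mats[OF Qb[OF that]])
  have Pmult: "P (E \<inter> F) = mat_times (P E) (P F)" if E: "E \<in> sets borel" and F: "F \<in> sets borel" for E F
  proof (rule mat_op_inject)
    show "P (E \<inter> F) \<in> mats r bounded_ops" using E F by (intro Pb) blast
    show "mat_times (P E) (P F) \<in> mats r bounded_ops" by (intro mat_times_in_mats bounded_ops_zero bounded_ops_add bounded_ops_comp Pb E F)
    show "mat_op r (P (E \<inter> F)) = mat_op r (mat_times (P E) (P F))"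
      using E F by (intro blinfun_eqI) (simp add: mat_op_times[OF Pb[OF E]] PE cut pvm_Int[OF pQ] sets.Int)
  qed simp
  have Padj: "mat_adj (P E) = P E" if E: "E \<in> sets borel" for E
  proof (intro ext)
    fix i j
    have cs: "cinner (Q E x) y = cinner x (Q E y)" for x y
      using pvm_sym[OF pQ E] bounded_opsD[OF Qb[OF E]] by (simp add: cinner_conv_inner)
    have "op_adj (l2_pr j o\<^sub>L Q E o\<^sub>L l2_inj i) = l2_pr i o\<^sub>L Q E o\<^sub>L l2_inj j"
      by (rule op_adj_eqI) (simp add: cs cinner_l2_inj flip: cinner_l2_inj_right)
    then show "mat_adj (P E) i j = P E i j"
      by (simp add: mat_adj_def P_def op_mat_def)
  qed
  have PA: "P E \<in> mats r A" if E: "E \<in> sets borel" for E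
    unfolding mats_def
  proof (intro CollectI conjI allI impI)
    fix i j assume ij: "i < r" "j < r"
    have "commutes (P E i j) T" if T: "T \<in> commutant A" for T
    proof -
      have Tb: "T \<in> bounded_ops" using T by (simp add: commutant_def)
      \<comment> \<open>For \<open>T\<close> in the commutant the amplification commutes with all
        matrices over \<open>A\<close>, hence with \<open>Q E\<close>. Evaluated between the
        coordinates \<open>j\<close> and \<open>i\<close> this says that \<open>T\<close> commutes
        with \<open>P E i j\<close>.\<close>
      have com: "commutes (l2_diag r T) (mat_op r b)" if b: "b \<in> mats r A" for b
      proof (rule commutesI, rule l2_pr_eqI)
        fix x k
        have "T (b k l y) = b k l (T y)" if "k < r" "l < r" for l y
        proof -
          have "T o\<^sub>L b k l = b k l o\<^sub>L T" using T mats_entry[OF b that] by (simp add: commutant_def)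
          then show ?thesis by (rule commutesD)
        qed
        then show "l2_pr k (l2_diag r T (mat_op r b x)) = l2_pr k (mat_op r b (l2_diag r T x))"
          by (simp add: l2_pr_diag l2_pr_mat_op blinfun.sum_right)
      qed
      have diag: "l2_diag r T (Q E x) = Q E (l2_diag r T x)" for x
        by (rule commutesD[OF Q(2)[OF l2_diag_bounded[OF Tb] com[OF a] com[OF adjA] E]])
      have dinj: "l2_diag r T (l2_inj j h) = l2_inj j (T h)" for h
        using ij by (intro l2_pr_eqI) (simp add: l2_pr_diag blin_simps)
      show ?thesis
      proof (rule commutesI)
        fix h
        have "P E i j (T h) = l2_pr i (Q E (l2_diag r T (l2_inj j h)))"
          using ij by (simp add: P_def op_mat_def dinj)
        also have "\<dots> = l2_pr i (l2_diag r T (Q E (l2_inj j h)))" by (simp add: diag)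
        also have "\<dots> = T (P E i j h)" using ij by (simp add: l2_pr_diag P_def op_mat_def)
        finally show "P E i j (T h) = T (P E i j h)" .
      qed
    qed
    then have "P E i j \<in> commutant (commutant A)"
      using mats_entry[OF Pb[OF E] ij] by (simp add: commutant_def[of "commutant A"])
    then show "P E i j \<in> A" using A(3) by simp
  qed (auto simp: P_def op_mat_def)
  have form: "mat_form r (P E) x y = cinner (Q E (l2_vec r x)) (l2_vec r y)" if "E \<in> sets borel" for E x y
    by (simp add: mat_form_eq PE[OF that] cinner_l2_cut)
  have "spectral_measure r a P"
    unfolding spectral_measure_def
  proof (intro conjI ballI allI impI)
    show "P E \<in> mats r bounded_ops" if "E \<in> sets borel" for E by (rule Pb[OF that])
    show "P E \<in> projs bounded_ops" if "E \<in> sets borel" for E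
      using Pb[OF that] Pmult[OF that that] Padj[OF that] by (auto simp: projs_def mats_inf_def)
    show "P {} = mat_zero"
      by (intro ext) (simp add: P_def op_mat_def pvm_empty[OF pQ] mat_zero_def blinfun_compose.zero_right blinfun_compose.zero_left)
    show "P UNIV = mat_one r" by (simp add: P_def pvm_UNIV[OF pQ] op_mat_id)
    show "P (E \<inter> F) = mat_times (P E) (P F)" if "E \<in> sets borel" "F \<in> sets borel" for E F
      by (rule Pmult[OF that])
    show "(\<lambda>n. mat_form r (P (F n)) x y) sums mat_form r (P (\<Union>n. F n)) x y"
      if F: "range F \<subseteq> sets borel \<and> disjoint_family F" for F :: "nat \<Rightarrow> complex set" and x y
    proof -
      have "F n \<in> sets borel" for n using F by auto
      moreover from this have "(\<Union>n. F n) \<in> sets borel" by blast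
      ultimately show ?thesis
        using pvm_sums_cinner[OF pQ, of F "l2_vec r x" "l2_vec r y"] F by (simp add: form)
    qed
    obtain R where "Q (cball 0 R) = id_blinfun" using pvm_bounded[OF pQ] by blast
    then have "P (cball 0 R) = mat_one r" by (simp add: P_def op_mat_id)
    then show "\<exists>R. P (cball 0 R) = mat_one r" ..
    fix x
    have "pvm_measure Q (l2_vec r x) = measure_of UNIV (sets borel) (\<lambda>E. ennreal (Re (mat_form r (P E) x x)))"
      unfolding pvm_measure_def
    proof (rule measure_of_eq)
      fix E :: "complex set" assume "E \<in> sigma_sets UNIV (sets borel)"
      then have "E \<in> sets borel" using sets.sigma_sets_eq[of "borel :: complex measure"] by simp
      then show "ennreal (inner (Q E (l2_vec r x)) (l2_vec r x)) = ennreal (Re (mat_form r (P E) x x))"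
        by (simp add: form inner_eq_Re_cinner)
    qed simp
    then show "mat_form r a x x =
        integral\<^sup>L (measure_of UNIV (sets borel) (\<lambda>E. ennreal (Re (mat_form r (P E) x x)))) (\<lambda>z. z)"
      unfolding mat_form_eq[of r a] by (simp add: I)
  qed
  then show ?thesis using PA by (rule that)
qed

text \<open>The orthogonal complement of $H^r$ is put into the spectral subspace of the point \<open>0\<close>; this makes
  spectral measures of one matrix on different $H^r$ comparable.\<close>

definition extend_pvm :: "nat \<Rightarrow> (complex set \<Rightarrow> 'h::complex_hilbert_space opmat) \<Rightarrow> complex set \<Rightarrow> 'h l2 \<Rightarrow>\<^sub>L 'h l2" where
  "extend_pvm r P E = mat_op r (P E) + (if 0 \<in> E then id_blinfun - l2_cut r else 0)"

text \<open>The complement of the cut enters as a point mass at 0, where \<open>z\<close> vanishes,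
  so the integral is unchanged while the total mass becomes the identity.\<close>

lemma spectral_measure_imp_spectral_for:
  assumes a: "a \<in> mats r bounded_ops" and sm: "spectral_measure r a P"
  shows "spectral_for (mat_op r a) (extend_pvm r P)"
proof -
  let ?P = "extend_pvm r P"
  have Pb: "P E \<in> mats r bounded_ops" and Padj: "mat_adj (P E) = P E" if "E \<in> sets borel" for E
    using sm that by (auto simp: spectral_measure_def projs_def)
  have P0: "P {} = mat_zero" and P1: "P UNIV = mat_one r"
    and Pmult: "\<And>E F. E \<in> sets borel \<Longrightarrow> F \<in> sets borel \<Longrightarrow> P (E \<inter> F) = mat_times (P E) (P F)"
    and Psums: "\<And>F x y. range F \<subseteq> sets borel \<Longrightarrow> disjoint_family F \<Longrightarrow>
        (\<lambda>n::nat. mat_form r (P (F n)) x y) sums mat_form r (P (\<Union>n. F n)) x y"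
    and Pball: "\<exists>R. P (cball 0 R) = mat_one r"
    and Pint: "\<And>x. mat_form r a x x =
        integral\<^sup>L (measure_of UNIV (sets borel) (\<lambda>E. ennreal (Re (mat_form r (P E) x x)))) (\<lambda>z. z)"
    using sm unfolding spectral_measure_def by blast+
  have ext_apply: "?P E x = mat_op r (P E) x + (if 0 \<in> E then x - l2_cut r x else 0)" for E x
    by (simp add: extend_pvm_def blin_simps)
  have cadj: "cinner (mat_op r (P E) x) y = cinner x (mat_op r (P E) y)" if "E \<in> sets borel" for E x y
    using mat_op_adj[OF Pb[OF that]] Padj[OF that] by simp
  have pvm: "pvm ?P"
    unfolding pvm_def
  proof (intro conjI ballI allI impI)
    show "inner (?P E x) y = inner x (?P E y)" if "E \<in> sets borel" for E x y
      using cadj[OF that, of x y] sym_opD[OF sym_l2_cut, of r x y]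
      by (simp add: ext_apply inner_eq_Re_cinner cinner_add_left cinner_add_right cinner_diff_left cinner_diff_right)
    show "?P {} = 0" by (simp add: extend_pvm_def P0)
    show "?P UNIV = id_blinfun" by (simp add: extend_pvm_def P1)
    show "?P (E \<inter> F) = ?P E o\<^sub>L ?P F" if E: "E \<in> sets borel" and F: "F \<in> sets borel" for E F
      by (rule blinfun_eqI)
        (simp add: ext_apply blin_simps Pmult[OF E F] mat_op_times[OF Pb[OF E]])
    obtain R where R: "P (cball 0 R) = mat_one r" using Pball by blast
    show "\<exists>R. ?P (cball 0 R) = id_blinfun"
    proof (cases "R \<ge> 0")
      case True
      then have "?P (cball 0 R) = id_blinfun" by (simp add: extend_pvm_def R)
      then show ?thesis ..
    next
      case False
      \<comment> \<open>A ball of negative radius is empty, so the unit matrix is zero. Then every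
        \<open>mat_op r (P E)\<close> vanishes, all mass sits at 0 and the radius 0 works.\<close>
      then have "mat_one r = (mat_zero :: 'a opmat)" using R P0 by simp
      then have cut0: "l2_cut r = (0 :: 'a l2 \<Rightarrow>\<^sub>L 'a l2)" using mat_op_one[of r] by (metis mat_op_zero)
      have "mat_op r (P E) x = 0" for E x
        using mat_op_l2_cut[of r "P E" x] unfolding cut0 by (simp add: blin_simps)
      then have "?P (cball 0 0) = id_blinfun"
        by (intro blinfun_eqI) (simp add: ext_apply cut0 blin_simps)
      then show ?thesis ..
    qed
    fix F :: "nat \<Rightarrow> complex set" and x y
    assume F: "range F \<subseteq> sets borel \<and> disjoint_family F"
    have eq: "inner (?P E x) y = Re (mat_form r (P E) (\<lambda>i. l2_pr i x) (\<lambda>i. l2_pr i y))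
        + (if 0 \<in> E then inner (x - l2_cut r x) y else 0)" for E
      by (simp add: ext_apply cinner_add_left inner_eq_Re_cinner flip: mat_op_form)
    show "(\<lambda>n. inner (?P (F n) x) y) sums inner (?P (\<Union>n. F n) x) y"
      unfolding eq using F by (intro sums_add sums_Re Psums sums_disjoint_family) auto
  qed
  show ?thesis
    unfolding spectral_for_def
  proof (intro conjI ballI allI pvm)
    show "?P E \<in> bounded_ops" if "E \<in> sets borel" for E
      using mat_op_bounded[OF Pb[OF that]] by (simp add: extend_pvm_def bounded_ops_add bounded_ops_diff)
    fix x
    \<comment> \<open>The point 0 contributes nothing to the integral of \<open>z\<close>, and away
      from it the measure sees a vector only through its cut.\<close>
    have drop0: "integral\<^sup>L (pvm_measure ?P y) (\<lambda>z. z) = integral\<^sup>L (pvm_measure ?P (?P (- {0}) y)) (\<lambda>z. z)" for y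
    proof -
      have "(\<lambda>z::complex. indicator (- {0}) z *\<^sub>R z) = (\<lambda>z. z)" by (auto simp: indicator_def)
      then show ?thesis using integral_pvm_measure_restrict[OF pvm, of "- {0}" y] by simp
    qed
    have "measure_of UNIV (sets borel) (\<lambda>E. ennreal (Re (mat_form r (P E) (\<lambda>i. l2_pr i x) (\<lambda>i. l2_pr i x))))
        = pvm_measure ?P (l2_cut r x)"
      unfolding pvm_measure_def
    proof (rule measure_of_eq)
      fix E :: "complex set"
      show "ennreal (Re (mat_form r (P E) (\<lambda>i. l2_pr i x) (\<lambda>i. l2_pr i x)))
          = ennreal (inner (?P E (l2_cut r x)) (l2_cut r x))"
        by (simp add: ext_apply inner_eq_Re_cinner flip: mat_op_form cinner_l2_cut)
    qed simp
    then have "cinner (mat_op r a x) x = integral\<^sup>L (pvm_measure ?P (l2_cut r x)) (\<lambda>z. z)"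
      unfolding mat_op_form Pint by simp
    also have "\<dots> = integral\<^sup>L (pvm_measure ?P x) (\<lambda>z. z)"
      unfolding drop0[of x] drop0[of "l2_cut r x"] by (simp add: ext_apply)
    finally show "cinner (mat_op r a x) x = integral\<^sup>L (pvm_measure ?P x) (\<lambda>z. z)" .
  qed
qed

text \<open>Two candidates, possibly for different sizes, extend to spectral measures of one
  operator on \<open>'h l2\<close>, which coincide. For \<open>E\<close> without 0 the extension
  adds nothing, so the definite description has exactly one solution.\<close>

lemma spec_proj_eq:
  assumes a: "a \<in> mats r bounded_ops" and sm: "spectral_measure r a P"
    and E: "E \<in> sets borel" "0 \<notin> E"
  shows "spec_proj a E = P E"
  unfolding spec_proj_def
proof (rule the_equality)
  show "\<exists>r Q. a \<in> mats r bounded_ops \<and> spectral_measure r a Q \<and> P E = Q E" using a sm by blast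
  fix p assume "\<exists>s Q. a \<in> mats s bounded_ops \<and> spectral_measure s a Q \<and> p = Q E"
  then obtain s Q where Q: "a \<in> mats s bounded_ops" "spectral_measure s a Q" "p = Q E" by blast
  have "extend_pvm r P E = extend_pvm s Q E"
    using spectral_measure_imp_spectral_for[OF a sm] spectral_measure_imp_spectral_for[OF Q(1,2)]
    unfolding mat_op_indep[OF a Q(1)]
    by (rule spectral_for_unique[OF mat_op_bounded[OF Q(1)] _ _ E(1)])
  then have "mat_op r (P E) = mat_op s (Q E)" using E(2) by (simp add: extend_pvm_def)
  moreover have "P E \<in> mats r bounded_ops" "Q E \<in> mats s bounded_ops"
    using sm Q(2) E(1) by (auto simp: spectral_measure_def)
  ultimately show "p = P E" using mat_op_inject[of "P E" r bounded_ops "Q E" s] Q(3) by simp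
qed

subsection \<open>Block matrices\<close>

text \<open>A version of \<open>dsum\<close> with an \<open>s \<times> r\<close> corner: a partial
  isometry between projections of sizes \<open>r\<close> and \<open>s\<close> is rectangular, so
  columns shift by \<open>r\<close> and rows by \<open>s\<close>.\<close>

definition diag_block :: "nat \<Rightarrow> nat \<Rightarrow> 'h::complex_hilbert_space opmat \<Rightarrow> 'h opmat \<Rightarrow> 'h opmat" where
  "diag_block s r a b = (\<lambda>i j. if i < s \<and> j < r then a i j
                       else if s \<le> i \<and> r \<le> j then b (i - s) (j - r) else 0)"

text \<open>Columns are split at \<open>r\<close> and rows at \<open>s\<close>, as the flip of two
  summands of sizes \<open>r\<close> and \<open>s\<close> requires.\<close>

definition antidiag_block :: "nat \<Rightarrow> nat \<Rightarrow> 'h::complex_hilbert_space opmat \<Rightarrow> 'h opmat \<Rightarrow> 'h opmat" where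
  "antidiag_block s r a b = (\<lambda>i j. if i < s \<and> r \<le> j then a i (j - r)
                       else if s \<le> i \<and> j < r then b (i - s) j else 0)"

lemma dsum_eq_diag_block: "dsum r a b = diag_block r r a b"
  by (simp add: dsum_def diag_block_def)

lemma sum_lessThan_add: "(\<Sum>k<r + n. f k) = (\<Sum>k<r. f k) + (\<Sum>k<n. f (r + k))"
  for f :: "nat \<Rightarrow> 'b::comm_monoid_add"
  by (induction n) (simp_all add: add.assoc)

lemma diag_block_times:
  assumes a: "\<And>i k. r \<le> k \<Longrightarrow> a i k = 0" and b: "\<And>i k. n \<le> k \<Longrightarrow> b i k = 0"
  shows "mat_times (diag_block s r a b) (diag_block r t c d) = diag_block s t (mat_times a c) (mat_times b d)"
proof (intro ext)
  fix i j
  have "mat_times (diag_block s r a b) (diag_block r t c d) i j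
      = (\<Sum>k<r + n. diag_block s r a b i k o\<^sub>L diag_block r t c d k j)"
    by (rule mat_times_sum) (auto simp: diag_block_def b)
  also have "\<dots> = (\<Sum>k<r. diag_block s r a b i k o\<^sub>L diag_block r t c d k j)
      + (\<Sum>k<n. diag_block s r a b i (r + k) o\<^sub>L diag_block r t c d (r + k) j)"
    by (rule sum_lessThan_add)
  also have "\<dots> = diag_block s t (mat_times a c) (mat_times b d) i j"
    by (auto simp: diag_block_def mat_times_sum[OF a] mat_times_sum[OF b])
  finally show "mat_times (diag_block s r a b) (diag_block r t c d) i j
      = diag_block s t (mat_times a c) (mat_times b d) i j" .
qed

lemma antidiag_block_times:
  assumes a: "\<And>i k. n \<le> k \<Longrightarrow> a i k = 0" and b: "\<And>i k. r \<le> k \<Longrightarrow> b i k = 0"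
  shows "mat_times (antidiag_block s r a b) (antidiag_block r t d c) = diag_block s t (mat_times a c) (mat_times b d)"
proof (intro ext)
  fix i j
  have "mat_times (antidiag_block s r a b) (antidiag_block r t d c) i j
      = (\<Sum>k<r + n. antidiag_block s r a b i k o\<^sub>L antidiag_block r t d c k j)"
    by (rule mat_times_sum) (auto simp: antidiag_block_def a)
  also have "\<dots> = (\<Sum>k<r. antidiag_block s r a b i k o\<^sub>L antidiag_block r t d c k j)
      + (\<Sum>k<n. antidiag_block s r a b i (r + k) o\<^sub>L antidiag_block r t d c (r + k) j)"
    by (rule sum_lessThan_add)
  also have "\<dots> = diag_block s t (mat_times a c) (mat_times b d) i j"
    by (auto simp: diag_block_def antidiag_block_def mat_times_sum[OF a] mat_times_sum[OF b])
  finally show "mat_times (antidiag_block s r a b) (antidiag_block r t d c) i j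
      = diag_block s t (mat_times a c) (mat_times b d) i j" .
qed

lemma mat_adj_diag_block: "mat_adj (diag_block s r a b) = diag_block r s (mat_adj a) (mat_adj b)"
  by (intro ext) (auto simp: mat_adj_def diag_block_def)

lemma mat_adj_antidiag_block: "mat_adj (antidiag_block s r a b) = antidiag_block r s (mat_adj b) (mat_adj a)"
  by (intro ext) (auto simp: mat_adj_def antidiag_block_def)

lemma dsum_assoc: "dsum (r + s) (dsum r a b) c = dsum r a (dsum s b c)"
proof (intro ext)
  fix i j
  have split: "k < r \<or> (\<exists>k'. k = r + k')" for k
    using le_Suc_ex[of r k] by (cases "k < r") auto
  show "dsum (r + s) (dsum r a b) c i j = dsum r a (dsum s b c) i j"
    using split[of i] split[of j] by (elim disjE exE) (simp_all add: dsum_def)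
qed

lemma dsum_0_left [simp]: "dsum 0 a b = b"
  by (simp add: dsum_def)

lemma dsum_mat_one: "dsum m (mat_one m) (mat_one n) = mat_one (m + n)"
  by (intro ext) (auto simp: dsum_def mat_one_def)

subsection \<open>Murray--von Neumann and stable equivalence\<close>

locale vn_algebra =
  fixes A :: "('h::complex_hilbert_space \<Rightarrow>\<^sub>L 'h) set"
  assumes vn: "von_neumann_algebra A"
begin

lemma A_bounded: "T \<in> A \<Longrightarrow> T \<in> bounded_ops" and A_adj: "T \<in> A \<Longrightarrow> op_adj T \<in> A"
  using vn by (auto simp: von_neumann_algebra_def)

text \<open>The bicommutant property as a membership test; closure of \<open>A\<close> under sums
  and products is then inherited from commutation relations.\<close>

lemma A_iff: "T \<in> A \<longleftrightarrow> T \<in> bounded_ops \<and> (\<forall>S\<in>commutant A. commutes T S)"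
  using vn by (auto simp: von_neumann_algebra_def commutant_def[of "commutant A"])

lemma A_zero [simp]: "0 \<in> A" and A_id [simp]: "id_blinfun \<in> A"
  by (simp_all add: A_iff)

lemma A_add: "S \<in> A \<Longrightarrow> T \<in> A \<Longrightarrow> S + T \<in> A"
  by (simp add: A_iff bounded_ops_add comp_simps)

lemma A_comp: "S \<in> A \<Longrightarrow> T \<in> A \<Longrightarrow> S o\<^sub>L T \<in> A"
  by (auto simp: A_iff intro!: bounded_ops_comp commutes_comp[symmetric] dest: sym)

lemma mats_infI: "a \<in> mats r A \<Longrightarrow> a \<in> mats_inf A"
  by (auto simp: mats_inf_def)

lemma mats_infE:
  assumes "a \<in> mats_inf A" obtains r where "a \<in> mats r A"
  using assms by (auto simp: mats_inf_def)

lemma mats_inf_common: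
  assumes "a \<in> mats_inf A" "b \<in> mats_inf A"
  obtains r where "a \<in> mats r A" "b \<in> mats r A"
  using assms by (metis A_zero mats_common mats_infE)

lemma mats_bounded: "a \<in> mats r A \<Longrightarrow> a \<in> mats r bounded_ops"
  by (rule mats_subset[of A]) (auto intro: A_bounded)

lemma mats_inf_entry: "a \<in> mats_inf A \<Longrightarrow> a i j \<in> A"
  by (auto simp: mats_inf_def mats_def) (metis A_zero not_less)

lemma mats_inf_criterion:
  assumes "\<And>i j. a i j \<in> A" "\<And>i j. m \<le> i \<Longrightarrow> a i j = 0" "\<And>i j. n \<le> j \<Longrightarrow> a i j = 0"
  shows "a \<in> mats_inf A"
  by (rule mats_infI[of _ "max m n"]) (use assms in \<open>auto simp: mats_def\<close>)

lemma mat_zero_mats [simp]: "mat_zero \<in> mats r A"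
  by (simp add: mats_def mat_zero_def)

lemma mat_one_mats [simp]: "mat_one r \<in> mats r A"
  by (simp add: mat_one_in_mats)

lemma mat_times_mats: "a \<in> mats r A \<Longrightarrow> b \<in> mats r A \<Longrightarrow> mat_times a b \<in> mats r A"
  by (rule mat_times_in_mats[OF A_zero A_add A_comp])

lemma mat_times_inf: "a \<in> mats_inf A \<Longrightarrow> b \<in> mats_inf A \<Longrightarrow> mat_times a b \<in> mats_inf A"
  by (metis mats_inf_common mat_times_mats mats_infI)

lemma mat_adj_mats: "a \<in> mats r A \<Longrightarrow> mat_adj a \<in> mats r A"
  by (auto simp: mats_def mat_adj_def A_adj)

lemma mat_adj_inf: "a \<in> mats_inf A \<Longrightarrow> mat_adj a \<in> mats_inf A"
  by (metis mats_infE mat_adj_mats mats_infI)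

lemma mat_adj_adj: "a \<in> mats_inf A \<Longrightarrow> mat_adj (mat_adj a) = a"
  by (intro ext) (simp add: mat_adj_def mats_inf_entry A_bounded)

lemma mat_adj_times:
  assumes "a \<in> mats_inf A" "b \<in> mats_inf A"
  shows "mat_adj (mat_times a b) = mat_times (mat_adj b) (mat_adj a)"
proof -
  obtain r where r: "a \<in> mats r A" "b \<in> mats r A" by (rule mats_inf_common[OF assms])
  show ?thesis
  proof (intro ext)
    fix i j
    have "mat_adj (mat_times a b) i j = (\<Sum>k<r. op_adj (a j k o\<^sub>L b k i))"
      unfolding mat_adj_def mat_times_sum_left[OF r(1)]
      by (rule op_adj_sum) (intro bounded_ops_comp A_bounded mats_inf_entry assms)
    also have "\<dots> = (\<Sum>k<r. mat_adj b i k o\<^sub>L mat_adj a k j)"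
      by (simp add: mat_adj_def op_adj_comp A_bounded mats_inf_entry assms)
    finally show "mat_adj (mat_times a b) i j = mat_times (mat_adj b) (mat_adj a) i j"
      by (simp add: mat_times_sum_left[OF mat_adj_mats[OF r(2)]])
  qed
qed

lemma mat_times_assoc:
  assumes "a \<in> mats_inf A" "b \<in> mats_inf A" "c \<in> mats_inf A"
  shows "mat_times (mat_times a b) c = mat_times a (mat_times b c)"
proof -
  obtain s t where "a \<in> mats s A" "b \<in> mats s A" "c \<in> mats t A"
    using mats_inf_common[OF assms(1,2)] mats_infE[OF assms(3)] by metis
  then obtain r where r: "a \<in> mats r A" "b \<in> mats r A" "c \<in> mats r A"
    using mats_mono[of _ s A "max s t"] mats_mono[of _ t A "max s t"] by auto
  show ?thesis
  proof (intro ext)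
    fix i j
    have "mat_times (mat_times a b) c i j = (\<Sum>l<r. \<Sum>k<r. a i k o\<^sub>L (b k l o\<^sub>L c l j))"
      by (simp add: mat_times_sum_right[OF r(3)] mat_times_sum_left[OF r(1)] blinfun_compose.sum_left blinfun_compose_assoc)
    also have "\<dots> = (\<Sum>k<r. \<Sum>l<r. a i k o\<^sub>L (b k l o\<^sub>L c l j))" by (rule sum.swap)
    also have "\<dots> = mat_times a (mat_times b c) i j"
      by (simp add: mat_times_sum_left[OF r(1)] mat_times_sum_left[OF r(2)] blinfun_compose.sum_right)
    finally show "mat_times (mat_times a b) c i j = mat_times a (mat_times b c) i j" .
  qed
qed

lemma projsD: "p \<in> projs A \<Longrightarrow> p \<in> mats_inf A" "p \<in> projs A \<Longrightarrow> mat_times p p = p"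
  "p \<in> projs A \<Longrightarrow> mat_adj p = p"
  by (auto simp: projs_def)

lemma dsum_mats:
  assumes a: "a \<in> mats r A" and b: "b \<in> mats s A"
  shows "dsum r a b \<in> mats (r + s) A"
proof -
  have "dsum r a b i j \<in> A" for i j
    using mats_inf_entry[OF mats_infI[OF a]] mats_inf_entry[OF mats_infI[OF b]] by (simp add: dsum_def)
  moreover have "dsum r a b i j = 0" if "r + s \<le> i \<or> r + s \<le> j" for i j
  proof -
    have "s \<le> i - r \<or> s \<le> j - r" using that by linarith
    from matsD[OF b this] show ?thesis using that by (auto simp: dsum_def)
  qed
  ultimately show ?thesis by (simp add: mats_def)
qed

lemma dsum_inf: "a \<in> mats r A \<Longrightarrow> b \<in> mats_inf A \<Longrightarrow> dsum r a b \<in> mats_inf A"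
  by (metis dsum_mats mats_infE mats_infI)

lemma dsum_times:
  assumes "a \<in> mats r A" "b \<in> mats_inf A"
  shows "mat_times (dsum r a b) (dsum r c d) = dsum r (mat_times a c) (mat_times b d)"
proof -
  obtain s where "b \<in> mats s A" using assms(2) by (rule mats_infE)
  then show ?thesis
    unfolding dsum_eq_diag_block using assms(1) matsD by (intro diag_block_times[of r a s b]) blast+
qed

lemma mat_adj_dsum: "mat_adj (dsum r a b) = dsum r (mat_adj a) (mat_adj b)"
  by (simp add: dsum_eq_diag_block mat_adj_diag_block)

lemma mat_zero_projs: "mat_zero \<in> projs A"
proof -
  have "mat_times mat_zero mat_zero = (mat_zero :: 'h opmat)"
    by (intro ext) (simp add: mat_times_def mat_zero_def)
  then show ?thesis
    using mats_infI[OF mat_zero_mats] by (auto simp: projs_def mat_adj_def mat_zero_def)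
qed

lemma mat_one_projs: "mat_one n \<in> projs A"
proof -
  have "mat_times (mat_one n) (mat_one n) = (mat_one n :: 'h opmat)"
  proof (intro ext)
    fix i j
    have "mat_times (mat_one n) (mat_one n :: 'h opmat) i j = (\<Sum>k<n. if i = k then mat_one n k j else 0)"
      unfolding mat_times_sum_left[OF mat_one_mats] by (intro sum.cong) (auto simp: mat_one_def)
    then show "mat_times (mat_one n) (mat_one n) i j = (mat_one n i j :: 'h \<Rightarrow>\<^sub>L 'h)"
      by (auto simp: mat_one_def)
  qed
  moreover have "mat_adj (mat_one n) = (mat_one n :: 'h opmat)"
    by (intro ext) (auto simp: mat_adj_def mat_one_def)
  ultimately show ?thesis using mats_infI[OF mat_one_mats] by (auto simp: projs_def)
qed

lemma dsum_projs:
  assumes "p \<in> projs A" "q \<in> projs A" "p \<in> mats r A"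
  shows "dsum r p q \<in> projs A"
  using assms dsum_inf[OF assms(3) projsD(1)[OF assms(2)]]
  by (simp add: projs_def dsum_times mat_adj_dsum)

lemma dsum_normals:
  assumes a: "a \<in> normals A" "a \<in> mats r A" and b: "b \<in> normals A"
  shows "dsum r a b \<in> normals A"
proof -
  have n: "mat_times (mat_adj a) a = mat_times a (mat_adj a)" "mat_times (mat_adj b) b = mat_times b (mat_adj b)"
    and bi: "b \<in> mats_inf A" using a b by (auto simp: normals_def)
  then show ?thesis
    using dsum_inf[OF a(2) bi]
    by (simp add: normals_def mat_adj_dsum dsum_times a(2) bi mat_adj_mats mat_adj_inf n)
qed

lemma mvn_equivI:
  "v \<in> mats_inf A \<Longrightarrow> mat_times (mat_adj v) v = p \<Longrightarrow> mat_times v (mat_adj v) = q \<Longrightarrow> mvn_equiv A p q"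
  by (auto simp: mvn_equiv_def)

lemma mvn_refl: "p \<in> projs A \<Longrightarrow> mvn_equiv A p p"
  by (rule mvn_equivI[of p]) (simp_all add: projsD)

lemma mvn_sym: "mvn_equiv A p q \<Longrightarrow> mvn_equiv A q p"
  unfolding mvn_equiv_def by (metis mat_adj_adj mat_adj_inf)

text \<open>The product \<open>w v\<close> implements the equivalence. The middle factor is
  \<open>q\<close> in either order; writing it through the other matrix leaves the square of
  \<open>p\<close>, respectively of \<open>t\<close>.\<close>

lemma mvn_trans:
  assumes pq: "mvn_equiv A p q" and qt: "mvn_equiv A q t" and p: "p \<in> projs A" and t: "t \<in> projs A"
  shows "mvn_equiv A p t"
proof -
  obtain v w where v: "v \<in> mats_inf A" "mat_times (mat_adj v) v = p" "mat_times v (mat_adj v) = q"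
    and w: "w \<in> mats_inf A" "mat_times (mat_adj w) w = q" "mat_times w (mat_adj w) = t"
    using pq qt by (auto simp: mvn_equiv_def)
  note inf = v(1) w(1) mat_adj_inf[OF v(1)] mat_adj_inf[OF w(1)]
  show ?thesis
  proof (rule mvn_equivI)
    show "mat_times w v \<in> mats_inf A" by (intro mat_times_inf inf)
    have "mat_times (mat_adj (mat_times w v)) (mat_times w v)
        = mat_times (mat_adj v) (mat_times (mat_times (mat_adj w) w) v)"
      by (simp add: mat_adj_times mat_times_assoc mat_times_inf inf)
    also have "\<dots> = mat_times (mat_times (mat_adj v) v) (mat_times (mat_adj v) v)"
      unfolding w(2) v(3)[symmetric] by (simp add: mat_times_assoc mat_times_inf inf)
    also have "\<dots> = p" unfolding v(2) by (rule projsD(2)[OF p])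
    finally show "mat_times (mat_adj (mat_times w v)) (mat_times w v) = p" .
    have "mat_times (mat_times w v) (mat_adj (mat_times w v))
        = mat_times w (mat_times (mat_times v (mat_adj v)) (mat_adj w))"
      by (simp add: mat_adj_times mat_times_assoc mat_times_inf inf)
    also have "\<dots> = mat_times (mat_times w (mat_adj w)) (mat_times w (mat_adj w))"
      unfolding v(3) w(2)[symmetric] by (simp add: mat_times_assoc mat_times_inf inf)
    also have "\<dots> = t" unfolding w(3) by (rule projsD(2)[OF t])
    finally show "mat_times (mat_times w v) (mat_adj (mat_times w v)) = t" .
  qed
qed

text \<open>The diagonal entry at \<open>j\<close> of the product has as its form the sum of the
  squares of \<open>norm (v k j x)\<close>, so the whole column vanishes with it.\<close>

lemma column_zero:
  assumes v: "v \<in> mats_inf A" and zero: "mat_times (mat_adj v) v j j = 0"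
  shows "v i j = 0"
proof (rule blinfun_eqI)
  fix x
  obtain r where r: "v \<in> mats r A" using v by (rule mats_infE)
  have vb: "v k l \<in> bounded_ops" for k l by (intro A_bounded mats_inf_entry v)
  have "0 = cinner (mat_times (mat_adj v) v j j x) x" by (simp add: zero blin_simps)
  also have "\<dots> = (\<Sum>k<r. cinner (op_adj (v k j) (v k j x)) x)"
    unfolding mat_times_sum_left[OF mat_adj_mats[OF r]]
    by (simp add: mat_adj_def blinfun.sum_left cinner_sum_left)
  also have "\<dots> = complex_of_real (\<Sum>k<r. (norm (v k j x))\<^sup>2)"
    by (simp add: op_adj_right[OF vb] cinner_self)
  finally have "complex_of_real (\<Sum>k<r. (norm (v k j x))\<^sup>2) = 0" by (rule sym)
  then have "(\<Sum>k<r. (norm (v k j x))\<^sup>2) = 0" by (simp only: of_real_eq_0_iff)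
  then have "v k j x = 0" if "k < r" for k
    using that by (subst (asm) sum_nonneg_eq_0_iff) auto
  then show "v i j x = blinfun_apply 0 x"
    using matsD[OF r, of i j] by (cases "i < r") (auto simp: blin_simps)
qed

text \<open>A matrix that implements \<open>mvn_equiv\<close> may a priori have any size.
  \<open>column_zero\<close>, applied to it and to its adjoint, confines it to the
  \<open>s \<times> r\<close> corner, so block constructions lose none of its entries.\<close>

lemma mvn_equivE:
  assumes "mvn_equiv A p q" "p \<in> mats r A" "q \<in> mats s A"
  obtains v where "v \<in> mats_inf A" "mat_times (mat_adj v) v = p" "mat_times v (mat_adj v) = q"
    "\<And>i j. r \<le> j \<Longrightarrow> v i j = 0" "\<And>i j. s \<le> i \<Longrightarrow> v i j = 0"
proof -
  obtain v where v: "v \<in> mats_inf A" "mat_times (mat_adj v) v = p" "mat_times v (mat_adj v) = q"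
    using assms(1) by (auto simp: mvn_equiv_def)
  have "v i j = 0" if "r \<le> j" for i j
    by (rule column_zero[OF v(1)]) (use matsD[OF assms(2), of j j] that in \<open>simp add: v(2)\<close>)
  moreover have "v i j = 0" if "s \<le> i" for i j
  proof -
    have "mat_adj v j i = 0"
      by (rule column_zero[OF mat_adj_inf[OF v(1)]])
        (use matsD[OF assms(3), of i i] that in \<open>simp add: mat_adj_adj v(1,3)\<close>)
    then have "op_adj (op_adj (v i j)) = 0" by (simp add: mat_adj_def)
    then show ?thesis by (simp add: A_bounded mats_inf_entry v(1))
  qed
  ultimately show ?thesis using that v by blast
qed

lemma mvn_dsum:
  assumes pq: "mvn_equiv A p q" "p \<in> mats r A" "q \<in> mats s A"
    and pq': "mvn_equiv A p' q'"
  shows "mvn_equiv A (dsum r p p') (dsum s q q')"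
proof -
  obtain v where v: "v \<in> mats_inf A" "mat_times (mat_adj v) v = p" "mat_times v (mat_adj v) = q"
    and vz: "\<And>i j. r \<le> j \<Longrightarrow> v i j = 0" "\<And>i j. s \<le> i \<Longrightarrow> v i j = 0"
    using mvn_equivE[OF pq] by blast
  obtain w where w: "w \<in> mats_inf A" "mat_times (mat_adj w) w = p'" "mat_times w (mat_adj w) = q'"
    using pq' by (auto simp: mvn_equiv_def)
  obtain n where n: "w \<in> mats n A" using w(1) by (rule mats_infE)
  have wz: "w i k = 0" "mat_adj w i k = 0" if "n \<le> k" for i k
    using matsD[OF n] matsD[OF mat_adj_mats[OF n]] that by auto
  have vz': "mat_adj v i k = 0" if "s \<le> k" for i k using that by (simp add: mat_adj_def vz(2))
  show ?thesis
  proof (rule mvn_equivI)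
    show "diag_block s r v w \<in> mats_inf A"
    proof (rule mats_inf_criterion)
      show "diag_block s r v w i j \<in> A" for i j
        using v(1) w(1) by (simp add: diag_block_def mats_inf_entry)
      show "diag_block s r v w i j = 0" if "s + n \<le> i" for i j
        using that matsD[OF n, of "i - s" "j - r"] by (auto simp: diag_block_def le_diff_conv2 add.commute)
      show "diag_block s r v w i j = 0" if "r + n \<le> j" for i j
        using that matsD[OF n, of "i - s" "j - r"] by (auto simp: diag_block_def le_diff_conv2 add.commute)
    qed
    show "mat_times (mat_adj (diag_block s r v w)) (diag_block s r v w) = dsum r p p'"
      unfolding mat_adj_diag_block dsum_eq_diag_block v(2)[symmetric] w(2)[symmetric]
      by (rule diag_block_times[OF vz' wz(2)])
    show "mat_times (diag_block s r v w) (mat_adj (diag_block s r v w)) = dsum s q q'"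
      unfolding mat_adj_diag_block dsum_eq_diag_block v(3)[symmetric] w(3)[symmetric]
      by (rule diag_block_times[OF vz(1) wz(1)])
  qed
qed

text \<open>The projections \<open>q\<close> and \<open>p\<close> themselves, placed off the
  diagonal, form the partial isometry of the flip.\<close>

lemma mvn_dsum_comm:
  assumes p: "p \<in> projs A" "p \<in> mats r A" and q: "q \<in> projs A" "q \<in> mats s A"
  shows "mvn_equiv A (dsum r p q) (dsum s q p)"
proof (rule mvn_equivI)
  have pz: "p i k = 0" if "r \<le> k" for i k using matsD[OF p(2)] that by auto
  have qz: "q i k = 0" if "s \<le> k" for i k using matsD[OF q(2)] that by auto
  show "antidiag_block s r q p \<in> mats_inf A"
  proof (rule mats_inf_criterion)
    show "antidiag_block s r q p i j \<in> A" for i j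
      using p(1) q(1) by (simp add: antidiag_block_def mats_inf_entry projsD)
    show "antidiag_block s r q p i j = 0" if "s + r \<le> i" for i j
      using that matsD[OF p(2), of "i - s" j] by (auto simp: antidiag_block_def le_diff_conv2 add.commute)
    show "antidiag_block s r q p i j = 0" if "r + s \<le> j" for i j
      using that matsD[OF q(2), of i "j - r"] by (auto simp: antidiag_block_def le_diff_conv2 add.commute)
  qed
  show "mat_times (mat_adj (antidiag_block s r q p)) (antidiag_block s r q p) = dsum r p q"
    unfolding mat_adj_antidiag_block dsum_eq_diag_block projsD(3)[OF p(1)] projsD(3)[OF q(1)]
    by (simp add: antidiag_block_times[OF pz qz] projsD(2) p(1) q(1))
  show "mat_times (antidiag_block s r q p) (mat_adj (antidiag_block s r q p)) = dsum s q p"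
    unfolding mat_adj_antidiag_block dsum_eq_diag_block projsD(3)[OF p(1)] projsD(3)[OF q(1)]
    by (simp add: antidiag_block_times[OF qz pz] projsD(2) p(1) q(1))
qed

section \<open>Stable equivalence\<close>

lemma dsum_one_projs: "p \<in> projs A \<Longrightarrow> dsum n (mat_one n) p \<in> projs A"
  by (intro dsum_projs mat_one_projs mat_one_mats)

lemma mvn_imp_stable: "mvn_equiv A p q \<Longrightarrow> stable_equiv A p q"
  unfolding stable_equiv_def by (rule exI[of _ 0]) simp

lemma stable_refl: "p \<in> projs A \<Longrightarrow> stable_equiv A p p"
  by (intro mvn_imp_stable mvn_refl)

lemma stable_sym: "stable_equiv A p q \<Longrightarrow> stable_equiv A q p"
  unfolding stable_equiv_def using mvn_sym by blast

text \<open>More units may be added, so two stable equivalences can be brought to a common number of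
  units.\<close>

lemma stable_lift:
  assumes "mvn_equiv A (dsum n (mat_one n) p) (dsum n (mat_one n) q)"
  shows "mvn_equiv A (dsum (m + n) (mat_one (m + n)) p) (dsum (m + n) (mat_one (m + n)) q)"
  unfolding dsum_mat_one[symmetric] dsum_assoc
  by (intro mvn_dsum mvn_refl mat_one_projs mat_one_mats assms)

lemma stable_trans:
  assumes "stable_equiv A p q" "stable_equiv A q t" "p \<in> projs A" "t \<in> projs A"
  shows "stable_equiv A p t"
proof -
  obtain m n where "mvn_equiv A (dsum m (mat_one m) p) (dsum m (mat_one m) q)"
    "mvn_equiv A (dsum n (mat_one n) q) (dsum n (mat_one n) t)"
    using assms(1,2) unfolding stable_equiv_def by blast
  from stable_lift[OF this(1), of n] stable_lift[OF this(2), of m] show ?thesis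
    unfolding stable_equiv_def add.commute[of n m]
    using mvn_trans[OF _ _ dsum_one_projs[OF assms(3)] dsum_one_projs[OF assms(4)]] by blast
qed

lemma stable_dsum_left:
  assumes pq: "stable_equiv A p q" "p \<in> mats r A" "q \<in> mats s A" and t: "t \<in> projs A"
  shows "stable_equiv A (dsum r p t) (dsum s q t)"
proof -
  obtain n where "mvn_equiv A (dsum n (mat_one n) p) (dsum n (mat_one n) q)"
    using pq(1) unfolding stable_equiv_def by blast
  from mvn_dsum[OF this dsum_mats dsum_mats mvn_refl[OF t]] pq
  have "mvn_equiv A (dsum (n + r) (dsum n (mat_one n) p) t) (dsum (n + s) (dsum n (mat_one n) q) t)"
    by simp
  then show ?thesis unfolding dsum_assoc stable_equiv_def by blast
qed

text \<open>Units are added on the left, so changing the left summand takes only associativity. The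
  right summand is moved to the left by \<open>mvn_dsum_comm\<close>, changed there and moved
  back.\<close>

lemma stable_dsum:
  assumes p: "p \<in> projs A" "p \<in> mats r A" and q: "q \<in> projs A" "q \<in> mats s A"
    and p': "p' \<in> projs A" and q': "q' \<in> projs A"
    and eq: "stable_equiv A p q" "stable_equiv A p' q'"
  shows "stable_equiv A (dsum r p p') (dsum s q q')"
proof -
  obtain m n where m: "p' \<in> mats m A" and n: "q' \<in> mats n A"
    using projsD(1)[OF p'] projsD(1)[OF q'] by (metis mats_infE)
  have 1: "stable_equiv A (dsum r p p') (dsum s q p')"
    by (rule stable_dsum_left[OF eq(1) p(2) q(2) p'])
  have 2: "stable_equiv A (dsum s q p') (dsum m p' q)"
    by (intro mvn_imp_stable mvn_dsum_comm q p' m)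
  have 3: "stable_equiv A (dsum m p' q) (dsum n q' q)"
    by (rule stable_dsum_left[OF eq(2) m n q(1)])
  have 4: "stable_equiv A (dsum n q' q) (dsum s q q')"
    by (intro mvn_imp_stable mvn_dsum_comm q q' n)
  show ?thesis
    by (intro stable_trans[OF 1 stable_trans[OF 2 stable_trans[OF 3 4]]] dsum_projs p q p' q' m n)
qed

subsection \<open>Spectral projections in matrix algebras\<close>

text \<open>\<open>spec_proj_eq\<close> identifies \<open>spec_proj a E\<close> with a matrix
  supplied by \<open>normal_spectral_measure_exists\<close>. Through the last conclusion any
  spectral measure of the operator can be used to compute it.\<close>

lemma spec_proj_normal:
  assumes a: "a \<in> normals A" "a \<in> mats r A" and E: "E \<in> sets borel" "0 \<notin> E"
  shows spec_proj_mats: "spec_proj a E \<in> mats r A" and spec_proj_projs: "spec_proj a E \<in> projs A"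
    and spec_proj_mat_op: "spectral_for (mat_op r a) Q \<Longrightarrow> mat_op r (spec_proj a E) = Q E"
proof -
  have "mat_times (mat_adj a) a = mat_times a (mat_adj a)" using a(1) by (simp add: normals_def)
  then obtain P where P: "spectral_measure r a P" "\<And>E. E \<in> sets borel \<Longrightarrow> P E \<in> mats r A"
    using normal_spectral_measure_exists[OF vn a(2)] by blast
  have ab: "a \<in> mats r bounded_ops" using a(2) by (rule mats_bounded)
  have eq: "spec_proj a E = P E" by (rule spec_proj_eq[OF ab P(1) E])
  show "spec_proj a E \<in> mats r A" unfolding eq by (rule P(2)[OF E(1)])
  have "P E \<in> projs bounded_ops" using P(1) E(1) by (simp add: spectral_measure_def)
  then show "spec_proj a E \<in> projs A"
    unfolding eq using mats_infI[OF P(2)[OF E(1)]] by (simp add: projs_def)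
  show "mat_op r (spec_proj a E) = Q E" if "spectral_for (mat_op r a) Q"
    using spectral_for_unique[OF mat_op_bounded[OF ab] spectral_measure_imp_spectral_for[OF ab P(1)] that E(1)] E(2)
    by (simp add: eq extend_pvm_def)
qed

lemma normal_spectral_for:
  assumes a: "a \<in> normals A" "a \<in> mats r A"
  obtains Q where "spectral_for (mat_op r a) Q"
proof -
  have "mat_times (mat_adj a) a = mat_times a (mat_adj a)" using a(1) by (simp add: normals_def)
  then obtain P where P: "spectral_measure r a P"
    using normal_spectral_measure_exists[OF vn a(2)] by blast
  show ?thesis using spectral_measure_imp_spectral_for[OF mats_bounded[OF a(2)] P] by (rule that)
qed

lemma projs_normals: "p \<in> projs A \<Longrightarrow> p \<in> normals A"
  by (simp add: projs_def normals_def)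

lemma spec_proj_projection:
  assumes p: "p \<in> projs A" and E: "E \<in> sets borel" "0 \<notin> E"
  shows "spec_proj p E = (if 1 \<in> E then p else mat_zero)"
proof -
  obtain r where r: "p \<in> mats r A" using projsD(1)[OF p] by (rule mats_infE)
  have pb: "p \<in> mats r bounded_ops" using r by (rule mats_bounded)
  have "sym_op (mat_op r p)"
    using mat_op_adj[OF pb] by (simp add: projsD(3)[OF p] inner_eq_Re_cinner)
  moreover have "mat_op r p o\<^sub>L mat_op r p = mat_op r p"
    using mat_op_times[OF r, of p] by (simp add: projsD(2)[OF p])
  ultimately have "spectral_for (mat_op r p)
      (\<lambda>E. (if 1 \<in> E then mat_op r p else 0) + (if 0 \<in> E then id_blinfun - mat_op r p else 0))"
    by (rule spectral_for_projection[OF mat_op_bounded[OF pb]])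
  from spec_proj_mat_op[OF projs_normals[OF p] r E this]
  have "mat_op r (spec_proj p E) = mat_op r (if 1 \<in> E then p else mat_zero)" using E(2) by simp
  then show ?thesis
    using spec_proj_mats[OF projs_normals[OF p] r E] r by (intro mat_op_inject[of _ r A _ r]) auto
qed

text \<open>Both the inclusion of the first summand and the shift by \<open>r\<close> intertwine \<open>a\<close>, respectively \<open>b\<close>,
  with \<open>a \<oplus> b\<close>; so they intertwine the spectral projections.\<close>

lemma spec_proj_dsum:
  assumes a: "a \<in> normals A" "a \<in> mats r A" and b: "b \<in> normals A" and E: "E \<in> sets borel" "0 \<notin> E"
  shows "spec_proj (dsum r a b) E = dsum r (spec_proj a E) (spec_proj b E)"
proof -
  obtain s where s: "b \<in> mats s A" using b by (auto simp: normals_def elim: mats_infE)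
  let ?d = "dsum r a b"
  have d: "?d \<in> normals A" "?d \<in> mats (r + s) A"
    by (intro dsum_normals a b, intro dsum_mats a s)
  obtain Qa where Qa: "spectral_for (mat_op r a) Qa" using normal_spectral_for[OF a] .
  obtain Qb where Qb: "spectral_for (mat_op s b) Qb" using normal_spectral_for[OF b s] .
  obtain Qd where Qd: "spectral_for (mat_op (r + s) ?d) Qd" using normal_spectral_for[OF d] .
  note bnd = mat_op_bounded[OF mats_bounded]
  \<comment> \<open>Embeds the first \<open>s\<close> coordinates as the coordinates from
    \<open>r\<close> to \<open>r + s - 1\<close>, the place of \<open>b\<close> in the direct
    sum.\<close>
  define W :: "'h l2 \<Rightarrow>\<^sub>L 'h l2" where "W = (\<Sum>k<s. l2_inj (r + k) o\<^sub>L l2_pr k)"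
  have W: "l2_pr i (W x) = (if r \<le> i \<and> i < r + s then l2_pr (i - r) x else 0)" for i x
  proof -
    have eq: "l2_pr i (W x) = (\<Sum>k<s. if i = r + k then l2_pr k x else 0)"
      by (simp add: W_def blinfun.sum_left blinfun.sum_right)
    show ?thesis
    proof (cases "r \<le> i")
      case True
      then obtain m where "i = r + m" using le_Suc_ex by blast
      then show ?thesis unfolding eq by simp
    next
      case False
      then show ?thesis unfolding eq by (auto intro!: sum.neutral)
    qed
  qed
  have Wb: "W \<in> bounded_ops"
    unfolding bounded_ops_def by (auto intro!: l2_pr_eqI simp: W l2_pr_scaleC)
  have cut: "l2_cut r o\<^sub>L mat_op r a = mat_op (r + s) ?d o\<^sub>L l2_cut r"
  proof (rule blinfun_eqI, rule l2_pr_eqI)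
    fix x i
    show "l2_pr i ((l2_cut r o\<^sub>L mat_op r a) x) = l2_pr i ((mat_op (r + s) ?d o\<^sub>L l2_cut r) x)"
      by (auto simp: l2_pr_cut l2_pr_mat_op sum_lessThan_add dsum_def blin_simps)
  qed
  have shift: "W o\<^sub>L mat_op s b = mat_op (r + s) ?d o\<^sub>L W"
  proof (rule blinfun_eqI, rule l2_pr_eqI)
    fix x i
    show "l2_pr i ((W o\<^sub>L mat_op s b) x) = l2_pr i ((mat_op (r + s) ?d o\<^sub>L W) x)"
      by (auto simp: W l2_pr_mat_op sum_lessThan_add dsum_def blin_simps)
  qed
  let ?p = "spec_proj a E" and ?q = "spec_proj b E" and ?t = "spec_proj ?d E"
  have p: "?p \<in> mats r A" "mat_op r ?p = Qa E" and q: "?q \<in> mats s A" "mat_op s ?q = Qb E"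
    and t: "?t \<in> mats (r + s) A" "mat_op (r + s) ?t = Qd E"
    using spec_proj_mats[OF a E] spec_proj_mat_op[OF a E Qa] spec_proj_mats[OF b s E]
      spec_proj_mat_op[OF b s E Qb] spec_proj_mats[OF d E] spec_proj_mat_op[OF d E Qd] by auto
  have col1: "l2_cut r o\<^sub>L mat_op r ?p = mat_op (r + s) ?t o\<^sub>L l2_cut r"
    unfolding p(2) t(2) using bnd[OF a(2)] bnd[OF d(2)] by (intro spectral_intertwiner[OF _ Qa _ Qd] cut E) simp_all
  have col2: "W o\<^sub>L mat_op s ?q = mat_op (r + s) ?t o\<^sub>L W"
    unfolding q(2) t(2) using bnd[OF s] bnd[OF d(2)] by (intro spectral_intertwiner[OF _ Qb _ Qd] shift Wb E) simp_all
  have "mat_op (r + s) ?t = mat_op (r + s) (dsum r ?p ?q)"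
  proof (rule blinfun_eqI)
    fix x :: "'h l2"
    let ?y = "l2_vec s (\<lambda>k. l2_pr (r + k) x)"
    \<comment> \<open>The ranges of the two embeddings span the first \<open>r + s\<close>
      coordinates, so the two intertwining relations determine the spectral projection of the
      sum.\<close>
    have dec: "l2_cut (r + s) x = l2_cut r x + W ?y"
      by (rule l2_pr_eqI) (auto simp: W l2_pr_cut l2_pr_vec blin_simps)
    have "mat_op (r + s) ?t x = mat_op (r + s) ?t (l2_cut r x) + mat_op (r + s) ?t (W ?y)"
      using mat_op_l2_cut[of "r + s" ?t x] unfolding dec by (simp add: blin_simps)
    also have "\<dots> = l2_cut r (mat_op r ?p x) + W (mat_op s ?q ?y)"
      using arg_cong[OF col1, of "\<lambda>T. blinfun_apply T x"] arg_cong[OF col2, of "\<lambda>T. blinfun_apply T ?y"]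
      by (simp only: blinfun_apply_blinfun_compose)
    also have "\<dots> = mat_op (r + s) (dsum r ?p ?q) x"
      by (rule l2_pr_eqI)
        (auto simp: W l2_pr_cut l2_pr_mat_op l2_pr_vec sum_lessThan_add dsum_def blin_simps)
    finally show "mat_op (r + s) ?t x = mat_op (r + s) (dsum r ?p ?q) x" .
  qed
  then show ?thesis
    by (rule mat_op_inject[OF t(1) dsum_mats[OF p(1) q(1)] A_zero])
qed

end

subsection \<open>Monoids of classes\<close>

text \<open>The common ground of the monoids of projections and of normal elements.
  \<open>R_dsum\<close> lets the sizes \<open>r\<close> and \<open>s\<close> of equivalent
  representatives differ, because the product in \<open>dsum_monoid\<close> ranges over all
  sizes.\<close>

locale dsum_congruence = vn_algebra A
  for A :: "('h::complex_hilbert_space \<Rightarrow>\<^sub>L 'h) set" +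
  fixes X :: "'h opmat set" and R :: "('h opmat \<times> 'h opmat) set"
  assumes equiv_R: "equiv X R"
    and X_mats: "a \<in> X \<Longrightarrow> a \<in> mats_inf A"
    and X_zero: "mat_zero \<in> X"
    and X_dsum: "a \<in> X \<Longrightarrow> b \<in> X \<Longrightarrow> a \<in> mats r A \<Longrightarrow> dsum r a b \<in> X"
    and R_dsum: "(a, a') \<in> R \<Longrightarrow> (b, b') \<in> R \<Longrightarrow> a \<in> mats r A \<Longrightarrow> a' \<in> mats s A \<Longrightarrow>
      (dsum r a b, dsum s a' b') \<in> R"
    and R_comm: "a \<in> X \<Longrightarrow> b \<in> X \<Longrightarrow> a \<in> mats r A \<Longrightarrow> b \<in> mats s A \<Longrightarrow> (dsum r a b, dsum s b a) \<in> R"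
begin

abbreviation "M \<equiv> dsum_monoid A X R"

lemma carrier_M: "carrier M = X // R" and one_M: "\<one>\<^bsub>M\<^esub> = R `` {mat_zero}"
  by (simp_all add: dsum_monoid_def)

lemma class_in_carrier: "a \<in> X \<Longrightarrow> R `` {a} \<in> carrier M"
  by (simp add: carrier_M quotientI)

lemma carrierE:
  assumes "C \<in> carrier M"
  obtains a r where "a \<in> X" "a \<in> mats r A" "C = R `` {a}"
  using assms unfolding carrier_M by (metis X_mats mats_infE quotientE)

lemma R_refl: "a \<in> X \<Longrightarrow> (a, a) \<in> R"
  using equiv_R by (meson equiv_class_self Image_singleton_iff)

lemma class_eq_iff: "a \<in> X \<Longrightarrow> b \<in> X \<Longrightarrow> R `` {a} = R `` {b} \<longleftrightarrow> (a, b) \<in> R"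
  using eq_equiv_class_iff[OF equiv_R] by blast

text \<open>By \<open>R_dsum\<close> all members of the union are the same class, and the index sets
  are nonempty, so the union collapses to that class.\<close>

lemma mult_class:
  assumes a: "a \<in> X" "a \<in> mats r A" and b: "b \<in> X"
  shows "R `` {a} \<otimes>\<^bsub>M\<^esub> R `` {b} = R `` {dsum r a b}"
proof -
  have eq: "R `` {dsum s a' b'} = R `` {dsum r a b}" if "(a, a') \<in> R" "(b, b') \<in> R" "a' \<in> mats s A" for a' b' s
    using R_dsum[OF that(1,2) a(2) that(3)] equiv_class_eq[OF equiv_R] by metis
  have "R `` {a} \<otimes>\<^bsub>M\<^esub> R `` {b} =
      (\<Union>a'\<in>R `` {a}. \<Union>b'\<in>R `` {b}. \<Union>s\<in>{s. a' \<in> mats s A}. R `` {dsum s a' b'})"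
    by (simp add: dsum_monoid_def)
  also have "\<dots> = (\<Union>a'\<in>R `` {a}. \<Union>b'\<in>R `` {b}. \<Union>s\<in>{s. a' \<in> mats s A}. R `` {dsum r a b})"
    by (intro SUP_cong refl) (auto simp: eq)
  also have "\<dots> = R `` {dsum r a b}"
    using R_refl[OF a(1)] R_refl[OF b] a(2) by blast
  finally show ?thesis .
qed

lemma comm_monoid_M: "comm_monoid M"
proof (rule comm_monoidI)
  show "x \<otimes>\<^bsub>M\<^esub> y \<in> carrier M" if "x \<in> carrier M" "y \<in> carrier M" for x y
    using that by (auto elim!: carrierE simp: mult_class intro!: class_in_carrier X_dsum)
  show "\<one>\<^bsub>M\<^esub> \<in> carrier M" unfolding one_M by (rule class_in_carrier[OF X_zero])
  show "x \<otimes>\<^bsub>M\<^esub> y \<otimes>\<^bsub>M\<^esub> z = x \<otimes>\<^bsub>M\<^esub> (y \<otimes>\<^bsub>M\<^esub> z)"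
    if xyz: "x \<in> carrier M" "y \<in> carrier M" "z \<in> carrier M" for x y z
  proof -
    obtain a r where a: "a \<in> X" "a \<in> mats r A" "x = R `` {a}" using xyz(1) by (rule carrierE)
    obtain b s where b: "b \<in> X" "b \<in> mats s A" "y = R `` {b}" using xyz(2) by (rule carrierE)
    obtain c t where c: "c \<in> X" "c \<in> mats t A" "z = R `` {c}" using xyz(3) by (rule carrierE)
    have ab: "dsum r a b \<in> X" "dsum r a b \<in> mats (r + s) A" and bc: "dsum s b c \<in> X"
      using a b c by (auto intro: X_dsum dsum_mats)
    show ?thesis
      unfolding a(3) b(3) c(3)
      by (simp add: mult_class[OF a(1,2) b(1)] mult_class[OF b(1,2) c(1)] mult_class[OF ab c(1)]
          mult_class[OF a(1,2) bc] dsum_assoc)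
  qed
  show "\<one>\<^bsub>M\<^esub> \<otimes>\<^bsub>M\<^esub> x = x" if x: "x \<in> carrier M" for x
  proof -
    obtain a r where a: "a \<in> X" "a \<in> mats r A" "x = R `` {a}" using x by (rule carrierE)
    \<comment> \<open>The zero matrix is taken of size 0, so that its direct sum with
      \<open>a\<close> is \<open>a\<close> itself.\<close>
    show ?thesis unfolding one_M a(3) using mult_class[OF X_zero mat_zero_mats[of 0] a(1)] by simp
  qed
  show "x \<otimes>\<^bsub>M\<^esub> y = y \<otimes>\<^bsub>M\<^esub> x" if xyz: "x \<in> carrier M" "y \<in> carrier M" for x y
  proof -
    obtain a r where a: "a \<in> X" "a \<in> mats r A" "x = R `` {a}" using xyz(1) by (rule carrierE)
    obtain b s where b: "b \<in> X" "b \<in> mats s A" "y = R `` {b}" using xyz(2) by (rule carrierE)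
    show ?thesis
      unfolding a(3) b(3) mult_class[OF a(1,2) b(1)] mult_class[OF b(1,2) a(1)]
      by (rule equiv_class_eq[OF equiv_R R_comm[OF a(1) b(1) a(2) b(2)]])
  qed
qed

end

subsection \<open>Symmetrization\<close>

context comm_monoid
begin

lemma symm_relI:
  "x \<in> carrier G \<Longrightarrow> y \<in> carrier G \<Longrightarrow> x' \<in> carrier G \<Longrightarrow> y' \<in> carrier G \<Longrightarrow> k \<in> carrier G \<Longrightarrow>
    x \<otimes> y' \<otimes> k = x' \<otimes> y \<otimes> k \<Longrightarrow> ((x, y), (x', y')) \<in> symm_rel G"
  by (auto simp: symm_rel_def)

lemma symm_relE:
  assumes "((x, y), (x', y')) \<in> symm_rel G"
  obtains k where "x \<in> carrier G" "y \<in> carrier G" "x' \<in> carrier G" "y' \<in> carrier G" "k \<in> carrier G"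
    "x \<otimes> y' \<otimes> k = x' \<otimes> y \<otimes> k"
  using assms by (auto simp: symm_rel_def)

lemma equiv_symm_rel: "equiv (carrier G \<times> carrier G) (symm_rel G)"
proof (rule equivI)
  show "symm_rel G \<subseteq> (carrier G \<times> carrier G) \<times> carrier G \<times> carrier G"
    by (auto simp: symm_rel_def)
  show "refl_on (carrier G \<times> carrier G) (symm_rel G)"
    by (auto simp: refl_on_def intro!: symm_relI[where k = \<one>])
  show "sym (symm_rel G)"
    by (rule symI) (auto simp: symm_rel_def, metis)
  show "trans (symm_rel G)"
  proof (rule transI, clarify)
    fix x y x' y' x'' y''
    assume "((x, y), (x', y')) \<in> symm_rel G" "((x', y'), (x'', y'')) \<in> symm_rel G"
    then obtain k l where k: "x \<in> carrier G" "y \<in> carrier G" "x' \<in> carrier G" "y' \<in> carrier G" "k \<in> carrier G"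
      "x \<otimes> y' \<otimes> k = x' \<otimes> y \<otimes> k"
      and l: "x'' \<in> carrier G" "y'' \<in> carrier G" "l \<in> carrier G" "x' \<otimes> y'' \<otimes> l = x'' \<otimes> y' \<otimes> l"
      by (auto elim!: symm_relE)
    \<comment> \<open>The factors \<open>k\<close> and \<open>l\<close> come from the two given
      relations; \<open>y'\<close> is what both sides share once these are combined.\<close>
    have "x \<otimes> y'' \<otimes> (y' \<otimes> k \<otimes> l) = (x \<otimes> y' \<otimes> k) \<otimes> (y'' \<otimes> l)"
      using k(1-5) l(1-3) by (simp add: m_ac)
    also have "\<dots> = (x' \<otimes> y'' \<otimes> l) \<otimes> (y \<otimes> k)"
      unfolding k(6) using k(1-5) l(1-3) by (simp add: m_ac)
    also have "\<dots> = x'' \<otimes> y \<otimes> (y' \<otimes> k \<otimes> l)"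
      unfolding l(4) using k(1-5) l(1-3) by (simp add: m_ac)
    finally show "((x, y), (x'', y'')) \<in> symm_rel G"
      using k(1-5) l(1-3) by (intro symm_relI[where k = "y' \<otimes> k \<otimes> l"]) auto
  qed
qed

lemma formal_diff_eq_iff:
  assumes "x \<in> carrier G" "y \<in> carrier G" "x' \<in> carrier G" "y' \<in> carrier G"
  shows "formal_diff G x y = formal_diff G x' y' \<longleftrightarrow> (\<exists>k\<in>carrier G. x \<otimes> y' \<otimes> k = x' \<otimes> y \<otimes> k)"
proof -
  have "formal_diff G x y = formal_diff G x' y' \<longleftrightarrow> ((x, y), (x', y')) \<in> symm_rel G"
    unfolding formal_diff_def using assms by (intro eq_equiv_class_iff[OF equiv_symm_rel]) auto
  then show ?thesis using assms by (auto simp: symm_rel_def)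
qed

lemma carrier_symmetrization: "carrier (symmetrization G) = (carrier G \<times> carrier G) // symm_rel G"
  and one_symmetrization: "\<one>\<^bsub>symmetrization G\<^esub> = formal_diff G \<one> \<one>"
  by (simp_all add: symmetrization_def)

lemma formal_diff_in_carrier:
  "x \<in> carrier G \<Longrightarrow> y \<in> carrier G \<Longrightarrow> formal_diff G x y \<in> carrier (symmetrization G)"
  by (simp add: carrier_symmetrization formal_diff_def quotientI)

lemma symmetrizationE:
  assumes "C \<in> carrier (symmetrization G)"
  obtains x y where "x \<in> carrier G" "y \<in> carrier G" "C = formal_diff G x y"
  using assms unfolding carrier_symmetrization formal_diff_def by (auto elim!: quotientE)

lemma formal_diff_self: "x \<in> carrier G \<Longrightarrow> y \<in> carrier G \<Longrightarrow> (x, y) \<in> formal_diff G x y"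
  unfolding formal_diff_def by (rule equiv_class_self[OF equiv_symm_rel]) simp

lemma in_formal_diffD:
  "(x', y') \<in> formal_diff G x y \<Longrightarrow> ((x, y), (x', y')) \<in> symm_rel G"
  by (simp add: formal_diff_def)

lemma formal_diff_mult:
  assumes x: "x \<in> carrier G" "y \<in> carrier G" and u: "u \<in> carrier G" "v \<in> carrier G"
  shows "formal_diff G x y \<otimes>\<^bsub>symmetrization G\<^esub> formal_diff G u v = formal_diff G (x \<otimes> u) (y \<otimes> v)"
proof -
  have eq: "formal_diff G (x' \<otimes> u') (y' \<otimes> v') = formal_diff G (x \<otimes> u) (y \<otimes> v)"
    if in_d: "(x', y') \<in> formal_diff G x y" "(u', v') \<in> formal_diff G u v" for x' y' u' v'
  proof -
    obtain k l where k: "x' \<in> carrier G" "y' \<in> carrier G" "k \<in> carrier G" "x \<otimes> y' \<otimes> k = x' \<otimes> y \<otimes> k"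
      and l: "u' \<in> carrier G" "v' \<in> carrier G" "l \<in> carrier G" "u \<otimes> v' \<otimes> l = u' \<otimes> v \<otimes> l"
      using in_d[THEN in_formal_diffD] by (auto elim!: symm_relE)
    have "(x \<otimes> u) \<otimes> (y' \<otimes> v') \<otimes> (k \<otimes> l) = (x \<otimes> y' \<otimes> k) \<otimes> (u \<otimes> v' \<otimes> l)"
      using x u k(1-3) l(1-3) by (simp add: m_ac)
    also have "\<dots> = (x' \<otimes> u') \<otimes> (y \<otimes> v) \<otimes> (k \<otimes> l)"
      unfolding k(4) l(4) using x u k(1-3) l(1-3) by (simp add: m_ac)
    finally show ?thesis
      using x u k(1-3) l(1-3) by (subst formal_diff_eq_iff) (auto intro!: bexI[of _ "k \<otimes> l"])
  qed
  have "formal_diff G x y \<otimes>\<^bsub>symmetrization G\<^esub> formal_diff G u v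
      = (\<Union>(x', y')\<in>formal_diff G x y. \<Union>(u', v')\<in>formal_diff G u v. formal_diff G (x' \<otimes> u') (y' \<otimes> v'))"
    by (simp add: symmetrization_def)
  also have "\<dots> = (\<Union>(x', y')\<in>formal_diff G x y. \<Union>(u', v')\<in>formal_diff G u v. formal_diff G (x \<otimes> u) (y \<otimes> v))"
    by (intro SUP_cong refl) (auto simp: eq)
  also have "\<dots> = formal_diff G (x \<otimes> u) (y \<otimes> v)"
    using formal_diff_self[OF x] formal_diff_self[OF u] by auto
  finally show ?thesis .
qed

lemma comm_group_symmetrization: "comm_group (symmetrization G)"
proof (rule comm_groupI)
  fix C assume "C \<in> carrier (symmetrization G)"
  then obtain x y where x: "x \<in> carrier G" "y \<in> carrier G" "C = formal_diff G x y" by (rule symmetrizationE)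
  show "\<one>\<^bsub>symmetrization G\<^esub> \<otimes>\<^bsub>symmetrization G\<^esub> C = C"
    unfolding x(3) one_symmetrization using x(1,2) by (simp add: formal_diff_mult)
  have "formal_diff G y x \<otimes>\<^bsub>symmetrization G\<^esub> C = \<one>\<^bsub>symmetrization G\<^esub>"
    unfolding x(3) one_symmetrization using x(1,2)
    by (auto simp: formal_diff_mult formal_diff_eq_iff m_comm intro!: bexI[of _ \<one>])
  then show "\<exists>D\<in>carrier (symmetrization G). D \<otimes>\<^bsub>symmetrization G\<^esub> C = \<one>\<^bsub>symmetrization G\<^esub>"
    using formal_diff_in_carrier[OF x(2,1)] by blast
qed (auto elim!: symmetrizationE simp: formal_diff_mult one_symmetrization m_ac intro!: formal_diff_in_carrier)

end

text \<open>Functoriality of the symmetrization. The union defining \<open>\<phi>\<close> collapses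
  because a homomorphism carries a witness \<open>k\<close> to the witness
  \<open>\<psi> k\<close>.\<close>

lemma symmetrization_hom:
  assumes M: "comm_monoid M" and N: "comm_monoid N" and \<psi>: "\<psi> \<in> hom M N"
  obtains \<phi> where "\<phi> \<in> hom (symmetrization M) (symmetrization N)"
    "\<And>x y. x \<in> carrier M \<Longrightarrow> y \<in> carrier M \<Longrightarrow> \<phi> (formal_diff M x y) = formal_diff N (\<psi> x) (\<psi> y)"
proof -
  interpret M: comm_monoid M by fact
  interpret N: comm_monoid N by fact
  have closed: "\<psi> x \<in> carrier N" if "x \<in> carrier M" for x using \<psi> that by (auto simp: hom_def)
  define \<phi> where "\<phi> C = (\<Union>(x, y)\<in>C. formal_diff N (\<psi> x) (\<psi> y))" for C
  have \<phi>: "\<phi> (formal_diff M x y) = formal_diff N (\<psi> x) (\<psi> y)" if xy: "x \<in> carrier M" "y \<in> carrier M" for x y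
  proof -
    have eq: "formal_diff N (\<psi> x') (\<psi> y') = formal_diff N (\<psi> x) (\<psi> y)" if in_d: "(x', y') \<in> formal_diff M x y" for x' y'
    proof -
      obtain k where k: "x' \<in> carrier M" "y' \<in> carrier M" "k \<in> carrier M"
        "x \<otimes>\<^bsub>M\<^esub> y' \<otimes>\<^bsub>M\<^esub> k = x' \<otimes>\<^bsub>M\<^esub> y \<otimes>\<^bsub>M\<^esub> k"
        using M.in_formal_diffD[OF in_d] by (auto elim!: M.symm_relE)
      have "\<psi> (x \<otimes>\<^bsub>M\<^esub> y' \<otimes>\<^bsub>M\<^esub> k) = \<psi> (x' \<otimes>\<^bsub>M\<^esub> y \<otimes>\<^bsub>M\<^esub> k)" using k(4) by simp
      then have "\<psi> x \<otimes>\<^bsub>N\<^esub> \<psi> y' \<otimes>\<^bsub>N\<^esub> \<psi> k = \<psi> x' \<otimes>\<^bsub>N\<^esub> \<psi> y \<otimes>\<^bsub>N\<^esub> \<psi> k"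
        using xy k(1-3) by (simp add: hom_mult[OF \<psi>])
      then show ?thesis
        using xy k(1-3) closed by (subst N.formal_diff_eq_iff) (auto intro!: bexI[of _ "\<psi> k"])
    qed
    have "\<phi> (formal_diff M x y) = (\<Union>(x', y')\<in>formal_diff M x y. formal_diff N (\<psi> x) (\<psi> y))"
      unfolding \<phi>_def by (intro SUP_cong refl) (auto simp: eq)
    then show ?thesis using M.formal_diff_self[OF xy] by auto
  qed
  show ?thesis
  proof (rule that[of \<phi>])
    show "\<phi> \<in> hom (symmetrization M) (symmetrization N)"
    proof (rule homI)
      show "\<phi> C \<in> carrier (symmetrization N)" if "C \<in> carrier (symmetrization M)" for C
        using that by (auto elim!: M.symmetrizationE simp: \<phi> closed intro!: N.formal_diff_in_carrier)
      show "\<phi> (C \<otimes>\<^bsub>symmetrization M\<^esub> D) = \<phi> C \<otimes>\<^bsub>symmetrization N\<^esub> \<phi> D"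
        if "C \<in> carrier (symmetrization M)" "D \<in> carrier (symmetrization M)" for C D
        using that
        by (auto elim!: M.symmetrizationE simp: \<phi> closed M.formal_diff_mult N.formal_diff_mult hom_mult[OF \<psi>])
    qed
  qed (rule \<phi>)
qed

section \<open>The congruences on projections and on normal elements\<close>

context vn_algebra
begin

lemma proj_congruence: "dsum_congruence A (projs A) (stable_rel A)"
proof
  show "equiv (projs A) (stable_rel A)"
  proof (rule equivI)
    show "stable_rel A \<subseteq> projs A \<times> projs A" by (auto simp: stable_rel_def)
    show "refl_on (projs A) (stable_rel A)" by (auto simp: refl_on_def stable_rel_def stable_refl)
    show "sym (stable_rel A)" by (auto simp: sym_def stable_rel_def stable_sym)
    show "trans (stable_rel A)" by (auto simp: trans_def stable_rel_def intro: stable_trans)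
  qed
qed (auto simp: stable_rel_def projsD mat_zero_projs intro: dsum_projs stable_dsum mvn_imp_stable mvn_dsum_comm)

lemma admissibleD: "admissible E \<Longrightarrow> E \<in> sets borel" "admissible E \<Longrightarrow> 0 \<notin> E"
  using closure_subset[of E] by (auto simp: admissible_def)

lemma normals_mats: "a \<in> normals A \<Longrightarrow> a \<in> mats_inf A"
  by (simp add: normals_def)

lemma spec_proj_admissible:
  assumes "a \<in> normals A" "admissible E"
  shows "spec_proj a E \<in> projs A"
  using normals_mats[OF assms(1)] spec_proj_projs[OF assms(1) _ admissibleD[OF assms(2)]] by (metis mats_infE)

text \<open>The clauses on direct sums are checked at one admissible \<open>E\<close> at a time,
  where \<open>spec_proj_dsum\<close> turns them into facts about stable equivalence of
  projections.\<close>

lemma normal_congruence: "dsum_congruence A (normals A) (normal_rel A)"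
proof
  show "equiv (normals A) (normal_rel A)"
  proof (rule equivI)
    show "normal_rel A \<subseteq> normals A \<times> normals A" by (auto simp: normal_rel_def)
    show "refl_on (normals A) (normal_rel A)"
      by (auto simp: refl_on_def normal_rel_def normal_equiv_def intro: stable_refl spec_proj_admissible)
    show "sym (normal_rel A)" by (auto simp: sym_def normal_rel_def normal_equiv_def stable_sym)
    show "trans (normal_rel A)"
      by (auto simp: trans_def normal_rel_def normal_equiv_def intro: stable_trans spec_proj_admissible)
  qed
  show "a \<in> mats_inf A" if "a \<in> normals A" for a by (rule normals_mats[OF that])
  show "mat_zero \<in> normals A" by (rule projs_normals[OF mat_zero_projs])
  show "dsum r a b \<in> normals A" if "a \<in> normals A" "b \<in> normals A" "a \<in> mats r A" for a b r
    by (rule dsum_normals[OF that(1,3,2)])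
  show "(dsum r a b, dsum s a' b') \<in> normal_rel A"
    if rel: "(a, a') \<in> normal_rel A" "(b, b') \<in> normal_rel A" and r: "a \<in> mats r A" "a' \<in> mats s A" for a a' b b' r s
  proof -
    have n: "a \<in> normals A" "a' \<in> normals A" "b \<in> normals A" "b' \<in> normals A"
      and eq: "normal_equiv A a a'" "normal_equiv A b b'" using rel by (auto simp: normal_rel_def)
    have "stable_equiv A (spec_proj (dsum r a b) E) (spec_proj (dsum s a' b') E)" if E: "admissible E" for E
      unfolding spec_proj_dsum[OF n(1) r(1) n(3) admissibleD[OF E]] spec_proj_dsum[OF n(2) r(2) n(4) admissibleD[OF E]]
      using eq E
      by (intro stable_dsum spec_proj_admissible n E spec_proj_mats[OF _ _ admissibleD[OF E]] r)
        (auto simp: normal_equiv_def)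
    then show ?thesis using n r by (auto simp: normal_rel_def normal_equiv_def intro: dsum_normals)
  qed
  show "(dsum r a b, dsum s b a) \<in> normal_rel A"
    if n: "a \<in> normals A" "b \<in> normals A" and r: "a \<in> mats r A" "b \<in> mats s A" for a b r s
  proof -
    have "stable_equiv A (spec_proj (dsum r a b) E) (spec_proj (dsum s b a) E)" if E: "admissible E" for E
      unfolding spec_proj_dsum[OF n(1) r(1) n(2) admissibleD[OF E]] spec_proj_dsum[OF n(2) r(2) n(1) admissibleD[OF E]]
      by (intro mvn_imp_stable mvn_dsum_comm spec_proj_admissible n E spec_proj_mats[OF _ _ admissibleD[OF E]] r)
    then show ?thesis using n r by (auto simp: normal_rel_def normal_equiv_def intro: dsum_normals)
  qed
qed

lemma stable_rel_imp_normal_rel: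
  assumes "(p, q) \<in> stable_rel A"
  shows "(p, q) \<in> normal_rel A"
proof -
  have pq: "p \<in> projs A" "q \<in> projs A" "stable_equiv A p q" using assms by (auto simp: stable_rel_def)
  have "stable_equiv A (spec_proj p E) (spec_proj q E)" if E: "admissible E" for E
    using pq(3) stable_refl[OF mat_zero_projs]
    by (simp add: spec_proj_projection[OF pq(1) admissibleD[OF E]] spec_proj_projection[OF pq(2) admissibleD[OF E]])
  then show ?thesis using pq by (simp add: normal_rel_def normal_equiv_def projs_normals)
qed

text \<open>Cancelling a normal \<open>c\<close> on both sides amounts, at the admissible set \<open>{1}\<close>, to cancelling the projection
  \<open>spec_proj c {1}\<close>.\<close>

lemma normal_rel_dsum_projs:
  assumes p: "p \<in> projs A" "p \<in> mats r A" and q: "q \<in> projs A" "q \<in> mats s A"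
    and c: "c \<in> normals A" and rel: "(dsum r p c, dsum s q c) \<in> normal_rel A"
  shows "(dsum r p (spec_proj c {1}), dsum s q (spec_proj c {1})) \<in> stable_rel A"
proof -
  have E: "admissible {1}" by (simp add: admissible_def)
  note E' = admissibleD[OF E]
  have "stable_equiv A (spec_proj (dsum r p c) {1}) (spec_proj (dsum s q c) {1})"
    using rel E by (simp add: normal_rel_def normal_equiv_def)
  then have "stable_equiv A (dsum r p (spec_proj c {1})) (dsum s q (spec_proj c {1}))"
    by (simp add: spec_proj_dsum[OF projs_normals[OF p(1)] p(2) c E'] spec_proj_dsum[OF projs_normals[OF q(1)] q(2) c E']
        spec_proj_projection[OF p(1) E'] spec_proj_projection[OF q(1) E'])
  then show ?thesis
    using p q spec_proj_admissible[OF c E] by (simp add: stable_rel_def dsum_projs)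
qed

end

section \<open>The embedding of the symmetrizations\<close>

theorem proposition1:
  fixes A :: "('h::complex_hilbert_space \<Rightarrow>\<^sub>L 'h) set"
  assumes "von_neumann_algebra A"
  shows "comm_group (K0 A) \<and> comm_group (N0 A) \<and>
    (\<exists>\<phi>. \<phi> \<in> hom (K0 A) (N0 A) \<and> inj_on \<phi> (carrier (K0 A)) \<and>
         (\<forall>p\<in>projs A. \<forall>q\<in>projs A. \<phi> (K0_diff A p q) = N0_diff A p q))"
proof -
  interpret vn_algebra A by (rule vn_algebra.intro) fact
  interpret P: dsum_congruence A "projs A" "stable_rel A" by (rule proj_congruence)
  interpret N: dsum_congruence A "normals A" "normal_rel A" by (rule normal_congruence)
  interpret PM: comm_monoid "proj_monoid A" unfolding proj_monoid_def by (rule P.comm_monoid_M)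
  interpret NM: comm_monoid "normal_monoid A" unfolding normal_monoid_def by (rule N.comm_monoid_M)
  let ?P = "proj_monoid A" and ?N = "normal_monoid A"
  let ?p = "\<lambda>p. stable_rel A `` {p}" and ?n = "\<lambda>a. normal_rel A `` {a}"
  \<comment> \<open>Sends the stable class of a projection to its class as a normal element; the
    union collapses because stable equivalence implies equivalence as normal elements.\<close>
  define \<psi> where "\<psi> C = (\<Union>p\<in>C. ?n p)" for C :: "'h opmat set"
  have \<psi>: "\<psi> (?p p) = ?n p" if p: "p \<in> projs A" for p
  proof -
    have "?n q = ?n p" if "q \<in> ?p p" for q
      using stable_rel_imp_normal_rel[of p q] that equiv_class_eq[OF N.equiv_R, of p q] by simp
    then have "\<psi> (?p p) = (\<Union>q\<in>?p p. ?n p)" unfolding \<psi>_def by simp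
    then show ?thesis using P.R_refl[OF p] by auto
  qed
  have hom: "\<psi> \<in> hom ?P ?N"
  proof (rule homI)
    show "\<psi> C \<in> carrier ?N" if "C \<in> carrier ?P" for C
      using that unfolding proj_monoid_def normal_monoid_def
      by (auto elim!: P.carrierE simp: \<psi> intro!: N.class_in_carrier projs_normals)
    show "\<psi> (C \<otimes>\<^bsub>?P\<^esub> D) = \<psi> C \<otimes>\<^bsub>?N\<^esub> \<psi> D" if "C \<in> carrier ?P" "D \<in> carrier ?P" for C D
      using that unfolding proj_monoid_def normal_monoid_def
      by (auto elim!: P.carrierE simp: \<psi> P.mult_class N.mult_class projs_normals dsum_projs)
  qed
  obtain \<phi> where \<phi>: "\<phi> \<in> hom (symmetrization ?P) (symmetrization ?N)"
    "\<And>x y. x \<in> carrier ?P \<Longrightarrow> y \<in> carrier ?P \<Longrightarrow> \<phi> (formal_diff ?P x y) = formal_diff ?N (\<psi> x) (\<psi> y)"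
    using symmetrization_hom[OF PM.comm_monoid_axioms NM.comm_monoid_axioms hom] by blast
  have inj: "C = D"
    if C: "C \<in> carrier (symmetrization ?P)" and D: "D \<in> carrier (symmetrization ?P)" and eq: "\<phi> C = \<phi> D" for C D
  proof -
    obtain x y where x: "x \<in> carrier ?P" "y \<in> carrier ?P" "C = formal_diff ?P x y" using C by (rule PM.symmetrizationE)
    obtain u v where u: "u \<in> carrier ?P" "v \<in> carrier ?P" "D = formal_diff ?P u v" using D by (rule PM.symmetrizationE)
    have hom_carrier: "\<psi> z \<in> carrier ?N" if "z \<in> carrier ?P" for z using hom that by (auto simp: hom_def)
    have xv: "x \<otimes>\<^bsub>?P\<^esub> v \<in> carrier ?P" and uy: "u \<otimes>\<^bsub>?P\<^esub> y \<in> carrier ?P" using x u by auto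
    have "formal_diff ?N (\<psi> x) (\<psi> y) = formal_diff ?N (\<psi> u) (\<psi> v)"
      using eq x u by (simp add: \<phi>(2))
    \<comment> \<open>Equality in \<open>N0 A\<close> provides a summand \<open>l\<close> that is
      the class of a normal element, whereas equality in \<open>K0 A\<close> asks for the class of a
      projection.\<close>
    then obtain l where l: "l \<in> carrier ?N" "\<psi> x \<otimes>\<^bsub>?N\<^esub> \<psi> v \<otimes>\<^bsub>?N\<^esub> l = \<psi> u \<otimes>\<^bsub>?N\<^esub> \<psi> y \<otimes>\<^bsub>?N\<^esub> l"
      using x u by (auto simp: NM.formal_diff_eq_iff hom_carrier)
    then have l2: "\<psi> (x \<otimes>\<^bsub>?P\<^esub> v) \<otimes>\<^bsub>?N\<^esub> l = \<psi> (u \<otimes>\<^bsub>?P\<^esub> y) \<otimes>\<^bsub>?N\<^esub> l"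
      using x u by (simp add: hom_mult[OF hom])
    obtain p r where p: "p \<in> projs A" "p \<in> mats r A" "x \<otimes>\<^bsub>?P\<^esub> v = ?p p"
      using xv unfolding proj_monoid_def by (rule P.carrierE)
    obtain q s where q: "q \<in> projs A" "q \<in> mats s A" "u \<otimes>\<^bsub>?P\<^esub> y = ?p q"
      using uy unfolding proj_monoid_def by (rule P.carrierE)
    obtain c t where c: "c \<in> normals A" "c \<in> mats t A" "l = ?n c"
      using l(1) unfolding normal_monoid_def by (rule N.carrierE)
    have "?n (dsum r p c) = ?n (dsum s q c)"
      using l2 unfolding p(3) q(3) c(3) \<psi>[OF p(1)] \<psi>[OF q(1)] normal_monoid_def
        N.mult_class[OF projs_normals[OF p(1)] p(2) c(1)] N.mult_class[OF projs_normals[OF q(1)] q(2) c(1)] .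
    then have "(dsum r p c, dsum s q c) \<in> normal_rel A"
      using p q c by (simp add: N.class_eq_iff dsum_normals projs_normals)
    then have rel: "(dsum r p (spec_proj c {1}), dsum s q (spec_proj c {1})) \<in> stable_rel A"
      by (rule normal_rel_dsum_projs[OF p(1,2) q(1,2) c(1)])
    have e: "spec_proj c {1} \<in> projs A"
      by (rule spec_proj_admissible[OF c(1)]) (simp add: admissible_def)
    \<comment> \<open>The class of \<open>spec_proj c {1}\<close> is the summand that replaces
      \<open>l\<close>.\<close>
    have "?p p \<otimes>\<^bsub>?P\<^esub> ?p (spec_proj c {1}) = ?p q \<otimes>\<^bsub>?P\<^esub> ?p (spec_proj c {1})"
      unfolding proj_monoid_def P.mult_class[OF p(1,2) e] P.mult_class[OF q(1,2) e]
      by (rule equiv_class_eq[OF P.equiv_R rel])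
    moreover have "?p (spec_proj c {1}) \<in> carrier ?P"
      unfolding proj_monoid_def by (rule P.class_in_carrier[OF e])
    ultimately show ?thesis
      unfolding x(3) u(3) using x(1,2) u(1,2) p(3) q(3) by (subst PM.formal_diff_eq_iff) auto
  qed
  have "?p p \<in> carrier ?P" if "p \<in> projs A" for p
    unfolding proj_monoid_def by (rule P.class_in_carrier[OF that])
  then have "\<phi> (K0_diff A p q) = N0_diff A p q" if "p \<in> projs A" "q \<in> projs A" for p q
    unfolding K0_diff_def N0_diff_def using that by (simp add: \<phi>(2) \<psi>)
  moreover have "inj_on \<phi> (carrier (symmetrization ?P))"
    by (rule inj_onI) (rule inj)
  ultimately show ?thesis
    using \<phi>(1) PM.comm_group_symmetrization NM.comm_group_symmetrization
    unfolding K0_def N0_def by blast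
qed

end
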